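(* Let $Q=(Q_0,Q_1)$ be an acyclic quiver, $V$ a rank-one representation of $Q$, with $V(a)=v_af_a$ for $a\in Q_1$, and $\sigma\in\mathbb{Z}^{Q_0}$ a weight. Then $V$ is $\sigma$-semistable if and only if the following three conditions hold: (K1) $\sum_{i\in Q_0}\sigma^+(i)\dim V(i)=\sum_{i\in Q_0}\sigma^-(i)\dim V(i)$; (F) $r_i^+(S_i^+)=\dim V(i)$ for every $i\in Q_0$ with $\sigma(i)>0$, and $r_i^-(S_i^-)=\dim V(i)$ for every $i\in Q_0$ with $\sigma(i)<0$; (S) the instance $(D[V],\overline{\infty},\underline{0},f_V)$ of the submodular flow problem is feasible, i.e., there is $\varphi\in\mathbb{R}^A$ with $\varphi(a)\ge0$ for all $a\in A$ and $\partial\varphi\in\mathbf{B}(f_V)$. In addition, condition (S) can be replaced by the following condition: (S)' there is a nonnegative integral flow $\varphi\in\mathbb{Z}_+^A$ such that, for each $i\in Q_0$, $\partial\varphi|_{S_i^+}=\sum_{\ell=1}^{\sigma^+(i)}\chi_{B_\ell}$ for some $B_1,\dots,B_{\sigma^+(i)}\in\mathcal{B}_i^+$ and $\partial\varphi|_{S_i^-}=-\sum_{\ell=1}^{\sigma^-(i)}\chi_{B_\ell}$ for some $B_1,\dots,B_{\sigma^-(i)}\in\mathcal{B}_i^-$.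
   Context: Quiver representations: $Q$ is a finite directed multigraph; $ta$, $ha$ are the tail and head of $a\in Q_1$; $\mathrm{Out}(i)$, $\mathrm{In}(i)$ are the sets of arcs leaving and entering $i$. A representation $V$ consists of finite-dimensional complex vector spaces $V(i)$ ($i\in Q_0$) and linear maps $V(a):V(ta)\to V(ha)$; its dimension vector is $\alpha=(\dim V(i))_i$. With $\mathrm{GL}(Q,\alpha)=\prod_i\mathrm{GL}(\alpha(i))$ and $\chi_\sigma(g)=\prod_i\det(g_i)^{\sigma(i)}$, $V$ is $\sigma$-semistable if $\inf_{g\in\mathrm{GL}(Q,\alpha)}\big(\sum_{a\in Q_1}\|g_{ha}V(a)g_{ta}^{-1}\|_{\mathrm F}^2+|\chi_\sigma(g)|^2\big)>0$ (bases of the $V(i)$ fixed). $\sigma^+(i)=\max\{\sigma(i),0\}$, $\sigma^-(i)=\max\{-\sigma(i),0\}$. Rank-one: $V$ is rank-one if each $V(a)$ has rank one; then $V(a)=v_af_a$ (i.e. $u\mapsto f_a(u)v_a$) with nonzero $v_a\in V(ha)$ and nonzero $f_a\in V(ta)^*$, which we fix. Let $S_i^+=\{f_a:a\in\mathrm{Out}(i)\}$ and $S_i^-=\{v_a:a\in\mathrm{In}(i)\}$ as multisets (elements indexed by distinct arcs are distinct). The directed graph $D[V]=(S,A)$ has vertex set $S$ the disjoint union of all $S_i^+$, $S_i^-$ ($i\in Q_0$), and arc set $$A=\{(f_a,v_a):a\in Q_1\}\cup\{(v_a,f_b): i\in Q_0,\ v_a\in S_i^-,\ f_b\in S_i^+,\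 v_a\notin\ker f_b\}.$$ Matroids: $\mathcal{B}_i^{\pm}=\{B\subseteq S_i^\pm: |B|=\dim\langle B\rangle=\dim\langle S_i^\pm\rangle\}$ is the base family of the linear matroid generated by $S_i^\pm$, with rank function $r_i^\pm(X)=\dim\langle X\rangle$, where $\langle X\rangle$ is the linear span. $\chi_B$ is the characteristic vector of $B$. For $\gamma\in\mathbb{R}^S$ and $T'\subseteq S$, $\gamma|_{T'}$ is the projection to $\mathbb{R}^{T'}$. Submodular flow: for $\varphi\in\mathbb{R}^A$, the boundary is $\partial\varphi(s)=\sum_{a\text{ leaving }s}\varphi(a)-\sum_{a\text{ entering }s}\varphi(a)$, $s\in S$. For $f:2^S\to\mathbb{R}$, $\mathbf{B}(f)=\{x\in\mathbb{R}^S:x(S)=f(S),\ x(X)\le f(X)\ \forall X\subseteq S\}$ with $x(X)=\sum_{s\in X}x(s)$. An instance $(D,\overline c,\underline c,f)$, with $D=(S,A)$ and $f$ submodular with $f(\emptyset)=f(S)=0$, is feasible if there is $\varphi\in\mathbb{R}^A$ with $\underline c\le\varphi\le\overline c$ and $\partial\varphi\in\mathbf{B}(f)$; $\overline\infty$ and $\underline0$ are the capacities constantly $+\infty$ and $0$. The function $f_V:2^S\to\mathbb{R}$ is $$f_V(X)=\sum_{i\in Q_0}\Big(\sigma^+(i)\,r_i^+(S_i^+\cap X)+\sigma^-(i)\,r_i^-(S_i^-\setminus X)-\sigma^-(i)\,r_i^-(S_i^-)\Big);$$ it is submodular, and $f_V(\emptyset)=f_V(S)=0$ whenever (K1) and (F)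 hold. *)

theory Defs
  imports
    "Graph_Theory.Pair_Digraph"
    "Jordan_Normal_Form.DL_Rank"
    "Jordan_Normal_Form.Gauss_Jordan_Elimination"
    "HOL-Library.Extended_Real"
    "HOL-Library.Indicator_Function"
begin

section \<open>Quiver representations and semistability\<close>

text \<open>
  A quiver is a finite directed multigraph \<open>Q\<close> (locale \<^locale>\<open>fin_digraph\<close>). Since
  bases of the spaces \<open>V(i)\<close> are fixed, \<open>V(i)\<close> is the space of complex column vectors of
  length \<open>\<alpha> i\<close>, and a representation is a family of matrices indexed by the arcs.
\<close>

definition acyclic_quiver :: "('v, 'a) pre_digraph \<Rightarrow> bool" where
  "acyclic_quiver Q \<longleftrightarrow> \<not> (\<exists>p. pre_digraph.cycle Q p)"

definition quiver_rep ::
  "('v, 'a) pre_digraph \<Rightarrow> ('v \<Rightarrow> nat) \<Rightarrow> ('a \<Rightarrow> complex mat) \<Rightarrow> bool" where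
  "quiver_rep Q \<alpha> V \<longleftrightarrow> (\<forall>a\<in>arcs Q. V a \<in> carrier_mat (\<alpha> (head Q a)) (\<alpha> (tail Q a)))"

definition GL :: "('v, 'a) pre_digraph \<Rightarrow> ('v \<Rightarrow> nat) \<Rightarrow> ('v \<Rightarrow> complex mat) set" where
  "GL Q \<alpha> = {g. \<forall>i\<in>verts Q. g i \<in> carrier_mat (\<alpha> i) (\<alpha> i) \<and> invertible_mat (g i)}"

definition character ::
  "('v, 'a) pre_digraph \<Rightarrow> ('v \<Rightarrow> int) \<Rightarrow> ('v \<Rightarrow> complex mat) \<Rightarrow> complex" where
  "character Q \<sigma> g = (\<Prod>i\<in>verts Q. det (g i) powi \<sigma> i)"

definition frobenius_norm :: "complex mat \<Rightarrow> real" where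
  "frobenius_norm M = sqrt (\<Sum>i<dim_row M. \<Sum>j<dim_col M. (cmod (M $$ (i, j)))\<^sup>2)"

definition semistable ::
  "('v, 'a) pre_digraph \<Rightarrow> ('v \<Rightarrow> nat) \<Rightarrow> ('a \<Rightarrow> complex mat) \<Rightarrow> ('v \<Rightarrow> int) \<Rightarrow> bool" where
  "semistable Q \<alpha> V \<sigma> \<longleftrightarrow>
     (INF g\<in>GL Q \<alpha>.
        (\<Sum>a\<in>arcs Q. (frobenius_norm
            (g (head Q a) * V a * the (mat_inverse (g (tail Q a)))))\<^sup>2)
        + (cmod (character Q \<sigma> g))\<^sup>2) > 0"

definition pos :: "('v \<Rightarrow> int) \<Rightarrow> 'v \<Rightarrow> int" where
  "pos \<sigma> i = max (\<sigma> i) 0"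

definition neg :: "('v \<Rightarrow> int) \<Rightarrow> 'v \<Rightarrow> int" where
  "neg \<sigma> i = max (- \<sigma> i) 0"

section \<open>Rank-one representations\<close>

definition rank_one_rep ::
  "('v, 'a) pre_digraph \<Rightarrow> ('v \<Rightarrow> nat) \<Rightarrow> ('a \<Rightarrow> complex mat) \<Rightarrow> bool" where
  "rank_one_rep Q \<alpha> V \<longleftrightarrow>
     quiver_rep Q \<alpha> V \<and> (\<forall>a\<in>arcs Q. vec_space.rank (\<alpha> (head Q a)) (V a) = 1)"

text \<open>
  A linear functional is given by its coefficient vector with respect to the dual basis:
  \<open>f a\<close> acts as \<open>u \<mapsto> f a \<bullet> u\<close>, where \<open>\<bullet>\<close> is the bilinear (not sesquilinear)
  product \<^const>\<open>scalar_prod\<close>.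
\<close>

definition rank_one_factors ::
  "('v, 'a) pre_digraph \<Rightarrow> ('v \<Rightarrow> nat) \<Rightarrow> ('a \<Rightarrow> complex mat)
    \<Rightarrow> ('a \<Rightarrow> complex vec) \<Rightarrow> ('a \<Rightarrow> complex vec) \<Rightarrow> bool" where
  "rank_one_factors Q \<alpha> V v f \<longleftrightarrow>
     (\<forall>a\<in>arcs Q.
        v a \<in> carrier_vec (\<alpha> (head Q a)) \<and> v a \<noteq> 0\<^sub>v (\<alpha> (head Q a)) \<and>
        f a \<in> carrier_vec (\<alpha> (tail Q a)) \<and> f a \<noteq> 0\<^sub>v (\<alpha> (tail Q a)) \<and>
        (\<forall>u\<in>carrier_vec (\<alpha> (tail Q a)). V a *\<^sub>v u = scalar_prod (f a) u \<cdot>\<^sub>v v a))"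

text \<open>
  Elements of the multisets \<open>S\<^sub>i\<^sup>+\<close> and \<open>S\<^sub>i\<^sup>-\<close> are labelled by their arcs:
  \<open>Fnl a\<close> stands for \<open>f\<^sub>a\<close> and \<open>Vct a\<close> for \<open>v\<^sub>a\<close>.
\<close>

datatype 'a node = Fnl 'a | Vct 'a

fun node_vec :: "('a \<Rightarrow> complex vec) \<Rightarrow> ('a \<Rightarrow> complex vec) \<Rightarrow> 'a node \<Rightarrow> complex vec" where
  "node_vec v f (Fnl a) = f a"
| "node_vec v f (Vct a) = v a"

definition S_plus :: "('v, 'a) pre_digraph \<Rightarrow> 'v \<Rightarrow> 'a node set" where
  "S_plus Q i = Fnl ` out_arcs Q i"

definition S_minus :: "('v, 'a) pre_digraph \<Rightarrow> 'v \<Rightarrow> 'a node set" where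
  "S_minus Q i = Vct ` in_arcs Q i"

definition rep_digraph ::
  "('v, 'a) pre_digraph \<Rightarrow> ('a \<Rightarrow> complex vec) \<Rightarrow> ('a \<Rightarrow> complex vec)
    \<Rightarrow> ('a node, 'a node \<times> 'a node) pre_digraph" where
  "rep_digraph Q v f = with_proj
     \<lparr> pverts = (\<Union>i\<in>verts Q. S_plus Q i \<union> S_minus Q i),
       parcs = {(Fnl a, Vct a) | a. a \<in> arcs Q} \<union>
               {(Vct a, Fnl b) | a b i. i \<in> verts Q \<and> Vct a \<in> S_minus Q i \<and>
                  Fnl b \<in> S_plus Q i \<and> scalar_prod (f b) (v a) \<noteq> 0} \<rparr>"

section \<open>Linear matroids\<close>

definition (in vec_space) dim_span :: "'a vec set \<Rightarrow> nat" where
  "dim_span W = vectorspace.dim class_ring (span_vs W)"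

text \<open>The ground set \<open>E\<close> is a set of labels; \<open>w\<close> maps each label to its vector.\<close>

definition mrank :: "nat \<Rightarrow> ('s \<Rightarrow> complex vec) \<Rightarrow> 's set \<Rightarrow> nat" where
  "mrank n w X = vec_space.dim_span n (w ` X)"

definition mbases :: "nat \<Rightarrow> ('s \<Rightarrow> complex vec) \<Rightarrow> 's set \<Rightarrow> 's set set" where
  "mbases n w E = {B. B \<subseteq> E \<and> card B = mrank n w B \<and> mrank n w B = mrank n w E}"

section \<open>Submodular flows\<close>

definition boundary ::
  "('s, 'e) pre_digraph \<Rightarrow> ('e \<Rightarrow> 'r::ab_group_add) \<Rightarrow> 's \<Rightarrow> 'r" where
  "boundary D \<phi> s = (\<Sum>e\<in>out_arcs D s. \<phi> e) - (\<Sum>e\<in>in_arcs D s. \<phi> e)"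

text \<open>
  Vectors in \<open>\<real>\<^sup>S\<close> are functions on the whole type, of which only the values on \<open>S\<close> matter.
\<close>

definition base_polytope :: "'s set \<Rightarrow> ('s set \<Rightarrow> real) \<Rightarrow> ('s \<Rightarrow> real) set" where
  "base_polytope S F = {x. sum x S = F S \<and> (\<forall>X\<subseteq>S. sum x X \<le> F X)}"

definition submodular_flow_feasible ::
  "('s, 'e) pre_digraph \<Rightarrow> ('e \<Rightarrow> ereal) \<Rightarrow> ('e \<Rightarrow> ereal) \<Rightarrow> ('s set \<Rightarrow> real) \<Rightarrow> bool" where
  "submodular_flow_feasible D cupper clower F \<longleftrightarrow>
     (\<exists>\<phi> :: 'e \<Rightarrow> real.
        (\<forall>e\<in>arcs D. clower e \<le> ereal (\<phi> e) \<and> ereal (\<phi> e) \<le> cupper e) \<and>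
        boundary D \<phi> \<in> base_polytope (verts D) F)"

definition flow_bound ::
  "('v, 'a) pre_digraph \<Rightarrow> ('v \<Rightarrow> nat) \<Rightarrow> ('a \<Rightarrow> complex vec) \<Rightarrow> ('a \<Rightarrow> complex vec)
    \<Rightarrow> ('v \<Rightarrow> int) \<Rightarrow> 'a node set \<Rightarrow> real" where
  "flow_bound Q \<alpha> v f \<sigma> X =
     (\<Sum>i\<in>verts Q.
        real_of_int (pos \<sigma> i) * real (mrank (\<alpha> i) (node_vec v f) (S_plus Q i \<inter> X))
        + real_of_int (neg \<sigma> i) * real (mrank (\<alpha> i) (node_vec v f) (S_minus Q i - X))
        - real_of_int (neg \<sigma> i) * real (mrank (\<alpha> i) (node_vec v f) (S_minus Q i)))"

section \<open>The conditions of the characterization\<close>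

definition cond_K1 :: "('v, 'a) pre_digraph \<Rightarrow> ('v \<Rightarrow> nat) \<Rightarrow> ('v \<Rightarrow> int) \<Rightarrow> bool" where
  "cond_K1 Q \<alpha> \<sigma> \<longleftrightarrow>
     (\<Sum>i\<in>verts Q. pos \<sigma> i * int (\<alpha> i)) = (\<Sum>i\<in>verts Q. neg \<sigma> i * int (\<alpha> i))"

definition cond_F ::
  "('v, 'a) pre_digraph \<Rightarrow> ('v \<Rightarrow> nat) \<Rightarrow> ('a \<Rightarrow> complex vec) \<Rightarrow> ('a \<Rightarrow> complex vec)
    \<Rightarrow> ('v \<Rightarrow> int) \<Rightarrow> bool" where
  "cond_F Q \<alpha> v f \<sigma> \<longleftrightarrow>
     (\<forall>i\<in>verts Q. \<sigma> i > 0 \<longrightarrow> mrank (\<alpha> i) (node_vec v f) (S_plus Q i) = \<alpha> i) \<and>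
     (\<forall>i\<in>verts Q. \<sigma> i < 0 \<longrightarrow> mrank (\<alpha> i) (node_vec v f) (S_minus Q i) = \<alpha> i)"

definition cond_S ::
  "('v, 'a) pre_digraph \<Rightarrow> ('v \<Rightarrow> nat) \<Rightarrow> ('a \<Rightarrow> complex vec) \<Rightarrow> ('a \<Rightarrow> complex vec)
    \<Rightarrow> ('v \<Rightarrow> int) \<Rightarrow> bool" where
  "cond_S Q \<alpha> v f \<sigma> \<longleftrightarrow>
     submodular_flow_feasible (rep_digraph Q v f) (\<lambda>_. \<infinity>) (\<lambda>_. 0) (flow_bound Q \<alpha> v f \<sigma>)"

definition cond_S' ::
  "('v, 'a) pre_digraph \<Rightarrow> ('v \<Rightarrow> nat) \<Rightarrow> ('a \<Rightarrow> complex vec) \<Rightarrow> ('a \<Rightarrow> complex vec)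
    \<Rightarrow> ('v \<Rightarrow> int) \<Rightarrow> bool" where
  "cond_S' Q \<alpha> v f \<sigma> \<longleftrightarrow>
     (\<exists>\<phi> :: 'a node \<times> 'a node \<Rightarrow> int.
        (\<forall>e\<in>arcs (rep_digraph Q v f). 0 \<le> \<phi> e) \<and>
        (\<forall>i\<in>verts Q.
           (\<exists>B. (\<forall>l\<in>{1..nat (pos \<sigma> i)}. B l \<in> mbases (\<alpha> i) (node_vec v f) (S_plus Q i)) \<and>
                (\<forall>s\<in>S_plus Q i. boundary (rep_digraph Q v f) \<phi> s
                   = (\<Sum>l = 1..nat (pos \<sigma> i). indicator (B l) s))) \<and>
           (\<exists>B. (\<forall>l\<in>{1..nat (neg \<sigma> i)}. B l \<in> mbases (\<alpha> i) (node_vec v f) (S_minus Q i)) \<and>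
                (\<forall>s\<in>S_minus Q i. boundary (rep_digraph Q v f) \<phi> s
                   = - (\<Sum>l = 1..nat (neg \<sigma> i). indicator (B l) s)))))"

end

theory Submission
  imports Defs "HOL-Analysis.L2_Norm"
begin

text \<open>
  Semistability implies (K1) and (F), and \<open>f\<^sub>V(X) \<ge> 0\<close> for every set \<open>X\<close> of nodes that no arc of
  \<open>D[V]\<close> enters: otherwise \<open>X\<close> determines a subrepresentation of positive weight, and the
  one-parameter subgroup contracting it, corrected by a scaling along a height function of the acyclic
  quiver, sends both the arcs and the character to \<open>0\<close>.

  Since all capacities are infinite, an integral flow as in (S)' amounts to a matching, along
  reachability in \<open>D[V]\<close>, of bases of \<open>\<sigma>\<^sup>+(i)\<close> copies of the matroids on \<open>S\<^sub>i\<^sup>+\<close> with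
  bases of \<open>\<sigma>\<^sup>-(i)\<close> copies of those on \<open>S\<^sub>i\<^sup>-\<close>. The matroid intersection theorem on the set of
  reachable pairs provides it under the cut condition, which is also a trivial consequence of (S).

  Conversely, given (S)', take the logarithms of \<open>\<parallel>g v\<^sub>a\<parallel>\<close> and \<open>\<parallel>f\<^sub>a g\<^sup>-\<^sup>1\<parallel>\<close> as node potentials.
  Small arcs and the invariance of \<open>f\<^sub>b(v\<^sub>a)\<close> bound the potential differences along the arcs
  of \<open>D[V]\<close>, and Hadamard's inequality on the bases \<open>B\<^sub>l\<close> bounds \<open>det g\<^sub>i\<close>; summing against the
  flow bounds the character away from \<open>0\<close>.
\<close>

section \<open>Matroid intersection\<close>

text \<open>The obstacle on the analytic side is that the energy adds the arcs to the character, so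
  a lower bound for it says nothing directly about the character of elements whose arcs are merely
  bounded. Acyclicity repairs this: a fixed scaling along the height makes bounded arcs as small as
  desired, at the cost of a factor in the character that does not depend on the group element. A
  destabilising subgroup then only has to keep the arcs bounded.

  Rank one is what makes the problem combinatorial. A subrepresentation respects an arc exactly if
  \<open>f a\<close> vanishes on it at the tail or \<open>v a\<close> lies in it at the head, and
  the norm of an arc is a product of two node terms, so that its logarithm is a potential
  difference.

  The opposite signs of the boundary on \<open>S_plus\<close> and \<open>S_minus\<close> come from
  the action: \<open>g\<close> acts on vectors and its inverse transpose on functionals, so a base
  of vectors bounds |det g| from above and a base of functionals bounds it from below.\<close>

text \<open>Matroids are represented by rank functions alone, with integer values so that
  contraction can subtract 1. The axioms speak of subsets of \<open>E\<close> only, so deletion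
  keeps the same function. Loops and parallel elements are allowed; the latter arise when ranks are
  pulled back to pairs of nodes.\<close>

definition rank_function :: "'e set \<Rightarrow> ('e set \<Rightarrow> int) \<Rightarrow> bool" where
  "rank_function E r \<longleftrightarrow> r {} = 0 \<and> (\<forall>e\<in>E. r {e} \<le> 1) \<and>
     (\<forall>A B. A \<subseteq> B \<longrightarrow> B \<subseteq> E \<longrightarrow> r A \<le> r B) \<and>
     (\<forall>A B. A \<subseteq> E \<longrightarrow> B \<subseteq> E \<longrightarrow> r (A \<union> B) + r (A \<inter> B) \<le> r A + r B)"

lemma rank_functionD:
  assumes "rank_function E r"
  shows "r {} = 0" "e \<in> E \<Longrightarrow> r {e} \<le> 1" "A \<subseteq> B \<Longrightarrow> B \<subseteq> E \<Longrightarrow> r A \<le> r B"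
    "A \<subseteq> E \<Longrightarrow> B \<subseteq> E \<Longrightarrow> r (A \<union> B) + r (A \<inter> B) \<le> r A + r B"
  using assms by (auto simp: rank_function_def)

lemma rank_function_delete: "rank_function E r \<Longrightarrow> rank_function (E - {e}) r"
  unfolding rank_function_def by (meson Diff_subset DiffD1 subset_trans)

lemma rank_function_contract:
  assumes r: "rank_function E r" and e: "e \<in> E" "r {e} = 1"
  shows "rank_function (E - {e}) (\<lambda>A. r (insert e A) - 1)"
  unfolding rank_function_def
proof (intro conjI ballI allI impI)
  show "r {e} - 1 = 0" using e by simp
next
  fix x assume x: "x \<in> E - {e}"
  then show "r {e, x} - 1 \<le> 1"
    using rank_functionD(4)[OF r, of "{e}" "{x}"] rank_functionD(2)[OF r, of x]
      rank_functionD(1)[OF r] e by (auto simp: insert_commute)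
next
  fix A B assume "A \<subseteq> B" "B \<subseteq> E - {e}"
  then have "insert e A \<subseteq> insert e B" "insert e B \<subseteq> E" using e by auto
  then show "r (insert e A) - 1 \<le> r (insert e B) - 1"
    using rank_functionD(3)[OF r, of "insert e A" "insert e B"] by linarith
next
  fix A B assume "A \<subseteq> E - {e}" "B \<subseteq> E - {e}"
  then show "r (insert e (A \<union> B)) - 1 + (r (insert e (A \<inter> B)) - 1)
      \<le> r (insert e A) - 1 + (r (insert e B) - 1)"
    using rank_functionD(4)[OF r, of "insert e A" "insert e B"] e by auto
qed

text \<open>
  An element \<open>e\<close> that is a loop in neither matroid is deleted or contracted. If both
  smaller instances violated the hypothesis, adding the two violated inequalities would
  contradict it for the original instance, by submodularity.
\<close>

theorem matroid_intersection:
  assumes "finite E" "rank_function E r1" "rank_function E r2"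
    and "\<And>A. A \<subseteq> E \<Longrightarrow> int k \<le> r1 A + r2 (E - A)"
  shows "\<exists>I\<subseteq>E. card I = k \<and> r1 I = int k \<and> r2 I = int k"
  using assms
proof (induction "card E" arbitrary: E r1 r2 k)
  case 0
  then have E: "E = {}" by simp
  with 0 have "r1 {} = 0" "r2 {} = 0" using rank_functionD(1) by blast+
  with 0(5)[of "{}"] E have "k = 0" by simp
  with E \<open>r1 {} = 0\<close> \<open>r2 {} = 0\<close> show ?case by auto
next
  case (Suc m)
  note r1 = rank_functionD[OF Suc.prems(2)] and r2 = rank_functionD[OF Suc.prems(3)]
  show ?case
  proof (cases "k = 0")
    case True
    with r1(1) r2(1) show ?thesis by (intro exI[of _ "{}"]) auto
  next
    case False
    \<comment> \<open>If every element were a loop of one of the two matroids, the hypothesis for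
      the set \<open>?A\<close> of loops of \<open>r1\<close> would read \<open>k\<close> \<le>
      0.\<close>
    have "\<exists>e\<in>E. r1 {e} = 1 \<and> r2 {e} = 1"
    proof (rule ccontr)
      assume nl: "\<not> (\<exists>e\<in>E. r1 {e} = 1 \<and> r2 {e} = 1)"
      then have loop: "r1 {e} = 0 \<or> r2 {e} = 0" if "e \<in> E" for e
      proof -
        have "0 \<le> r1 {e}" "0 \<le> r2 {e}" using that r1(1) r2(1) r1(3)[of "{}" "{e}"] r2(3)[of "{}" "{e}"] by auto
        moreover have "r1 {e} \<le> 1" "r2 {e} \<le> 1" using that r1(2) r2(2) by auto
        moreover have "r1 {e} \<noteq> 1 \<or> r2 {e} \<noteq> 1" using that nl by blast
        ultimately show ?thesis by linarith
      qed
      have zero: "r A = 0" if "rank_function E r" "finite A" "A \<subseteq> E" "\<And>e. e \<in> A \<Longrightarrow> r {e} = 0" for r A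
        using that(2-)
      proof (induction A)
        case empty then show ?case using rank_functionD(1)[OF that(1)] by simp
      next
        case (insert x A)
        have "r (insert x A) + r ({x} \<inter> A) \<le> r {x} + r A"
          using rank_functionD(4)[OF that(1), of "{x}" A] insert by simp
        moreover have "r A = 0" "r {x} = 0" using insert by auto
        moreover have "0 \<le> r (insert x A)" "{x} \<inter> A = {}"
          using rank_functionD(1)[OF that(1)] rank_functionD(3)[OF that(1), of "{}" "insert x A"] insert by auto
        ultimately show ?case using rank_functionD(1)[OF that(1)] by simp
      qed
      let ?A = "{e\<in>E. r1 {e} = 0}"
      have "r1 ?A = 0" by (rule zero[OF Suc.prems(2)]) (use Suc.prems(1) in auto)
      moreover have "r2 (E - ?A) = 0" by (rule zero[OF Suc.prems(3)]) (use Suc.prems(1) loop in auto)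
      ultimately show False using Suc.prems(4)[of ?A] False by auto
    qed
    then obtain e where e: "e \<in> E" "r1 {e} = 1" "r2 {e} = 1" by blast
    let ?E = "E - {e}"
    have cE: "m = card ?E" "finite ?E" using Suc.hyps(2) Suc.prems(1) e by auto
    \<comment> \<open>Deletion keeps \<open>k\<close>. Contraction asks for \<open>k - 1\<close>
      with both ranks lowered by 1, which becomes the bound \<open>k + 1\<close> once
      \<open>e\<close> is added on both sides.\<close>
    have "(\<forall>A\<subseteq>?E. int k \<le> r1 A + r2 (?E - A)) \<or>
      (\<forall>A\<subseteq>?E. int k + 1 \<le> r1 (insert e A) + r2 (insert e (?E - A)))"
    proof (rule ccontr)
      assume "\<not> ?thesis"
      then obtain A B where A: "A \<subseteq> ?E" "r1 A + r2 (?E - A) < int k"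
        and B: "B \<subseteq> ?E" "r1 (insert e B) + r2 (insert e (?E - B)) < int k + 1"
        unfolding not_le de_Morgan_disj by (auto simp: not_le)
      \<comment> \<open>The failing sets cut \<open>E\<close> at \<open>A\<close> and at
        \<open>?C\<close>. By integrality their sums add up to at most 2k - 1, while uncrossing them
        to \<open>A \<inter> ?C\<close> and \<open>A \<union> ?C\<close> leaves at least 2k.\<close>
      let ?C = "insert e B"
      have e1: "insert e (?E - B) = E - B" using B e by auto
      have "r1 (A \<union> ?C) + r1 (A \<inter> ?C) \<le> r1 A + r1 ?C"
        using A B e by (intro r1(4)) auto
      moreover have "r2 (E - (A \<inter> ?C)) + r2 (E - (A \<union> ?C)) \<le> r2 (?E - A) + r2 (E - B)"
      proof -
        have "(?E - A) \<union> (E - B) = E - (A \<inter> ?C)" "(?E - A) \<inter> (E - B) = E - (A \<union> ?C)"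
          using A B e by auto
        then show ?thesis using r2(4)[of "?E - A" "E - B"] by auto
      qed
      moreover have "int k \<le> r1 (A \<inter> ?C) + r2 (E - (A \<inter> ?C))"
        using A by (intro Suc.prems(4)) auto
      moreover have "int k \<le> r1 (A \<union> ?C) + r2 (E - (A \<union> ?C))"
        using A B e by (intro Suc.prems(4)) auto
      ultimately show False using A(2) B(2) unfolding e1 by linarith
    qed
    then show ?thesis
    proof
      assume "\<forall>A\<subseteq>?E. int k \<le> r1 A + r2 (?E - A)"
      then have "\<exists>I\<subseteq>?E. card I = k \<and> r1 I = int k \<and> r2 I = int k"
        using Suc.prems(2,3) by (intro Suc.hyps(1)[OF cE] rank_function_delete) simp_all
      then show ?thesis by blast
    next
      assume *: "\<forall>A\<subseteq>?E. int k + 1 \<le> r1 (insert e A) + r2 (insert e (?E - A))"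
      have "\<exists>I\<subseteq>?E. card I = k - 1 \<and> r1 (insert e I) - 1 = int (k - 1) \<and> r2 (insert e I) - 1 = int (k - 1)"
      proof (intro Suc.hyps(1)[OF cE] rank_function_contract Suc.prems e)
        fix A assume "A \<subseteq> ?E"
        with * have "int k + 1 \<le> r1 (insert e A) + r2 (insert e (?E - A))" by blast
        then show "int (k - 1) \<le> r1 (insert e A) - 1 + (r2 (insert e (?E - A)) - 1)"
          using False by simp
      qed
      then obtain I where I: "I \<subseteq> ?E" "card I = k - 1" "r1 (insert e I) - 1 = int (k - 1)"
        "r2 (insert e I) - 1 = int (k - 1)" by blast
      have "finite I" "e \<notin> I" using I(1) finite_subset[OF I(1) cE(2)] by blast+
      then have "card (insert e I) = k" "r1 (insert e I) = int k" "r2 (insert e I) = int k"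
        using I False by simp_all
      moreover have "insert e I \<subseteq> E" using I e by blast
      ultimately show ?thesis by blast
    qed
  qed
qed

section \<open>Projections and ranks\<close>

text \<open>The products \<open>?L * ?M\<close> and \<open>?N * ?L\<close> are the same block
  matrix. Since \<open>?L\<close> has determinant 1 and \<open>?M\<close>, \<open>?N\<close> are
  block triangular, comparing determinants moves the problem from size \<open>n\<close> to size
  1.\<close>

lemma det_one_plus_rank_one:
  fixes U W :: "'a::field mat"
  assumes U: "U \<in> carrier_mat n 1" and W: "W \<in> carrier_mat 1 n"
  shows "det (1\<^sub>m n + U * W) = 1 + (W * U) $$ (0, 0)"
proof -
  have UW: "U * W \<in> carrier_mat n n" and WU: "W * U \<in> carrier_mat 1 1" using U W by auto
  let ?L = "four_block_mat (1\<^sub>m n) (0\<^sub>m n 1) W (1\<^sub>m 1)"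
  let ?M = "four_block_mat (1\<^sub>m n + U * W) U (0\<^sub>m 1 n) (1\<^sub>m 1)"
  let ?N = "four_block_mat (1\<^sub>m n) U (0\<^sub>m 1 n) (1\<^sub>m 1 + W * U)"
  have M: "?M \<in> carrier_mat (n + 1) (n + 1)" and N: "?N \<in> carrier_mat (n + 1) (n + 1)"
    and L: "?L \<in> carrier_mat (n + 1) (n + 1)"
    using U W by auto
  have dL: "det ?L = 1"
    using W by (subst det_four_block_mat_upper_right_zero[of _ n _ 1]) auto
  have "W * (1\<^sub>m n + U * W) = W + W * U * W"
    using U W UW by (simp add: mult_add_distrib_mat[OF W _ UW])
  then have LM: "?L * ?M = four_block_mat (1\<^sub>m n + U * W) U (W + W * U * W) (W * U + 1\<^sub>m 1)"
    using U W UW WU by (subst mult_four_block_mat[of _ n n _ 1 _ 1 _ _ n _ 1]) auto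
  have "0\<^sub>m 1 n + (W * U + 1\<^sub>m 1) * W = W * U * W + W"
    using U W WU by (simp add: add_mult_distrib_mat[OF WU _ W])
  moreover have "W * U * W + W = W + W * U * W"
    using W WU by (intro comm_add_mat[of _ 1 n]) auto
  moreover have "1\<^sub>m 1 + W * U = W * U + 1\<^sub>m 1"
    using WU by (intro comm_add_mat[of _ 1 1]) auto
  ultimately have NL: "?N * ?L = four_block_mat (1\<^sub>m n + U * W) U (W + W * U * W) (W * U + 1\<^sub>m 1)"
    using U W UW WU by (subst mult_four_block_mat[of _ n n _ 1 _ 1 _ _ n _ 1]) auto
  have "det ?M = det (?L * ?M)" using det_mult[OF L M] dL by simp
  also have "\<dots> = det (?N * ?L)" by (simp only: LM NL)
  also have "\<dots> = det ?N" using det_mult[OF N L] dL by simp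
  finally have "det ?M = det ?N" .
  moreover have "det ?M = det (1\<^sub>m n + U * W)"
    using U UW by (subst det_four_block_mat_lower_left_zero[of _ n _ 1]) auto
  moreover have "det ?N = det (1\<^sub>m 1 + W * U)"
    using U WU by (subst det_four_block_mat_lower_left_zero[of _ n _ 1]) auto
  moreover have "det (1\<^sub>m 1 + W * U) = 1 + (W * U) $$ (0, 0)"
    using U W by (subst det_single[OF add_carrier_mat[OF WU]], subst index_add_mat) auto
  ultimately show ?thesis by simp
qed

text \<open>No conjugation: functionals are coefficient vectors for the bilinear product, so this is
  the matrix of \<open>y\<close> \<mapsto> f(y) u.\<close>

definition outer_prod :: "'a::semiring_0 vec \<Rightarrow> 'a vec \<Rightarrow> 'a mat" where
  "outer_prod u f = mat (dim_vec u) (dim_vec f) (\<lambda>(i, j). u $ i * f $ j)"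

lemma outer_prod_carrier [simp, intro]:
  "u \<in> carrier_vec m \<Longrightarrow> f \<in> carrier_vec n \<Longrightarrow> outer_prod u f \<in> carrier_mat m n"
  by (auto simp: outer_prod_def)

lemma outer_prod_mult_vec:
  fixes u f y :: "'a::comm_semiring_0 vec"
  assumes "u \<in> carrier_vec m" "f \<in> carrier_vec n" "y \<in> carrier_vec n"
  shows "outer_prod u f *\<^sub>v y = (f \<bullet> y) \<cdot>\<^sub>v u"
  using assms
  by (intro eq_vecI) (auto simp: outer_prod_def scalar_prod_def sum_distrib_right sum_distrib_left ac_simps intro!: sum.cong)

lemma transpose_outer_prod:
  "(outer_prod u f)\<^sup>T = outer_prod f (u :: 'a::comm_semiring_0 vec)"
  by (rule eq_matI) (auto simp: outer_prod_def mult.commute)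

lemma det_one_plus_outer_prod:
  fixes u f :: "'a::field vec"
  assumes u: "u \<in> carrier_vec n" and f: "f \<in> carrier_vec n"
  shows "det (1\<^sub>m n + c \<cdot>\<^sub>m outer_prod u f) = 1 + c * (f \<bullet> u)"
proof -
  let ?U = "mat n 1 (\<lambda>(i, j). u $ i)" and ?W = "mat 1 n (\<lambda>(i, j). c * f $ j)"
  have "c \<cdot>\<^sub>m outer_prod u f = ?U * ?W"
    using u f by (intro eq_matI) (auto simp: outer_prod_def scalar_prod_def)
  moreover have "(?W * ?U) $$ (0, 0) = c * (f \<bullet> u)"
    using u f by (auto simp: scalar_prod_def sum_distrib_left mult.assoc)
  ultimately show ?thesis using det_one_plus_rank_one[of ?U n ?W] by simp
qed

lemma mat_eq_by_action:
  fixes A B :: "'a::comm_semiring_1 mat"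
  assumes A: "A \<in> carrier_mat m n" and B: "B \<in> carrier_mat m n"
    and eq: "\<And>y. y \<in> carrier_vec n \<Longrightarrow> A *\<^sub>v y = B *\<^sub>v y"
  shows "A = B"
proof (rule eq_matI)
  fix i j assume ij: "i < dim_row B" "j < dim_col B"
  then have "(A *\<^sub>v unit_vec n j) $ i = (B *\<^sub>v unit_vec n j) $ i" using eq by simp
  then show "A $$ (i, j) = B $$ (i, j)" using ij A B by (simp add: scalar_prod_right_unit)
qed (use A B in auto)

section \<open>Idempotents adapted to a span or to an annihilator\<close>

context vec_space
begin

lemma fixed_space_submodule:
  assumes P: "P \<in> carrier_mat n n"
  shows "submodule class_ring {u \<in> carrier_vec n. P *\<^sub>v u = u} V"
  using P
  by (auto simp: submodule_def module_axioms mult_add_distrib_mat_vec[OF P] mult_mat_vec[OF P])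

lemma fixed_on_span:
  assumes "P \<in> carrier_mat n n" "W \<subseteq> carrier_vec n" "\<And>w. w \<in> W \<Longrightarrow> P *\<^sub>v w = w" "x \<in> span W"
  shows "P *\<^sub>v x = x"
  using span_is_subset[OF _ fixed_space_submodule[OF assms(1)], of W] assms by auto

lemma dim_span_empty: "dim_span {} = 0"
proof -
  have "maximal {} (\<lambda>T. T \<subseteq> {} \<and> lin_indpt T)"
    by (auto simp: maximal_def lin_dep_def)
  from dim_span[OF _ _ this] show ?thesis by (simp add: dim_span_def)
qed

lemma span_insert_in:
  assumes "W \<subseteq> carrier_vec n" "x \<in> span W"
  shows "span (insert x W) = span W"
proof
  have "x \<in> carrier_vec n" using assms span_closed by auto
  then show "span W \<subseteq> span (insert x W)" using assms by (intro span_is_monotone) auto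
  show "span (insert x W) \<subseteq> span W"
    using assms span_is_submodule[of W] in_own_span[of W] by (intro span_is_subset) auto
qed

lemma dim_span_insert_in:
  assumes "W \<subseteq> carrier_vec n" "x \<in> span W"
  shows "dim_span (insert x W) = dim_span W"
  using span_insert_in[OF assms] by (simp add: dim_span_def)

text \<open>A maximal independent subset of \<open>W\<close> becomes a maximal independent subset of
  \<open>insert x W\<close> when \<open>x\<close> is added to it.\<close>

lemma dim_span_insert_notin:
  assumes W: "finite W" "W \<subseteq> carrier_vec n" and x: "x \<in> carrier_vec n" "x \<notin> span W"
  shows "dim_span (insert x W) = Suc (dim_span W)"
proof -
  have "lin_indpt {}" by (auto simp: lin_dep_def)
  then obtain U where U: "finite U" "maximal U (\<lambda>T. T \<subseteq> W \<and> lin_indpt T)"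
    using maximal_exists_superset[of W "\<lambda>T. T \<subseteq> W \<and> lin_indpt T" "{}"] W(1) by blast
  then have UW: "U \<subseteq> W" and ind: "lin_indpt U" by (auto simp: maximal_def)
  have xU: "x \<notin> span U" using x(2) span_is_monotone[OF UW] by blast
  moreover have "U \<subseteq> span U" using UW W by (intro in_own_span) auto
  ultimately have "x \<notin> U" by blast
  have indx: "lin_indpt (insert x U)"
    using lin_dep_iff_in_span[of U x] UW W x ind xU \<open>x \<notin> U\<close> by auto
  have "maximal (insert x U) (\<lambda>T. T \<subseteq> insert x W \<and> lin_indpt T)"
    unfolding maximal_def
  proof (intro conjI allI impI)
    show "insert x U \<subseteq> insert x W" using UW by auto
    show "lin_indpt (insert x U)" by (rule indx)
    fix B assume B: "insert x U \<subseteq> B \<and> B \<subseteq> insert x W \<and> lin_indpt B"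
    then have "lin_indpt (B - {x})" using supset_ld_is_ld[of "B - {x}" B] by auto
    moreover have "U \<subseteq> B - {x}" "B - {x} \<subseteq> W" using B \<open>x \<notin> U\<close> by auto
    ultimately have "B - {x} = U" using U(2) unfolding maximal_def by blast
    then show "B = insert x U" using B by auto
  qed
  then have "dim_span (insert x W) = card (insert x U)"
    unfolding dim_span_def using W x by (intro dim_span) auto
  moreover have "dim_span W = card U"
    unfolding dim_span_def using W U by (intro dim_span) auto
  ultimately show ?thesis using \<open>x \<notin> U\<close> U(1) by simp
qed

text \<open>One induction supplies all that a one-parameter subgroup needs: the idempotent, its
  effect on vectors and functionals, and the determinant. A vector outside the span adds a rank-one
  idempotent \<open>R\<close> with P R = R P = 0. Hence 1 + (s - 1)(P + R) factors into the
  corresponding terms of \<open>P\<close> and \<open>R\<close>, and the determinant gains one factor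
  \<open>s\<close> as the dimension grows by 1.\<close>

lemma projection_onto_span:
  assumes "finite W" "W \<subseteq> carrier_vec n"
  shows "\<exists>P\<in>carrier_mat n n. P * P = P \<and> (\<forall>w\<in>W. P *\<^sub>v w = w) \<and>
    (\<forall>y\<in>carrier_vec n. P *\<^sub>v y \<in> span W) \<and>
    (\<forall>f\<in>carrier_vec n. (\<forall>w\<in>W. f \<bullet> w = 0) \<longrightarrow> P\<^sup>T *\<^sub>v f = 0\<^sub>v n) \<and>
    (\<forall>s. det (1\<^sub>m n + (s - 1) \<cdot>\<^sub>m P) = s ^ dim_span W)"
  using assms
proof (induction W)
  case empty
  have "0\<^sub>m n n *\<^sub>v y = 0\<^sub>v n" if "y \<in> carrier_vec n" for y :: "'a vec"
    using that by (intro eq_vecI) auto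
  moreover have "(0\<^sub>m n n)\<^sup>T = (0\<^sub>m n n :: 'a mat)" by (intro eq_matI) auto
  moreover have "1\<^sub>m n + c \<cdot>\<^sub>m 0\<^sub>m n n = (1\<^sub>m n :: 'a mat)" for c by (intro eq_matI) auto
  ultimately show ?case
    by (intro bexI[of _ "0\<^sub>m n n"]) (auto simp: dim_span_empty span_empty)
next
  case (insert x W)
  then have W: "W \<subseteq> carrier_vec n" and x: "x \<in> carrier_vec n" by auto
  from insert.IH[OF W] obtain P where P: "P \<in> carrier_mat n n" and PP: "P * P = P"
    and fixW: "\<And>w. w \<in> W \<Longrightarrow> P *\<^sub>v w = w" and im: "\<And>y. y \<in> carrier_vec n \<Longrightarrow> P *\<^sub>v y \<in> span W"
    and ann: "\<And>f. f \<in> carrier_vec n \<Longrightarrow> (\<forall>w\<in>W. f \<bullet> w = 0) \<Longrightarrow> P\<^sup>T *\<^sub>v f = 0\<^sub>v n"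
    and det: "\<And>s. det (1\<^sub>m n + (s - 1) \<cdot>\<^sub>m P) = s ^ dim_span W" by metis
  show ?case
  proof (cases "x \<in> span W")
    case True
    then show ?thesis
      using P PP fixW im ann det fixed_on_span[OF P W fixW True]
      by (intro bexI[of _ P]) (auto simp: dim_span_insert_in[OF W] span_insert_in[OF W])
  next
    case False
    \<comment> \<open>The component of \<open>x\<close> in the kernel of \<open>P\<close>; it is
      nonzero because the image of \<open>P\<close> lies in the span.\<close>
    define u where "u = x - P *\<^sub>v x"
    have Px: "P *\<^sub>v x \<in> carrier_vec n" and u: "u \<in> carrier_vec n" using P x by (auto simp: u_def)
    have xu: "x = P *\<^sub>v x + u" using x P unfolding u_def by (intro eq_vecI) auto
    have "u \<noteq> 0\<^sub>v n"
    proof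
      assume "u = 0\<^sub>v n"
      then have "x = P *\<^sub>v x" using xu Px by simp
      with im[OF x] False show False by simp
    qed
    then obtain j where j: "j < n" "u $ j \<noteq> 0"
      using u by (metis carrier_vecD eq_vecI index_zero_vec(1) index_zero_vec(2))
    have Pc: "P *\<^sub>v y \<in> carrier_vec n" if "y \<in> carrier_vec n" for y using that P by simp
    have PPy: "P *\<^sub>v (P *\<^sub>v y) = P *\<^sub>v y" if "y \<in> carrier_vec n" for y
      using that P PP by (simp add: assoc_mult_mat_vec[symmetric])
    have Pu: "P *\<^sub>v u = 0\<^sub>v n"
      using x Px unfolding u_def by (simp add: mult_minus_distrib_mat_vec[OF P] PPy)
    \<comment> \<open>A coordinate functional normalised to take the value 1 at \<open>u\<close>.
      Subtracting its pullback along \<open>P\<close> gives \<open>\<phi>\<close>, which also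
      vanishes on the image of \<open>P\<close>.\<close>
    define \<psi> where "\<psi> = (1 / u $ j) \<cdot>\<^sub>v unit_vec n j"
    define \<phi> where "\<phi> = \<psi> - P\<^sup>T *\<^sub>v \<psi>"
    have \<psi>: "\<psi> \<in> carrier_vec n" by (simp add: \<psi>_def)
    have P\<psi>: "P\<^sup>T *\<^sub>v \<psi> \<in> carrier_vec n" using P \<psi> by auto
    have \<phi>: "\<phi> \<in> carrier_vec n" using \<psi> P\<psi> by (auto simp: \<phi>_def)
    have \<phi>y: "\<phi> \<bullet> y = \<psi> \<bullet> y - \<psi> \<bullet> (P *\<^sub>v y)" if "y \<in> carrier_vec n" for y
      using that transpose_vec_mult_scalar[OF P that \<psi>]
      by (simp add: \<phi>_def minus_scalar_prod_distrib[OF \<psi> P\<psi> that])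
    have "\<psi> \<bullet> u = 1" using j u by (simp add: \<psi>_def)
    then have \<phi>u: "\<phi> \<bullet> u = 1" using \<phi>y[OF u] Pu \<psi> by simp
    have \<phi>P: "\<phi> \<bullet> (P *\<^sub>v y) = 0" if "y \<in> carrier_vec n" for y
      using \<phi>y[OF Pc[OF that]] PPy[OF that] by simp
    have \<phi>w: "\<phi> \<bullet> w = 0" if "w \<in> W" for w
      using \<phi>P[of w] fixW[OF that] W that by auto
    define R where "R = outer_prod u \<phi>"
    have R: "R \<in> carrier_mat n n" using u \<phi> by (simp add: R_def)
    have Ry: "R *\<^sub>v y = (\<phi> \<bullet> y) \<cdot>\<^sub>v u" if "y \<in> carrier_vec n" for y
      using outer_prod_mult_vec[OF u \<phi> that] by (simp add: R_def)
    let ?P = "P + R"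
    have P'y: "?P *\<^sub>v y = P *\<^sub>v y + (\<phi> \<bullet> y) \<cdot>\<^sub>v u" if "y \<in> carrier_vec n" for y
      using that by (simp add: add_mult_distrib_mat_vec[OF P R] Ry)
    have fx: "?P *\<^sub>v x = x"
    proof -
      have "\<phi> \<bullet> x = \<phi> \<bullet> (P *\<^sub>v x + u)" using xu by simp
      also have "\<dots> = 1" using \<phi>P[OF x] \<phi>u by (simp add: scalar_prod_add_distrib[OF \<phi> Px u])
      finally show ?thesis using P'y[OF x] xu by simp
    qed
    have fW: "?P *\<^sub>v w = w" if "w \<in> W" for w
      using that W P'y[of w] fixW[OF that] \<phi>w[OF that] u by auto
    have xW: "insert x W \<subseteq> carrier_vec n" using x W by auto
    have mono: "span W \<subseteq> span (insert x W)" by (intro span_is_monotone) auto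
    have "u = x + (- 1) \<cdot>\<^sub>v (P *\<^sub>v x)" using x Px unfolding u_def by (intro eq_vecI) auto
    moreover have "(- 1) \<cdot>\<^sub>v (P *\<^sub>v x) \<in> span (insert x W)"
      by (rule smult_in_span[OF xW]) (use im[OF x] mono in blast)
    moreover have "x \<in> span (insert x W)" using span_mem[of "insert x W" x] xW by simp
    ultimately have uspan: "u \<in> span (insert x W)"
      using span_add1[of "insert x W"] xW by simp
    have im': "?P *\<^sub>v y \<in> span (insert x W)" if "y \<in> carrier_vec n" for y
      using P'y[OF that] span_add1[of "insert x W" "P *\<^sub>v y"] xW im[OF that] mono
        smult_in_span[OF xW uspan] by auto
    have ann': "?P\<^sup>T *\<^sub>v f = 0\<^sub>v n" if f: "f \<in> carrier_vec n" "\<forall>w\<in>insert x W. f \<bullet> w = 0" for f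
    proof -
      have Pf: "P\<^sup>T *\<^sub>v f = 0\<^sub>v n" using ann f by auto
      have "f \<bullet> u = f \<bullet> x - f \<bullet> (P *\<^sub>v x)"
        unfolding u_def by (rule scalar_prod_minus_distrib[OF f(1) x Px])
      also have "f \<bullet> (P *\<^sub>v x) = 0"
        using transpose_vec_mult_scalar[OF P x f(1)] Pf x by simp
      finally have "f \<bullet> u = 0" using f by simp
      then have "u \<bullet> f = 0" using comm_scalar_prod[OF f(1) u] by simp
      moreover have "R\<^sup>T *\<^sub>v f = (u \<bullet> f) \<cdot>\<^sub>v \<phi>"
        using outer_prod_mult_vec[OF \<phi> u f(1)] by (simp add: R_def transpose_outer_prod)
      moreover have "?P\<^sup>T *\<^sub>v f = P\<^sup>T *\<^sub>v f + R\<^sup>T *\<^sub>v f"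
        using P R f by (simp add: transpose_add add_mult_distrib_mat_vec[of "P\<^sup>T" n n "R\<^sup>T"])
      ultimately show ?thesis using Pf \<phi> by auto
    qed
    have idem: "?P * ?P = ?P"
    proof (rule mat_eq_by_action[of _ n n])
      fix y :: "'a vec" assume y: "y \<in> carrier_vec n"
      have "?P *\<^sub>v (?P *\<^sub>v y) = ?P *\<^sub>v y"
        using y u \<phi> Pc[OF y] P'y[OF y] P'y[of "P *\<^sub>v y + (\<phi> \<bullet> y) \<cdot>\<^sub>v u"]
        by (simp add: mult_add_distrib_mat_vec[OF P] mult_mat_vec[OF P] Pu PPy \<phi>P \<phi>u
            scalar_prod_add_distrib[OF \<phi>])
      then show "(?P * ?P) *\<^sub>v y = ?P *\<^sub>v y"
        using P R y by (simp add: assoc_mult_mat_vec[of _ n n _ n])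
    qed (use P R in auto)
    have det': "det (1\<^sub>m n + (s - 1) \<cdot>\<^sub>m ?P) = s ^ Suc (dim_span W)" for s
    proof -
      let ?A = "1\<^sub>m n + (s - 1) \<cdot>\<^sub>m P" and ?B = "1\<^sub>m n + (s - 1) \<cdot>\<^sub>m R"
      have A: "?A \<in> carrier_mat n n" and B: "?B \<in> carrier_mat n n" using P R by auto
      have "1\<^sub>m n + (s - 1) \<cdot>\<^sub>m ?P = ?A * ?B"
      proof (rule mat_eq_by_action[of _ n n])
        fix y :: "'a vec" assume y: "y \<in> carrier_vec n"
        let ?t = "((s - 1) * (\<phi> \<bullet> y)) \<cdot>\<^sub>v u"
        have smult: "(1\<^sub>m n + c \<cdot>\<^sub>m M) *\<^sub>v z = z + c \<cdot>\<^sub>v (M *\<^sub>v z)"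
          if "M \<in> carrier_mat n n" "z \<in> carrier_vec n" for c M and z :: "'a vec"
          using that by (subst add_mult_distrib_mat_vec[of _ n n]) (auto intro!: eq_vecI)
        have By: "?B *\<^sub>v y = y + ?t" using y u R by (simp add: smult Ry smult_smult_assoc)
        have "(?A * ?B) *\<^sub>v y = ?A *\<^sub>v (y + ?t)" using A B y By by (simp add: assoc_mult_mat_vec[of _ n n _ n])
        also have "\<dots> = (y + ?t) + (s - 1) \<cdot>\<^sub>v (P *\<^sub>v (y + ?t))" using P y u by (subst smult) auto
        also have "P *\<^sub>v (y + ?t) = P *\<^sub>v y"
          using y u Pc[OF y] by (simp add: mult_add_distrib_mat_vec[OF P] mult_mat_vec[OF P] Pu)
        also have "(y + ?t) + (s - 1) \<cdot>\<^sub>v (P *\<^sub>v y) = y + (s - 1) \<cdot>\<^sub>v (?P *\<^sub>v y)"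
          unfolding P'y[OF y] using y u P
          by (intro eq_vecI) (auto simp: ring_distribs simp del: index_mult_mat_vec)
        also have "\<dots> = (1\<^sub>m n + (s - 1) \<cdot>\<^sub>m ?P) *\<^sub>v y" using P R y by (subst smult) auto
        finally show "(1\<^sub>m n + (s - 1) \<cdot>\<^sub>m ?P) *\<^sub>v y = (?A * ?B) *\<^sub>v y" by simp
      qed (use P R in auto)
      then have "det (1\<^sub>m n + (s - 1) \<cdot>\<^sub>m ?P) = det ?A * det ?B" using det_mult[OF A B] by simp
      also have "det ?B = s" using det_one_plus_outer_prod[OF u \<phi>] \<phi>u by (simp add: R_def)
      finally show ?thesis by (simp add: det)
    qed
    show ?thesis
      using P R idem fx fW im' ann' det'
        dim_span_insert_notin[OF insert.hyps(1) W x False]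
      by (intro bexI[of _ ?P]) auto
  qed
qed

end

context vec_space
begin

lemma dim_span_le:
  assumes "finite W" "W \<subseteq> carrier_vec n"
  shows "dim_span W \<le> n"
proof -
  have "lin_indpt {}" by (auto simp: lin_dep_def)
  then obtain U where U: "finite U" "maximal U (\<lambda>T. T \<subseteq> W \<and> lin_indpt T)"
    using maximal_exists_superset[of W "\<lambda>T. T \<subseteq> W \<and> lin_indpt T" "{}"] assms(1) by blast
  then have "dim_span W = card U"
    unfolding dim_span_def using assms by (intro dim_span) auto
  moreover have "card U \<le> n"
    using U assms li_le_dim(2)[of U] fin_dim dim_is_n by (auto simp: maximal_def)
  ultimately show ?thesis by simp
qed

text \<open>The complement of the transpose of the projection \<open>Q\<close> onto the span of the
  functionals. Pulling a factor \<open>s\<close> out of 1 + (s - 1) P leaves the transpose of 1 +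
  (1/s - 1) Q, whose determinant is known; this is where \<open>s\<close> must be nonzero.\<close>

lemma projection_onto_annihilator:
  assumes F: "finite F" "F \<subseteq> carrier_vec n"
  shows "\<exists>P\<in>carrier_mat n n. P * P = P \<and> (\<forall>f\<in>F. P\<^sup>T *\<^sub>v f = 0\<^sub>v n) \<and>
    (\<forall>u\<in>carrier_vec n. (\<forall>f\<in>F. f \<bullet> u = 0) \<longrightarrow> P *\<^sub>v u = u) \<and>
    (\<forall>s. s \<noteq> 0 \<longrightarrow> det (1\<^sub>m n + (s - 1) \<cdot>\<^sub>m P) = s ^ (n - dim_span F))"
proof -
  obtain Q where Q: "Q \<in> carrier_mat n n" "Q * Q = Q" "\<And>f. f \<in> F \<Longrightarrow> Q *\<^sub>v f = f"
    "\<And>u. u \<in> carrier_vec n \<Longrightarrow> \<forall>f\<in>F. u \<bullet> f = 0 \<Longrightarrow> Q\<^sup>T *\<^sub>v u = 0\<^sub>v n"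
    and det: "\<And>s. det (1\<^sub>m n + (s - 1) \<cdot>\<^sub>m Q) = s ^ dim_span F"
    using projection_onto_span[OF F] by blast
  have T: "Q\<^sup>T \<in> carrier_mat n n" using Q by auto
  define P where "P = 1\<^sub>m n - Q\<^sup>T"
  have P: "P \<in> carrier_mat n n" using T by (auto simp: P_def)
  have TT: "Q\<^sup>T * Q\<^sup>T = Q\<^sup>T" using transpose_mult[OF Q(1) Q(1)] Q(2) by simp
  have act: "P *\<^sub>v u = u - Q\<^sup>T *\<^sub>v u" if "u \<in> carrier_vec n" for u
    using that T by (simp add: P_def minus_mult_distrib_mat_vec[of _ n n])
  have "P * P = P"
  proof (rule mat_eq_by_action[of _ n n])
    fix y :: "'a vec" assume y: "y \<in> carrier_vec n"
    have Ty: "Q\<^sup>T *\<^sub>v y \<in> carrier_vec n" using T y by auto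
    have "Q\<^sup>T *\<^sub>v (Q\<^sup>T *\<^sub>v y) = Q\<^sup>T *\<^sub>v y" using T TT y by (simp add: assoc_mult_mat_vec[symmetric])
    then have "Q\<^sup>T *\<^sub>v (P *\<^sub>v y) = 0\<^sub>v n"
      using y Ty by (simp add: act mult_minus_distrib_mat_vec[OF T])
    then have "P *\<^sub>v (P *\<^sub>v y) = P *\<^sub>v y"
      using act[of "P *\<^sub>v y"] P y by auto
    then show "(P * P) *\<^sub>v y = P *\<^sub>v y" using P y by (simp add: assoc_mult_mat_vec[of _ n n _ n])
  qed (use P in auto)
  moreover have "P\<^sup>T *\<^sub>v f = 0\<^sub>v n" if "f \<in> F" for f
  proof -
    have "P\<^sup>T = 1\<^sub>m n - Q" using Q(1) by (intro eq_matI) (auto simp: P_def)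
    moreover have "f \<in> carrier_vec n" using that F by auto
    ultimately show ?thesis
      using Q(1) Q(3)[OF that] by (simp add: minus_mult_distrib_mat_vec[of _ n n])
  qed
  moreover have "P *\<^sub>v u = u" if "u \<in> carrier_vec n" "\<forall>f\<in>F. f \<bullet> u = 0" for u
  proof -
    have "\<forall>f\<in>F. u \<bullet> f = 0" using that F comm_scalar_prod by (metis subsetD)
    then show ?thesis using act[of u] Q(4)[of u] that by auto
  qed
  moreover have "det (1\<^sub>m n + (s - 1) \<cdot>\<^sub>m P) = s ^ (n - dim_span F)" if "s \<noteq> 0" for s
  proof -
    have le: "dim_span F \<le> n" by (rule dim_span_le[OF F])
    have "1\<^sub>m n + (s - 1) \<cdot>\<^sub>m P = s \<cdot>\<^sub>m (1\<^sub>m n + (1 / s - 1) \<cdot>\<^sub>m Q)\<^sup>T"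
      using Q(1) that by (intro eq_matI) (auto simp: P_def field_simps)
    then have "det (1\<^sub>m n + (s - 1) \<cdot>\<^sub>m P) = s ^ n * det ((1\<^sub>m n + (1 / s - 1) \<cdot>\<^sub>m Q)\<^sup>T)"
      using Q(1) by (simp add: det_smult)
    also have "\<dots> = s ^ n * (1 / s) ^ dim_span F"
      using Q(1) by (subst det_transpose[of _ n]) (auto simp: det)
    also have "\<dots> = s ^ (n - dim_span F)"
      using that le by (simp add: power_divide power_diff)
    finally show ?thesis .
  qed
  ultimately show ?thesis using P by blast
qed

end

section \<open>Rank functions of the linear matroids\<close>

lemma mrank_empty [simp]: "mrank n w {} = 0"
  by (simp add: mrank_def vec_space.dim_span_empty)

lemma mrank_insert:
  assumes "finite X" "w ` insert x X \<subseteq> carrier_vec n"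
  shows "mrank n w (insert x X) = mrank n w X +
    (if w x \<in> LinearCombinations.module.span class_ring (module_vec TYPE(complex) n) (w ` X) then 0 else 1)"
  using assms vec_space.dim_span_insert_in[of "w ` X" n "w x"]
    vec_space.dim_span_insert_notin[of "w ` X" n "w x"]
  by (auto simp: mrank_def)

lemma mrank_mono:
  assumes Y: "finite Y" "w ` Y \<subseteq> carrier_vec n" and "X \<subseteq> Y"
  shows "mrank n w X \<le> mrank n w Y"
proof -
  have "mrank n w X \<le> mrank n w (X \<union> Z)" if "finite Z" "Z \<subseteq> Y" for Z
    using that
  proof (induction Z)
    case (insert z Z)
    then have "finite (X \<union> Z)" "w ` insert z (X \<union> Z) \<subseteq> carrier_vec n"
      using assms finite_subset[of X Y] by auto
    from mrank_insert[OF this] insert show ?case by auto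
  qed simp
  from this[of Y] assms show ?thesis by (simp add: Un_absorb1)
qed

text \<open>A vector outside the span of the larger set is outside the span of the smaller one, so
  each element of \<open>Z\<close> raises the rank over \<open>X\<close> at least as much as over
  \<open>Y\<close>. Submodularity is the instance with the intersection as the smaller set.\<close>

lemma mrank_diminishing:
  assumes Y: "finite Y" "w ` Y \<subseteq> carrier_vec n" and "X \<subseteq> Y"
    and Z: "finite Z" "w ` Z \<subseteq> carrier_vec n"
  shows "mrank n w (Y \<union> Z) + mrank n w X \<le> mrank n w (X \<union> Z) + mrank n w Y"
  using Z
proof (induction Z)
  case (insert z Z)
  interpret vec_space "TYPE(complex)" n .
  have X: "finite X" "w ` X \<subseteq> carrier_vec n" using Y \<open>X \<subseteq> Y\<close> finite_subset by auto
  have "finite (X \<union> Z)" "w ` insert z (X \<union> Z) \<subseteq> carrier_vec n"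
    and "finite (Y \<union> Z)" "w ` insert z (Y \<union> Z) \<subseteq> carrier_vec n"
    using X Y insert by auto
  from mrank_insert[OF this(1,2)] mrank_insert[OF this(3,4)]
  have "mrank n w (Y \<union> insert z Z) + mrank n w (X \<union> Z) \<le> mrank n w (X \<union> insert z Z) + mrank n w (Y \<union> Z)"
    using span_is_monotone[of "w ` (X \<union> Z)" "w ` (Y \<union> Z)"] \<open>X \<subseteq> Y\<close> by auto
  with insert show ?case by auto
qed simp

lemma mrank_submodular:
  assumes "finite X" "w ` X \<subseteq> carrier_vec n" "finite Y" "w ` Y \<subseteq> carrier_vec n"
  shows "mrank n w (X \<union> Y) + mrank n w (X \<inter> Y) \<le> mrank n w X + mrank n w Y"
  using mrank_diminishing[of X w n "X \<inter> Y" Y] assms by (auto simp: Un_absorb1)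

lemma mrank_le_card:
  assumes "finite X" "w ` X \<subseteq> carrier_vec n"
  shows "mrank n w X \<le> card X"
  using assms
proof (induction X)
  case (insert x X)
  then show ?case using mrank_insert[of X w x n] by auto
qed simp

lemma mrank_le_dim:
  assumes "finite X" "w ` X \<subseteq> carrier_vec n"
  shows "mrank n w X \<le> n"
  using assms vec_space.dim_span_le[of "w ` X" n] by (simp add: mrank_def)

lemma det_basis_nonzero:
  assumes "distinct bs" "length bs = n" "mrank n w (set bs) = n" "w ` set bs \<subseteq> carrier_vec n"
  shows "det (mat_of_cols n (map w bs)) \<noteq> 0"
proof -
  interpret vec_space "TYPE(complex)" n .
  have "rank (mat_of_cols n (map w bs)) = n"
    using assms by (auto simp: rank_def mrank_def dim_span_def)
  moreover have "mat_of_cols n (map w bs) \<in> carrier_mat n n"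
    using assms by auto
  ultimately show ?thesis using det_rank_iff by blast
qed

section \<open>Bases and flows\<close>

text \<open>The direct sum of the linear matroids over the copies in \<open>J\<close>, pulled back
  to \<open>E\<close>: \<open>\<kappa> e\<close> is the copy and \<open>\<pi> e\<close> the node
  that \<open>e\<close> uses there. Elements using the same node in the same copy cannot both lie in
  an independent set.\<close>

lemma rank_function_mrank_sum:
  assumes J: "finite J" and E: "finite E" "\<kappa> ` E \<subseteq> J"
    and w: "\<And>e. e \<in> E \<Longrightarrow> w (\<pi> e) \<in> carrier_vec (n (\<kappa> e))"
  shows "rank_function E (\<lambda>A. \<Sum>x\<in>J. int (mrank (n x) w (\<pi> ` {e \<in> A. \<kappa> e = x})))"
    (is "rank_function E (\<lambda>A. \<Sum>x\<in>J. int (?m x A))")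
  unfolding rank_function_def
proof (intro conjI ballI allI impI)
  have fin: "finite (\<pi> ` {e \<in> A. \<kappa> e = x})" "w ` \<pi> ` {e \<in> A. \<kappa> e = x} \<subseteq> carrier_vec (n x)"
    if "A \<subseteq> E" for A x
    using that w finite_subset[OF that E(1)] by auto
  show "(\<Sum>x\<in>J. int (?m x {})) = 0" by simp
  {
    fix e assume e: "e \<in> E"
    have "int (?m x {e}) \<le> (if x = \<kappa> e then 1 else 0)" for x
    proof (cases "x = \<kappa> e")
      case True
      then have "{e' \<in> {e}. \<kappa> e' = x} = {e}" by auto
      then show ?thesis using mrank_le_card[of "{\<pi> e}" w "n x"] w[OF e] True by simp
    next
      case False
      then have none: "{e' \<in> {e}. \<kappa> e' = x} = {}" by auto
      show ?thesis unfolding none by simp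
    qed
    then have "(\<Sum>x\<in>J. int (?m x {e})) \<le> (\<Sum>x\<in>J. if x = \<kappa> e then 1 else 0)"
      by (intro sum_mono)
    also have "\<dots> = 1" using J E e by (simp add: image_subset_iff)
    finally show "(\<Sum>x\<in>J. int (?m x {e})) \<le> 1" .
  }
  {
    fix A B assume "A \<subseteq> B" "B \<subseteq> E"
    then have "?m x A \<le> ?m x B" for x
      using fin by (intro mrank_mono) auto
    then show "(\<Sum>x\<in>J. int (?m x A)) \<le> (\<Sum>x\<in>J. int (?m x B))" by (intro sum_mono) simp
  }
  {
    fix A B assume A: "A \<subseteq> E" and B: "B \<subseteq> E"
    have "?m x (A \<union> B) + ?m x (A \<inter> B) \<le> ?m x A + ?m x B" for x
    proof -
      let ?A = "\<pi> ` {e \<in> A. \<kappa> e = x}" and ?B = "\<pi> ` {e \<in> B. \<kappa> e = x}"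
      have "\<pi> ` {e \<in> A \<union> B. \<kappa> e = x} = ?A \<union> ?B" by auto
      \<comment> \<open>The image of an intersection is only contained in the intersection of the
        images; monotonicity bridges the gap in the right direction.\<close>
      moreover have "?m x (A \<inter> B) \<le> mrank (n x) w (?A \<inter> ?B)"
        using fin[OF A, of x] by (intro mrank_mono) auto
      ultimately show ?thesis
        using mrank_submodular[OF fin[OF A, of x] fin[OF B, of x]] by simp
    qed
    then have "int (?m x (A \<union> B)) + int (?m x (A \<inter> B)) \<le> int (?m x A) + int (?m x B)" for x
      unfolding of_nat_add[symmetric] of_nat_le_iff .
    then show "(\<Sum>x\<in>J. int (?m x (A \<union> B))) + (\<Sum>x\<in>J. int (?m x (A \<inter> B)))
      \<le> (\<Sum>x\<in>J. int (?m x A)) + (\<Sum>x\<in>J. int (?m x B))"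
      unfolding sum.distrib[symmetric] by (intro sum_mono)
  }
qed

lemma sum_eq_termwise:
  fixes g h :: "'b \<Rightarrow> nat"
  assumes "finite J" "\<And>x. x \<in> J \<Longrightarrow> g x \<le> h x" "sum g J = sum h J" "x \<in> J"
  shows "g x = h x"
proof (rule ccontr)
  assume "g x \<noteq> h x"
  then have "sum g J < sum h J"
    using assms by (intro sum_strict_mono_ex1) (auto simp: order.strict_iff_order)
  with assms show False by simp
qed

text \<open>In each copy the rank is at most the number of distinct nodes, hence at most the number
  of elements, and it is at most the dimension. The totals of ranks, elements and dimensions agree,
  so all these inequalities are equalities: the nodes used in a copy form a base, and none is used
  twice.\<close>

lemma tight_fibres:
  assumes J: "finite J" and I: "finite I" "\<kappa> ` I \<subseteq> J"
    and w: "\<And>e. e \<in> I \<Longrightarrow> w (\<pi> e) \<in> carrier_vec (n (\<kappa> e))"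
    and rank: "(\<Sum>x\<in>J. mrank (n x) w (\<pi> ` {e \<in> I. \<kappa> e = x})) = card I"
    and card: "card I = (\<Sum>x\<in>J. n x)" and x: "x \<in> J"
  shows "mrank (n x) w (\<pi> ` {e \<in> I. \<kappa> e = x}) = n x"
    and "card (\<pi> ` {e \<in> I. \<kappa> e = x}) = n x"
    and "inj_on \<pi> {e \<in> I. \<kappa> e = x}"
proof -
  let ?F = "\<lambda>x. {e \<in> I. \<kappa> e = x}"
  have fin: "finite (\<pi> ` ?F x)" "w ` \<pi> ` ?F x \<subseteq> carrier_vec (n x)" for x
    using I w by auto
  have le1: "mrank (n x) w (\<pi> ` ?F x) \<le> card (\<pi> ` ?F x)" for x by (rule mrank_le_card[OF fin])
  have le2: "card (\<pi> ` ?F x) \<le> card (?F x)" for x using I by (intro card_image_le) auto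
  have "card I = (\<Sum>x\<in>J. card (?F x))"
    using sum.group[OF I(1) J I(2), of "\<lambda>_. 1::nat"] by simp
  with rank have "mrank (n x) w (\<pi> ` ?F x) = card (?F x)"
    using J x order_trans[OF le1 le2] by (intro sum_eq_termwise[where J = J and g = "\<lambda>x. mrank (n x) w (\<pi> ` ?F x)" and h = "\<lambda>x. card (?F x)"]) simp_all
  moreover show m: "mrank (n x) w (\<pi> ` ?F x) = n x"
    using J x rank card mrank_le_dim[OF fin]
    by (intro sum_eq_termwise[where J = J and g = "\<lambda>x. mrank (n x) w (\<pi> ` ?F x)" and h = n]) simp_all
  ultimately show c: "card (\<pi> ` ?F x) = n x" using le1[of x] le2[of x] by simp
  with m \<open>mrank _ _ _ = card (?F x)\<close> show "inj_on \<pi> (?F x)"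
    using I by (intro eq_card_imp_inj_on) auto
qed

text \<open>Turns the multiplicity of a node in a matching into the sum of characteristic vectors
  that (S)' asks for.\<close>

lemma count_by_fibres:
  assumes J: "finite J" and I: "finite I" "\<kappa> ` I \<subseteq> J"
    and inj: "\<And>x. x \<in> J \<Longrightarrow> inj_on \<pi> {e \<in> I. \<kappa> e = x}"
  shows "(\<Sum>e\<in>I. of_bool (\<pi> e = s)) = (\<Sum>x\<in>J. indicator (\<pi> ` {e \<in> I. \<kappa> e = x}) s :: int)"
proof -
  have "(\<Sum>e\<in>{e \<in> I. \<kappa> e = x}. of_bool (\<pi> e = s)) = (indicator (\<pi> ` {e \<in> I. \<kappa> e = x}) s :: int)"
    if "x \<in> J" for x
  proof -
    have "(\<Sum>e\<in>{e \<in> I. \<kappa> e = x}. of_bool (\<pi> e = s))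
        = (\<Sum>t\<in>\<pi> ` {e \<in> I. \<kappa> e = x}. of_bool (t = s) :: int)"
      by (subst sum.reindex[OF inj[OF that]]) simp
    also have "\<dots> = indicator (\<pi> ` {e \<in> I. \<kappa> e = x}) s"
      using I by (auto simp: of_bool_def indicator_def)
    finally show ?thesis .
  qed
  then show ?thesis using sum.group[OF I(1) J I(2), of "\<lambda>e. of_bool (\<pi> e = s) :: int"] by simp
qed

text \<open>The rank inequality for an independent set and, by passing to the complement, the
  matching lower bound for a base. The first serves the boundary on \<open>S_plus\<close>, the
  second the negated boundary on \<open>S_minus\<close>.\<close>

lemma mbases_inter_card:
  assumes E: "finite E" "w ` E \<subseteq> carrier_vec n" and B: "B \<in> mbases n w E"
  shows "card (B \<inter> X) \<le> mrank n w (E \<inter> X)"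
    and "mrank n w E \<le> card (B \<inter> X) + mrank n w (E - X)"
proof -
  have BE: "B \<subseteq> E" and cB: "card B = mrank n w B" and rB: "mrank n w B = mrank n w E"
    using B by (auto simp: mbases_def)
  have fB: "finite B" "w ` B \<subseteq> carrier_vec n" using BE E finite_subset by auto
  \<comment> \<open>If \<open>B \<inter> Y\<close> had rank below its cardinality, then by
    submodularity so would \<open>B\<close>.\<close>
  have ind: "card (B \<inter> Y) \<le> mrank n w (E \<inter> Y)" for Y
  proof -
    have "card B = card (B \<inter> Y) + card (B - Y)"
      using fB card_Un_disjoint[of "B \<inter> Y" "B - Y"] by (simp add: Int_Diff_Un Int_Diff_disjoint)
    moreover have "mrank n w B \<le> mrank n w (B \<inter> Y) + mrank n w (B - Y)"
      using mrank_submodular[of "B \<inter> Y" w n "B - Y"] fB by (auto simp: Int_Diff_Un Int_Diff_disjoint)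
    moreover have "mrank n w (B - Y) \<le> card (B - Y)"
      using fB by (intro mrank_le_card) auto
    moreover have "mrank n w (B \<inter> Y) \<le> mrank n w (E \<inter> Y)"
      using E BE by (intro mrank_mono) auto
    ultimately show ?thesis using cB by simp
  qed
  show "card (B \<inter> X) \<le> mrank n w (E \<inter> X)" by (rule ind)
  have "card B = card (B \<inter> X) + card (B - X)"
    using fB card_Un_disjoint[of "B \<inter> X" "B - X"] by (simp add: Int_Diff_Un Int_Diff_disjoint)
  moreover have "card (B - X) \<le> mrank n w (E - X)"
    using ind[of "- X"] by (simp add: Diff_eq)
  ultimately show "mrank n w E \<le> card (B \<inter> X) + mrank n w (E - X)" using cB rB by simp
qed

section \<open>Boundaries of flows\<close>

lemma boundary_add: "boundary D (\<lambda>e. \<phi> e + \<psi> e) s = boundary D \<phi> s + boundary D \<psi> s"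
  by (simp add: boundary_def sum.distrib)

lemma boundary_sum_flows:
  "boundary D (\<lambda>e. \<Sum>i\<in>I. \<phi> i e) s = (\<Sum>i\<in>I. boundary D (\<phi> i) s)"
  unfolding boundary_def sum_subtractf
  by (rule arg_cong2[of _ _ _ _ "(-)"]; rule sum.swap)

lemma (in fin_digraph) sum_boundary:
  fixes \<phi> :: "'b \<Rightarrow> 'r::ab_group_add"
  assumes "finite X"
  shows "sum (boundary G \<phi>) X = sum \<phi> {e \<in> arcs G. tail G e \<in> X} - sum \<phi> {e \<in> arcs G. head G e \<in> X}"
proof -
  have "(\<Sum>s\<in>X. sum \<phi> (out_arcs G s)) = sum \<phi> {e \<in> arcs G. tail G e \<in> X}"
  proof -
    have "out_arcs G s = {e \<in> {e \<in> arcs G. tail G e \<in> X}. tail G e = s}" if "s \<in> X" for s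
      using that by (auto simp: out_arcs_def)
    then show ?thesis
      using sum.group[of "{e \<in> arcs G. tail G e \<in> X}" X "tail G" \<phi>] assms
      by (simp add: image_subset_iff)
  qed
  moreover have "(\<Sum>s\<in>X. sum \<phi> (in_arcs G s)) = sum \<phi> {e \<in> arcs G. head G e \<in> X}"
  proof -
    have "in_arcs G s = {e \<in> {e \<in> arcs G. head G e \<in> X}. head G e = s}" if "s \<in> X" for s
      using that by (auto simp: in_arcs_def)
    then show ?thesis
      using sum.group[of "{e \<in> arcs G. head G e \<in> X}" X "head G" \<phi>] assms
      by (simp add: image_subset_iff)
  qed
  ultimately show ?thesis by (simp add: boundary_def sum_subtractf)
qed

text \<open>One unit is sent along a walk, arc by arc. Arcs that the walk repeats accumulate flow,
  which is harmless under infinite capacities.\<close>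

lemma unit_flow:
  assumes fin: "finite (parcs D)" and "(s, t) \<in> (parcs D)\<^sup>*"
  shows "\<exists>\<phi>. (\<forall>e. 0 \<le> \<phi> e) \<and>
    (\<forall>u. boundary (with_proj D) \<phi> u = of_bool (u = s) - (of_bool (u = t) :: int))"
  using assms(2)
proof (induction rule: rtrancl_induct)
  case base
  show ?case by (intro exI[of _ "\<lambda>_. 0"]) (simp add: boundary_def)
next
  case (step y z)
  then obtain \<phi> where \<phi>: "\<forall>e. 0 \<le> \<phi> e"
    "\<forall>u. boundary (with_proj D) \<phi> u = of_bool (u = s) - (of_bool (u = y) :: int)" by blast
  let ?\<psi> = "\<lambda>e. of_bool (e = (y, z)) :: int"
  have "boundary (with_proj D) ?\<psi> u = of_bool (u = y) - of_bool (u = z)" for u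
    using fin step(2) by (auto simp: boundary_def out_arcs_def in_arcs_def of_bool_def)
  then show ?case
    using \<phi> by (intro exI[of _ "\<lambda>e. \<phi> e + ?\<psi> e"]) (auto simp: boundary_add)
qed

text \<open>Summation by parts: the boundary is adjoint to the potential difference. Weak duality
  for flows is used in this form.\<close>

lemma (in fin_digraph) sum_boundary_mult:
  fixes \<phi> :: "'b \<Rightarrow> 'r::comm_ring"
  shows "(\<Sum>s\<in>verts G. boundary G \<phi> s * p s) = (\<Sum>e\<in>arcs G. \<phi> e * (p (tail G e) - p (head G e)))"
proof -
  have "(\<Sum>s\<in>verts G. sum \<phi> (out_arcs G s) * p s) = (\<Sum>e\<in>arcs G. \<phi> e * p (tail G e))"
    using sum.group[of "arcs G" "verts G" "tail G" "\<lambda>e. \<phi> e * p (tail G e)"]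
    by (simp add: image_subset_iff out_arcs_def sum_distrib_right)
  moreover have "(\<Sum>s\<in>verts G. sum \<phi> (in_arcs G s) * p s) = (\<Sum>e\<in>arcs G. \<phi> e * p (head G e))"
    using sum.group[of "arcs G" "verts G" "head G" "\<lambda>e. \<phi> e * p (head G e)"]
    by (simp add: image_subset_iff in_arcs_def sum_distrib_right)
  ultimately show ?thesis by (simp add: boundary_def left_diff_distrib right_diff_distrib sum_subtractf)
qed

lemma mult_mat_vec_nonzero:
  fixes M :: "'a::field mat"
  assumes "M' * M = 1\<^sub>m n" "M \<in> carrier_mat n n" "M' \<in> carrier_mat n n" "u \<in> carrier_vec n" "u \<noteq> 0\<^sub>v n"
  shows "M *\<^sub>v u \<noteq> 0\<^sub>v n"
proof
  assume 0: "M *\<^sub>v u = 0\<^sub>v n"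
  have "u = (M' * M) *\<^sub>v u" using assms by simp
  also have "\<dots> = M' *\<^sub>v (M *\<^sub>v u)" by (rule assoc_mult_mat_vec[OF assms(3,2,4)])
  also have "\<dots> = 0\<^sub>v n" unfolding 0 using assms(3) by (intro eq_vecI) auto
  finally show False using assms(5) by simp
qed

section \<open>Norms and inverses\<close>

definition vnorm :: "complex vec \<Rightarrow> real" where
  "vnorm x = L2_set (\<lambda>i. cmod (x $ i)) {..<dim_vec x}"

lemma vnorm_nonneg [simp]: "0 \<le> vnorm x"
  by (simp add: vnorm_def)

lemma vnorm_square: "(vnorm x)\<^sup>2 = (\<Sum>i<dim_vec x. (cmod (x $ i))\<^sup>2)"
  by (simp add: vnorm_def L2_set_def sum_nonneg)

lemma vnorm_pos: "x \<in> carrier_vec n \<Longrightarrow> x \<noteq> 0\<^sub>v n \<Longrightarrow> 0 < vnorm x"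
  by (rule ccontr) (auto simp: not_less vnorm_def L2_set_eq_0_iff dest!: antisym[OF _ L2_set_nonneg] intro: eq_vecI)

lemma vnorm_ge_entry: "i < dim_vec x \<Longrightarrow> cmod (x $ i) \<le> vnorm x"
  unfolding vnorm_def by (rule member_le_L2_set) auto

lemma vnorm_mono:
  assumes "\<And>i. i < n \<Longrightarrow> cmod (x $ i) \<le> b i" "dim_vec x = n"
  shows "vnorm x \<le> L2_set b {..<n}"
  unfolding vnorm_def using assms by (auto intro: L2_set_mono)

lemma vnorm_smult: "vnorm (c \<cdot>\<^sub>v x) = cmod c * vnorm x"
  unfolding vnorm_def by (subst L2_set_right_distrib) (auto simp: norm_mult intro: L2_set_cong)

lemma scalar_prod_le_vnorm:
  assumes "x \<in> carrier_vec n" "y \<in> carrier_vec n"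
  shows "cmod (x \<bullet> y) \<le> vnorm x * vnorm y"
proof -
  have "cmod (x \<bullet> y) \<le> (\<Sum>i<n. \<bar>cmod (x $ i)\<bar> * \<bar>cmod (y $ i)\<bar>)"
    using assms unfolding scalar_prod_def by (auto simp: atLeast0LessThan norm_mult intro: sum_norm_le)
  also have "\<dots> \<le> vnorm x * vnorm y"
    unfolding vnorm_def using assms
      L2_set_mult_ineq[of "\<lambda>i. cmod (x $ i)" "\<lambda>i. cmod (y $ i)" "{..<n}"] by simp
  finally show ?thesis .
qed

lemma frobenius_outer_prod: "(frobenius_norm (outer_prod x y))\<^sup>2 = (vnorm x * vnorm y)\<^sup>2"
proof -
  have "(frobenius_norm (outer_prod x y))\<^sup>2
      = (\<Sum>i<dim_vec x. \<Sum>j<dim_vec y. (cmod (x $ i))\<^sup>2 * (cmod (y $ j))\<^sup>2)"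
    by (simp add: frobenius_norm_def outer_prod_def sum_nonneg norm_mult power_mult_distrib)
  then show ?thesis by (simp add: power_mult_distrib vnorm_square sum_product)
qed

lemma mult_outer_prod_mult:
  fixes x y :: "'a::field vec"
  assumes A: "A \<in> carrier_mat m m" and B: "B \<in> carrier_mat n n"
    and x: "x \<in> carrier_vec m" and y: "y \<in> carrier_vec n"
  shows "A * outer_prod x y * B = outer_prod (A *\<^sub>v x) (B\<^sup>T *\<^sub>v y)"
proof (rule mat_eq_by_action[of _ m n])
  have o: "outer_prod x y \<in> carrier_mat m n" using x y by simp
  have Ax: "A *\<^sub>v x \<in> carrier_vec m" and By: "B\<^sup>T *\<^sub>v y \<in> carrier_vec n" using A B x y by auto
  show "A * outer_prod x y * B \<in> carrier_mat m n" using A B o by simp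
  show "outer_prod (A *\<^sub>v x) (B\<^sup>T *\<^sub>v y) \<in> carrier_mat m n" using Ax By by simp
  fix u :: "'a vec" assume u: "u \<in> carrier_vec n"
  have Bu: "B *\<^sub>v u \<in> carrier_vec n" using B u by simp
  have "(A * outer_prod x y * B) *\<^sub>v u = A *\<^sub>v (outer_prod x y *\<^sub>v (B *\<^sub>v u))"
    using assoc_mult_mat_vec[of "A * outer_prod x y" m n B n u]
      assoc_mult_mat_vec[of A m m "outer_prod x y" n "B *\<^sub>v u"] A B o u Bu by simp
  also have "\<dots> = (y \<bullet> (B *\<^sub>v u)) \<cdot>\<^sub>v (A *\<^sub>v x)"
    using A x by (simp add: outer_prod_mult_vec[OF x y Bu] mult_mat_vec[OF A])
  also have "y \<bullet> (B *\<^sub>v u) = (B\<^sup>T *\<^sub>v y) \<bullet> u"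
    using transpose_vec_mult_scalar[OF B u y] by simp
  finally show "(A * outer_prod x y * B) *\<^sub>v u = outer_prod (A *\<^sub>v x) (B\<^sup>T *\<^sub>v y) *\<^sub>v u"
    by (simp add: outer_prod_mult_vec[OF Ax By u])
qed

lemma mat_inverse_invertible:
  fixes A :: "'a::field mat"
  assumes A: "A \<in> carrier_mat n n" and inv: "invertible_mat A"
  shows "the (mat_inverse A) \<in> carrier_mat n n" "A * the (mat_inverse A) = 1\<^sub>m n"
    "the (mat_inverse A) * A = 1\<^sub>m n"
proof -
  obtain B where "A * B = 1\<^sub>m n" "B * A = 1\<^sub>m (dim_row B)"
    using inv A by (auto simp: invertible_mat_def inverts_mat_def)
  moreover from this have B: "B \<in> carrier_mat n n"
    using A by (metis carrier_matD carrier_matI index_mult_mat(2,3) index_one_mat(2,3))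
  ultimately have "A \<in> Units (ring_mat TYPE('a) n ())"
    using A by (auto simp: Units_def ring_mat_simps intro!: bexI[of _ B])
  then obtain C where "mat_inverse A = Some C" using mat_inverse(1)[OF A, where b = "()"] by (cases "mat_inverse A") auto
  with mat_inverse(2)[OF A this] show "the (mat_inverse A) \<in> carrier_mat n n" "A * the (mat_inverse A) = 1\<^sub>m n"
    "the (mat_inverse A) * A = 1\<^sub>m n" by auto
qed

lemma mat_inverse_eqI:
  fixes A :: "'a::field mat"
  assumes A: "A \<in> carrier_mat n n" and B: "B \<in> carrier_mat n n" and AB: "A * B = 1\<^sub>m n" and BA: "B * A = 1\<^sub>m n"
  shows "invertible_mat A" "the (mat_inverse A) = B"
proof -
  show inv: "invertible_mat A"
    using assms by (auto simp: invertible_mat_def inverts_mat_def intro!: exI[of _ B])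
  note C = mat_inverse_invertible[OF A inv]
  have "the (mat_inverse A) = the (mat_inverse A) * (A * B)" using AB C by simp
  also have "\<dots> = B" using A B C by (simp add: assoc_mult_mat[symmetric, of _ n n _ n _ n])
  finally show "the (mat_inverse A) = B" .
qed

text \<open>Each term of the Leibniz expansion takes one entry from every column, and an entry is at
  most the norm of its column. This is Hadamard's inequality up to the factor \<open>fact n\<close>,
  which later constants absorb.\<close>

lemma det_le_prod_vnorm_cols:
  assumes A: "A \<in> carrier_mat n n"
  shows "cmod (det A) \<le> fact n * (\<Prod>j<n. vnorm (col A j))"
proof -
  have "cmod (det A) \<le> (\<Sum>p | p permutes {0..<n}. \<Prod>j<n. vnorm (col A j))"
    unfolding det_def'[OF A]
  proof (rule sum_norm_le)
    fix p assume "p \<in> {p. p permutes {0..<n}}"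
    then have p: "p permutes {0..<n}" by simp
    have "cmod (signof p * (\<Prod>i = 0..<n. A $$ (i, p i))) = (\<Prod>i = 0..<n. cmod (A $$ (i, p i)))"
      by (simp add: norm_mult prod_norm sign_def)
    also have "\<dots> \<le> (\<Prod>i = 0..<n. vnorm (col A (p i)))"
    proof (rule prod_mono)
      fix i assume i: "i \<in> {0..<n}"
      then have "p i < n" using p permutes_in_image by fastforce
      then show "0 \<le> cmod (A $$ (i, p i)) \<and> cmod (A $$ (i, p i)) \<le> vnorm (col A (p i))"
        using vnorm_ge_entry[of i "col A (p i)"] A i by simp
    qed
    also have "\<dots> = (\<Prod>j = 0..<n. vnorm (col A j))"
      using prod.permute[OF p, of "\<lambda>j. vnorm (col A j)"] by (simp add: comp_def)
    finally show "cmod (signof p * (\<Prod>i = 0..<n. A $$ (i, p i))) \<le> (\<Prod>j<n. vnorm (col A j))"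
      by (simp add: atLeast0LessThan)
  qed
  then show ?thesis by (simp add: card_permutations)
qed

text \<open>For the matrix \<open>?W\<close> whose columns form the base, the columns of
  \<open>M * ?W\<close> are the transformed base vectors, and det M = det (M W) / det W. The
  constant depends on the base only, not on \<open>M\<close>.\<close>

lemma basis_det_bound:
  assumes B: "finite B" "card B = n" "mrank n w B = n" "w ` B \<subseteq> carrier_vec n"
  shows "\<exists>K>0. \<forall>M\<in>carrier_mat n n. cmod (det M) \<le> K * (\<Prod>s\<in>B. vnorm (M *\<^sub>v w s))"
proof -
  obtain bs where bs: "distinct bs" "set bs = B" using B(1) finite_distinct_list by blast
  then have len: "length bs = n" using B(2) distinct_card by fastforce
  let ?W = "mat_of_cols n (map w bs)"
  have W: "?W \<in> carrier_mat n n" using len by auto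
  have d: "det ?W \<noteq> 0" using det_basis_nonzero[of bs n w] bs len B by simp
  show ?thesis
  proof (intro exI[of _ "fact n / cmod (det ?W)"] conjI ballI)
    show "0 < fact n / cmod (det ?W)" using d by simp
    fix M :: "complex mat" assume M: "M \<in> carrier_mat n n"
    have "col (M * ?W) j = M *\<^sub>v w (bs ! j)" if "j < n" for j
    proof -
      have "w (bs ! j) \<in> carrier_vec n" using that len bs B by (metis image_subset_iff nth_mem)
      then show ?thesis using that len M W by (subst col_mult2) auto
    qed
    then have "cmod (det (M * ?W)) \<le> fact n * (\<Prod>j<n. vnorm (M *\<^sub>v w (bs ! j)))"
      using det_le_prod_vnorm_cols[of "M * ?W" n] M W by simp
    also have "(\<Prod>j<n. vnorm (M *\<^sub>v w (bs ! j))) = (\<Prod>s\<in>B. vnorm (M *\<^sub>v w s))"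
      using bij_betw_nth[OF bs(1), of "{..<n}" B] bs len
      by (intro prod.reindex_bij_betw) auto
    finally show "cmod (det M) \<le> fact n / cmod (det ?W) * (\<Prod>s\<in>B. vnorm (M *\<^sub>v w s))"
      using d by (simp add: det_mult[OF M W] norm_mult field_simps)
  qed
qed

section \<open>Rank-one representations\<close>

locale rank_one_quiver = fin_digraph Q
  for Q :: "('v, 'a) pre_digraph" +
  fixes \<alpha> :: "'v \<Rightarrow> nat" and \<sigma> :: "'v \<Rightarrow> int"
    and V :: "'a \<Rightarrow> complex mat" and v f :: "'a \<Rightarrow> complex vec"
  assumes acyclic: "acyclic_quiver Q"
    and rank_one: "rank_one_rep Q \<alpha> V"
    and factors: "rank_one_factors Q \<alpha> V v f"
begin

abbreviation D where "D \<equiv> rep_digraph Q v f"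
abbreviation w where "w \<equiv> node_vec v f"
abbreviation rk_plus where "rk_plus i X \<equiv> mrank (\<alpha> i) w (S_plus Q i \<inter> X)"
abbreviation rk_minus where "rk_minus i X \<equiv> mrank (\<alpha> i) w (S_minus Q i - X)"

lemma v_carrier: "a \<in> arcs Q \<Longrightarrow> v a \<in> carrier_vec (\<alpha> (head Q a))"
  and f_carrier: "a \<in> arcs Q \<Longrightarrow> f a \<in> carrier_vec (\<alpha> (tail Q a))"
  using factors by (auto simp: rank_one_factors_def)

lemma S_plus_finite [simp]: "finite (S_plus Q i)"
  and S_minus_finite [simp]: "finite (S_minus Q i)"
  by (auto simp: S_plus_def S_minus_def)

lemma S_plus_carrier: "w ` S_plus Q i \<subseteq> carrier_vec (\<alpha> i)"
  and S_minus_carrier: "w ` S_minus Q i \<subseteq> carrier_vec (\<alpha> i)"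
  using v_carrier f_carrier by (auto simp: S_plus_def S_minus_def)

lemma in_S_plus: "s \<in> S_plus Q i \<longleftrightarrow> (\<exists>a\<in>arcs Q. s = Fnl a \<and> tail Q a = i)"
  and in_S_minus: "s \<in> S_minus Q i \<longleftrightarrow> (\<exists>a\<in>arcs Q. s = Vct a \<and> head Q a = i)"
  by (auto simp: S_plus_def S_minus_def)

lemma verts_D: "verts D = (\<Union>i\<in>verts Q. S_plus Q i \<union> S_minus Q i)"
  by (simp add: rep_digraph_def)

lemma node_in_verts_D: "Fnl a \<in> verts D \<longleftrightarrow> a \<in> arcs Q" "Vct a \<in> verts D \<longleftrightarrow> a \<in> arcs Q"
  by (auto simp: verts_D in_S_plus in_S_minus)

lemma finite_verts_D: "finite (verts D)"
  by (simp add: verts_D)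

lemma arcs_D: "arcs D = {(Fnl a, Vct a) | a. a \<in> arcs Q} \<union>
  {(Vct a, Fnl b) | a b. a \<in> arcs Q \<and> b \<in> arcs Q \<and> head Q a = tail Q b \<and> f b \<bullet> v a \<noteq> 0}"
  by (auto simp: rep_digraph_def in_S_plus in_S_minus)

lemma D_simps [simp]: "tail D = fst" "head D = snd"
  by (simp_all add: rep_digraph_def)

lemma arcs_D_verts: "arcs D \<subseteq> verts D \<times> verts D"
  by (auto simp: arcs_D node_in_verts_D)

sublocale D: fin_digraph D
proof
  show "finite (arcs D)"
    using finite_subset[OF arcs_D_verts] finite_verts_D by simp
qed (use arcs_D_verts finite_verts_D in auto)

lemma sum_verts_D:
  fixes g :: "'a node \<Rightarrow> 'r::comm_monoid_add"
  assumes "X \<subseteq> verts D"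
  shows "sum g X = (\<Sum>i\<in>verts Q. sum g (S_plus Q i \<inter> X) + sum g (S_minus Q i \<inter> X))"
proof -
  have "X = (\<Union>i\<in>verts Q. (S_plus Q i \<union> S_minus Q i) \<inter> X)" using assms verts_D by auto
  then have "sum g X = sum g (\<Union>i\<in>verts Q. (S_plus Q i \<union> S_minus Q i) \<inter> X)" by simp
  also have "\<dots> = (\<Sum>i\<in>verts Q. sum g ((S_plus Q i \<union> S_minus Q i) \<inter> X))"
    by (rule sum.UNION_disjoint) (auto simp: in_S_plus in_S_minus)
  also have "\<dots> = (\<Sum>i\<in>verts Q. sum g (S_plus Q i \<inter> X) + sum g (S_minus Q i \<inter> X))"
  proof (rule sum.cong[OF refl])
    fix i
    have "S_plus Q i \<inter> X \<inter> (S_minus Q i \<inter> X) = {}" by (auto simp: in_S_plus in_S_minus)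
    then show "sum g ((S_plus Q i \<union> S_minus Q i) \<inter> X) = sum g (S_plus Q i \<inter> X) + sum g (S_minus Q i \<inter> X)"
      unfolding Int_Un_distrib2 by (intro sum.union_disjoint) auto
  qed
  finally show ?thesis .
qed

section \<open>The cut condition, (S) and (S)'\<close>

text \<open>An arc of infinite capacity entering \<open>X\<close> makes the cut inequality of
  \<open>X\<close> void, so only sets without entering arcs can obstruct a flow. For these the
  boundary of a nonnegative flow has a nonnegative sum.\<close>

definition cut_condition :: bool where
  "cut_condition \<longleftrightarrow> (\<forall>X\<subseteq>verts D. (\<forall>(s, t)\<in>arcs D. t \<in> X \<longrightarrow> s \<in> X) \<longrightarrow> 0 \<le> flow_bound Q \<alpha> v f \<sigma> X)"

lemma flow_bound_alt:
  "flow_bound Q \<alpha> v f \<sigma> X = (\<Sum>i\<in>verts Q. of_int (pos \<sigma> i) * real (rk_plus i X))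
    + (\<Sum>i\<in>verts Q. of_int (neg \<sigma> i) * real (rk_minus i X))
    - (\<Sum>i\<in>verts Q. of_int (neg \<sigma> i) * real (mrank (\<alpha> i) w (S_minus Q i)))"
  by (simp add: flow_bound_def sum.distrib sum_subtractf)

lemma pos_neg_nonneg [simp]: "0 \<le> pos \<sigma> i" "0 \<le> neg \<sigma> i"
  by (auto simp: pos_def neg_def)

lemma cond_F_pos: "cond_F Q \<alpha> v f \<sigma> \<Longrightarrow> i \<in> verts Q \<Longrightarrow> pos \<sigma> i > 0 \<Longrightarrow> mrank (\<alpha> i) w (S_plus Q i) = \<alpha> i"
  and cond_F_neg: "cond_F Q \<alpha> v f \<sigma> \<Longrightarrow> i \<in> verts Q \<Longrightarrow> neg \<sigma> i > 0 \<Longrightarrow> mrank (\<alpha> i) w (S_minus Q i) = \<alpha> i"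
  by (auto simp: cond_F_def pos_def neg_def)

lemma cond_F_sums:
  assumes "cond_F Q \<alpha> v f \<sigma>"
  shows "(\<Sum>i\<in>verts Q. of_int (pos \<sigma> i) * real (mrank (\<alpha> i) w (S_plus Q i))) = of_int (\<Sum>i\<in>verts Q. pos \<sigma> i * int (\<alpha> i))"
    and "(\<Sum>i\<in>verts Q. of_int (neg \<sigma> i) * real (mrank (\<alpha> i) w (S_minus Q i))) = of_int (\<Sum>i\<in>verts Q. neg \<sigma> i * int (\<alpha> i))"
proof -
  have "of_int (pos \<sigma> i) * real (mrank (\<alpha> i) w (S_plus Q i)) = of_int (pos \<sigma> i * int (\<alpha> i))"
    "of_int (neg \<sigma> i) * real (mrank (\<alpha> i) w (S_minus Q i)) = of_int (neg \<sigma> i * int (\<alpha> i))" if "i \<in> verts Q" for i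
    using cond_F_pos[OF assms that] cond_F_neg[OF assms that] pos_neg_nonneg[of i]
    by (cases "pos \<sigma> i = 0"; cases "neg \<sigma> i = 0"; force)+
  then show "(\<Sum>i\<in>verts Q. of_int (pos \<sigma> i) * real (mrank (\<alpha> i) w (S_plus Q i))) = of_int (\<Sum>i\<in>verts Q. pos \<sigma> i * int (\<alpha> i))"
    "(\<Sum>i\<in>verts Q. of_int (neg \<sigma> i) * real (mrank (\<alpha> i) w (S_minus Q i))) = of_int (\<Sum>i\<in>verts Q. neg \<sigma> i * int (\<alpha> i))"
    unfolding of_int_sum by (auto intro: sum.cong)
qed

lemma cond_S_imp_cut_condition:
  assumes "cond_S Q \<alpha> v f \<sigma>"
  shows cut_condition
  unfolding cut_condition_def
proof (intro allI impI)
  fix X assume X: "X \<subseteq> verts D" and closed: "\<forall>(s, t)\<in>arcs D. t \<in> X \<longrightarrow> s \<in> X"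
  obtain \<phi> :: "'a node \<times> 'a node \<Rightarrow> real" where \<phi>: "\<And>e. e \<in> arcs D \<Longrightarrow> 0 \<le> \<phi> e"
    and B: "boundary D \<phi> \<in> base_polytope (verts D) (flow_bound Q \<alpha> v f \<sigma>)"
    using assms by (auto simp: cond_S_def submodular_flow_feasible_def)
  have "sum \<phi> {e \<in> arcs D. snd e \<in> X} \<le> sum \<phi> {e \<in> arcs D. fst e \<in> X}"
    using \<phi> closed by (intro sum_mono2) auto
  then have "0 \<le> sum (boundary D \<phi>) X"
    using D.sum_boundary[of X \<phi>] finite_subset[OF X finite_verts_D] by simp
  also have "\<dots> \<le> flow_bound Q \<alpha> v f \<sigma> X" using B X by (auto simp: base_polytope_def)
  finally show "0 \<le> flow_bound Q \<alpha> v f \<sigma> X" .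
qed

lemma cond_S'_flowE:
  assumes "cond_S' Q \<alpha> v f \<sigma>"
  obtains \<phi> :: "'a node \<times> 'a node \<Rightarrow> int" and B B'
  where "\<forall>e\<in>arcs D. 0 \<le> \<phi> e"
    and "\<forall>i\<in>verts Q. (\<forall>l\<in>{1..nat (pos \<sigma> i)}. B i l \<in> mbases (\<alpha> i) w (S_plus Q i)) \<and>
      (\<forall>s\<in>S_plus Q i. boundary D \<phi> s = (\<Sum>l = 1..nat (pos \<sigma> i). indicator (B i l) s))"
    and "\<forall>i\<in>verts Q. (\<forall>l\<in>{1..nat (neg \<sigma> i)}. B' i l \<in> mbases (\<alpha> i) w (S_minus Q i)) \<and>
      (\<forall>s\<in>S_minus Q i. boundary D \<phi> s = - (\<Sum>l = 1..nat (neg \<sigma> i). indicator (B' i l) s))"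
proof -
  let ?B = "\<lambda>\<phi> i B. (\<forall>l\<in>{1..nat (pos \<sigma> i)}. B l \<in> mbases (\<alpha> i) w (S_plus Q i)) \<and>
    (\<forall>s\<in>S_plus Q i. boundary D \<phi> s = (\<Sum>l = 1..nat (pos \<sigma> i). indicator (B l) s))"
  let ?B' = "\<lambda>\<phi> i B. (\<forall>l\<in>{1..nat (neg \<sigma> i)}. B l \<in> mbases (\<alpha> i) w (S_minus Q i)) \<and>
    (\<forall>s\<in>S_minus Q i. boundary D \<phi> s = - (\<Sum>l = 1..nat (neg \<sigma> i). indicator (B l) s))"
  obtain \<phi> :: "'a node \<times> 'a node \<Rightarrow> int" where \<phi>: "\<forall>e\<in>arcs D. 0 \<le> \<phi> e"
    and ex: "\<forall>i\<in>verts Q. \<exists>B. ?B \<phi> i B" and ex': "\<forall>i\<in>verts Q. \<exists>B. ?B' \<phi> i B"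
    using assms unfolding cond_S'_def by (elim exE conjE) auto
  from bchoice[OF ex] obtain B where B: "\<forall>i\<in>verts Q. ?B \<phi> i (B i)" ..
  from bchoice[OF ex'] obtain B' where B': "\<forall>i\<in>verts Q. ?B' \<phi> i (B' i)" ..
  show thesis by (rule that[OF \<phi> B B'])
qed

text \<open>Summed over a set, the boundary counts how many nodes of each base the set contains. On
  \<open>S_plus\<close> the count is at most a rank; on \<open>S_minus\<close> it enters negatively
  and is controlled through the complement. These are the summands of
  \<open>flow_bound\<close>.\<close>

lemma cond_S'_imp_cond_S:
  assumes K1: "cond_K1 Q \<alpha> \<sigma>" and F: "cond_F Q \<alpha> v f \<sigma>" and S': "cond_S' Q \<alpha> v f \<sigma>"
  shows "cond_S Q \<alpha> v f \<sigma>"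
proof -
  obtain \<phi> :: "'a node \<times> 'a node \<Rightarrow> int" and B B' where nonneg: "\<forall>e\<in>arcs D. 0 \<le> \<phi> e"
    and Bs: "\<forall>i\<in>verts Q. (\<forall>l\<in>{1..nat (pos \<sigma> i)}. B i l \<in> mbases (\<alpha> i) w (S_plus Q i)) \<and>
      (\<forall>s\<in>S_plus Q i. boundary D \<phi> s = (\<Sum>l = 1..nat (pos \<sigma> i). indicator (B i l) s))"
    and B's: "\<forall>i\<in>verts Q. (\<forall>l\<in>{1..nat (neg \<sigma> i)}. B' i l \<in> mbases (\<alpha> i) w (S_minus Q i)) \<and>
      (\<forall>s\<in>S_minus Q i. boundary D \<phi> s = - (\<Sum>l = 1..nat (neg \<sigma> i). indicator (B' i l) s))"
    using cond_S'_flowE[OF S'] .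
  have \<phi>: "0 \<le> \<phi> e" if "e \<in> arcs D" for e using nonneg that by blast
  have B: "B i l \<in> mbases (\<alpha> i) w (S_plus Q i)" if "i \<in> verts Q" "l \<in> {1..nat (pos \<sigma> i)}" for i l
    using Bs that by blast
  have bd: "boundary D \<phi> s = (\<Sum>l = 1..nat (pos \<sigma> i). indicator (B i l) s)"
    if "i \<in> verts Q" "s \<in> S_plus Q i" for i s
    using Bs that by blast
  have B': "B' i l \<in> mbases (\<alpha> i) w (S_minus Q i)" if "i \<in> verts Q" "l \<in> {1..nat (neg \<sigma> i)}" for i l
    using B's that by blast
  have bd': "boundary D \<phi> s = - (\<Sum>l = 1..nat (neg \<sigma> i). indicator (B' i l) s)"
    if "i \<in> verts Q" "s \<in> S_minus Q i" for i s
    using B's that by blast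
  define \<psi> where "\<psi> e = real_of_int (\<phi> e)" for e
  have bd\<psi>: "boundary D \<psi> s = real_of_int (boundary D \<phi> s)" for s
    by (simp add: boundary_def \<psi>_def)
  have sum_ind: "(\<Sum>s\<in>Y. \<Sum>l\<in>L. indicator (C l) s) = (\<Sum>l\<in>L. int (card (C l \<inter> Y)))" if "finite Y"
    for Y :: "'a node set" and L :: "nat set" and C
    using that by (subst sum.swap) (simp add: indicator_def sum.If_cases Int_commute)
  have "sum (boundary D \<psi>) X \<le> flow_bound Q \<alpha> v f \<sigma> X" if X: "X \<subseteq> verts D" for X
  proof -
    have "sum (boundary D \<phi>) (S_plus Q i \<inter> X) \<le> pos \<sigma> i * int (rk_plus i X)"
      if i: "i \<in> verts Q" for i
    proof -
      have "sum (boundary D \<phi>) (S_plus Q i \<inter> X)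
          = (\<Sum>s\<in>S_plus Q i \<inter> X. \<Sum>l = 1..nat (pos \<sigma> i). indicator (B i l) s)"
        using bd[OF i] by (intro sum.cong) auto
      also have "\<dots> = (\<Sum>l = 1..nat (pos \<sigma> i). int (card (B i l \<inter> (S_plus Q i \<inter> X))))"
        by (rule sum_ind) simp
      also have "\<dots> \<le> (\<Sum>l = 1..nat (pos \<sigma> i). int (rk_plus i X))"
        using mbases_inter_card(1)[OF _ S_plus_carrier B[OF i], of _ "S_plus Q i \<inter> X"]
        by (intro sum_mono) (simp add: Int_assoc[symmetric])
      finally show ?thesis by simp
    qed
    moreover have "sum (boundary D \<phi>) (S_minus Q i \<inter> X)
        \<le> neg \<sigma> i * int (rk_minus i X) - neg \<sigma> i * int (mrank (\<alpha> i) w (S_minus Q i))"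
      if i: "i \<in> verts Q" for i
    proof -
      have "sum (boundary D \<phi>) (S_minus Q i \<inter> X)
          = (\<Sum>s\<in>S_minus Q i \<inter> X. - (\<Sum>l = 1..nat (neg \<sigma> i). indicator (B' i l) s))"
        using bd'[OF i] by (intro sum.cong) auto
      also have "\<dots> = - (\<Sum>s\<in>S_minus Q i \<inter> X. \<Sum>l = 1..nat (neg \<sigma> i). indicator (B' i l) s)"
        by (rule sum_negf)
      also have "\<dots> = (\<Sum>l = 1..nat (neg \<sigma> i). - int (card (B' i l \<inter> (S_minus Q i \<inter> X))))"
        by (subst sum_ind) (simp_all add: sum_negf)
      also have "\<dots> \<le> (\<Sum>l = 1..nat (neg \<sigma> i). int (rk_minus i X) - int (mrank (\<alpha> i) w (S_minus Q i)))"
      proof (rule sum_mono)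
        fix l assume "l \<in> {1..nat (neg \<sigma> i)}"
        from mbases_inter_card(2)[OF _ S_minus_carrier B'[OF i this], of "S_minus Q i \<inter> X"]
        show "- int (card (B' i l \<inter> (S_minus Q i \<inter> X))) \<le> int (rk_minus i X) - int (mrank (\<alpha> i) w (S_minus Q i))"
          by (simp add: Diff_Int)
      qed
      finally show ?thesis by (simp add: algebra_simps)
    qed
    ultimately have "sum (boundary D \<phi>) X \<le> (\<Sum>i\<in>verts Q. pos \<sigma> i * int (rk_plus i X)
        + (neg \<sigma> i * int (rk_minus i X) - neg \<sigma> i * int (mrank (\<alpha> i) w (S_minus Q i))))"
      unfolding sum_verts_D[OF X] by (intro sum_mono add_mono)
    then have "real_of_int (sum (boundary D \<phi>) X) \<le> of_int (\<Sum>i\<in>verts Q. pos \<sigma> i * int (rk_plus i X)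
        + (neg \<sigma> i * int (rk_minus i X) - neg \<sigma> i * int (mrank (\<alpha> i) w (S_minus Q i))))"
      by (simp only: of_int_le_iff)
    then show ?thesis by (simp add: bd\<psi> flow_bound_def add_diff_eq)
  qed
  \<comment> \<open>A boundary has total 0, and (F) with (K1) makes the two rank sums in
    \<open>flow_bound\<close> cancel on the full node set.\<close>
  moreover have "sum (boundary D \<psi>) (verts D) = flow_bound Q \<alpha> v f \<sigma> (verts D)"
  proof -
    have "{e \<in> arcs D. tail D e \<in> verts D} = arcs D" "{e \<in> arcs D. head D e \<in> verts D} = arcs D"
      using arcs_D_verts by auto
    then have "sum (boundary D \<psi>) (verts D) = 0" using D.sum_boundary[OF finite_verts_D, of \<psi>] by simp
    moreover have "flow_bound Q \<alpha> v f \<sigma> (verts D) = 0"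
    proof -
      have "S_plus Q i \<inter> verts D = S_plus Q i" "S_minus Q i - verts D = {}" if "i \<in> verts Q" for i
        using that by (auto simp: verts_D)
      then have "rk_plus i (verts D) = mrank (\<alpha> i) w (S_plus Q i)" "rk_minus i (verts D) = 0"
        if "i \<in> verts Q" for i
        using that by (simp_all only: mrank_empty)
      then show ?thesis
        unfolding flow_bound_alt using cond_F_sums[OF F] K1 by (simp add: cond_K1_def del: of_int_sum)
    qed
    ultimately show ?thesis by simp
  qed
  moreover have "\<forall>e\<in>arcs D. 0 \<le> ereal (\<psi> e)" using \<phi> by (simp add: \<psi>_def)
  ultimately show ?thesis
    unfolding cond_S_def submodular_flow_feasible_def base_polytope_def
    by (intro exI[of _ \<psi>]) auto
qed

text \<open>The pair \<open>(i, l)\<close> in \<open>J1\<close> or \<open>J2\<close> stands for the \<open>l\<close>-th copy of the matroid at \<open>i\<close>.\<close>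

lemma cut_condition_imp_matched_bases:
  assumes K1: "cond_K1 Q \<alpha> \<sigma>" and F: "cond_F Q \<alpha> v f \<sigma>" and cut: cut_condition
  defines "J1 \<equiv> SIGMA i:verts Q. {1..nat (pos \<sigma> i)}" and "J2 \<equiv> SIGMA i:verts Q. {1..nat (neg \<sigma> i)}"
  shows "\<exists>I :: ((('v \<times> nat) \<times> 'a node) \<times> (('v \<times> nat) \<times> 'a node)) set. finite I \<and>
    (\<forall>e\<in>I. fst (fst e) \<in> J1 \<and> snd (fst e) \<in> S_plus Q (fst (fst (fst e))) \<and>
      fst (snd e) \<in> J2 \<and> snd (snd e) \<in> S_minus Q (fst (fst (snd e))) \<and>
      (snd (fst e), snd (snd e)) \<in> (arcs D)\<^sup>*) \<and>
    card I = (\<Sum>x\<in>J1. \<alpha> (fst x)) \<and> card I = (\<Sum>y\<in>J2. \<alpha> (fst y)) \<and>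
    (\<Sum>x\<in>J1. mrank (\<alpha> (fst x)) w ((snd \<circ> fst) ` {e \<in> I. fst (fst e) = x})) = card I \<and>
    (\<Sum>y\<in>J2. mrank (\<alpha> (fst y)) w ((snd \<circ> snd) ` {e \<in> I. fst (snd e) = y})) = card I"
proof -
  have fin: "finite J1" "finite J2" by (auto simp: J1_def J2_def)
  have sumJ1: "(\<Sum>x\<in>J1. g (fst x)) = (\<Sum>i\<in>verts Q. pos \<sigma> i * g i)"
    and sumJ2: "(\<Sum>x\<in>J2. g (fst x)) = (\<Sum>i\<in>verts Q. neg \<sigma> i * g i)" for g :: "'v \<Rightarrow> int"
  proof -
    have "(\<Sum>x\<in>J1. g (fst x)) = (\<Sum>i\<in>verts Q. \<Sum>l\<in>{1..nat (pos \<sigma> i)}. g i)"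
      unfolding J1_def by (subst sum.Sigma) (auto simp: case_prod_unfold)
    then show "(\<Sum>x\<in>J1. g (fst x)) = (\<Sum>i\<in>verts Q. pos \<sigma> i * g i)" by simp
    have "(\<Sum>x\<in>J2. g (fst x)) = (\<Sum>i\<in>verts Q. \<Sum>l\<in>{1..nat (neg \<sigma> i)}. g i)"
      unfolding J2_def by (subst sum.Sigma) (auto simp: case_prod_unfold)
    then show "(\<Sum>x\<in>J2. g (fst x)) = (\<Sum>i\<in>verts Q. neg \<sigma> i * g i)" by simp
  qed
  define k where "k = (\<Sum>x\<in>J1. \<alpha> (fst x))"
  have k1: "int k = (\<Sum>i\<in>verts Q. pos \<sigma> i * int (\<alpha> i))"
    unfolding k_def using sumJ1[of "\<lambda>i. int (\<alpha> i)"] by simp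
  have k2': "int (\<Sum>y\<in>J2. \<alpha> (fst y)) = (\<Sum>i\<in>verts Q. neg \<sigma> i * int (\<alpha> i))"
    using sumJ2[of "\<lambda>i. int (\<alpha> i)"] by simp
  then have k2: "k = (\<Sum>y\<in>J2. \<alpha> (fst y))" using k1 K1 by (simp add: cond_K1_def del: of_nat_sum)
  let ?R = "(arcs D)\<^sup>*"
  \<comment> \<open>Sources and sinks, each together with a copy. On the pairs \<open>E\<close>
    joined by a walk, one matroid is pulled back from the sources and the other from the sinks, so a
    set independent in both is a matching with independent ends in every copy.\<close>
  define U1 where "U1 = (SIGMA x:J1. S_plus Q (fst x))"
  define U2 where "U2 = (SIGMA y:J2. S_minus Q (fst y))"
  define E where "E = {e \<in> U1 \<times> U2. (snd (fst e), snd (snd e)) \<in> ?R}"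
  have finE: "finite E" unfolding E_def U1_def U2_def using fin by auto
  let ?r1 = "\<lambda>A. \<Sum>x\<in>J1. int (mrank (\<alpha> (fst x)) w ((snd \<circ> fst) ` {e \<in> A. fst (fst e) = x}))"
  let ?r2 = "\<lambda>A. \<Sum>y\<in>J2. int (mrank (\<alpha> (fst y)) w ((snd \<circ> snd) ` {e \<in> A. fst (snd e) = y}))"
  have r1: "rank_function E ?r1"
    using S_plus_carrier
    by (intro rank_function_mrank_sum[where \<kappa> = "\<lambda>e. fst (fst e)" and n = "\<lambda>x. \<alpha> (fst x)"] fin finE)
      (auto simp: E_def U1_def image_subset_iff)
  have r2: "rank_function E ?r2"
    using S_minus_carrier
    by (intro rank_function_mrank_sum[where \<kappa> = "\<lambda>e. fst (snd e)" and n = "\<lambda>x. \<alpha> (fst x)"] fin finE)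
      (auto simp: E_def U2_def image_subset_iff)
  have "int k \<le> ?r1 A + ?r2 (E - A)" if A: "A \<subseteq> E" for A
  proof -
    \<comment> \<open>\<open>Y\<close> collects what is reachable from source copies that no pair of
      \<open>A\<close> uses, so no arc enters its complement \<open>X\<close>. A source in
      \<open>X\<close> is used by \<open>A\<close> in every copy, since reachability is reflexive; a
      sink outside \<open>X\<close> is, in every copy, the end of a pair outside \<open>A\<close>.
      Hence the ranks at \<open>X\<close> are dominated by those of \<open>A\<close> and
      \<open>E - A\<close>.\<close>
    define Y where "Y = {u \<in> verts D. \<exists>x s. (x, s) \<in> U1 - fst ` A \<and> (s, u) \<in> ?R}"
    define X where "X = verts D - Y"
    have "s \<in> X" if st: "(s, t) \<in> arcs D" "t \<in> X" for s t
    proof -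
      have "s \<in> verts D" "t \<in> verts D" using arcs_D_verts st by auto
      moreover have "t \<in> Y" if "s \<in> Y"
      proof -
        from that obtain x r where "(x, r) \<in> U1 - fst ` A" "(r, s) \<in> ?R" unfolding Y_def by blast
        moreover from this(2) st(1) have "(r, t) \<in> ?R" by (rule rtrancl_into_rtrancl)
        ultimately show ?thesis using \<open>t \<in> verts D\<close> unfolding Y_def by blast
      qed
      ultimately show ?thesis using st(2) by (auto simp: X_def)
    qed
    then have "\<forall>(s, t)\<in>arcs D. t \<in> X \<longrightarrow> s \<in> X" by blast
    moreover have "X \<subseteq> verts D" unfolding X_def by blast
    ultimately have fb: "0 \<le> flow_bound Q \<alpha> v f \<sigma> X"
      using cut unfolding cut_condition_def by blast
    have "rk_plus (fst x) X \<le> mrank (\<alpha> (fst x)) w ((snd \<circ> fst) ` {e \<in> A. fst (fst e) = x})" if x: "x \<in> J1" for x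
    proof (rule mrank_mono)
      have "finite A" using A finE finite_subset by blast
      then show "finite ((snd \<circ> fst) ` {e \<in> A. fst (fst e) = x})" by simp
      show "w ` (snd \<circ> fst) ` {e \<in> A. fst (fst e) = x} \<subseteq> carrier_vec (\<alpha> (fst x))"
        using A S_plus_carrier by (auto simp: E_def U1_def image_subset_iff subset_iff)
      show "S_plus Q (fst x) \<inter> X \<subseteq> (snd \<circ> fst) ` {e \<in> A. fst (fst e) = x}"
      proof
        fix s assume s: "s \<in> S_plus Q (fst x) \<inter> X"
        then have "s \<notin> Y" "s \<in> verts D" "(x, s) \<in> U1" using x by (auto simp: X_def U1_def)
        then have "(x, s) \<in> fst ` A" unfolding Y_def by blast
        then show "s \<in> (snd \<circ> fst) ` {e \<in> A. fst (fst e) = x}" by force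
      qed
    qed
    then have "(\<Sum>x\<in>J1. int (rk_plus (fst x) X)) \<le> ?r1 A" by (intro sum_mono) simp
    moreover have "rk_minus (fst y) X \<le> mrank (\<alpha> (fst y)) w ((snd \<circ> snd) ` {e \<in> E - A. fst (snd e) = y})" if y: "y \<in> J2" for y
    proof (rule mrank_mono)
      show "finite ((snd \<circ> snd) ` {e \<in> E - A. fst (snd e) = y})" using finE by simp
      show "w ` (snd \<circ> snd) ` {e \<in> E - A. fst (snd e) = y} \<subseteq> carrier_vec (\<alpha> (fst y))"
        using S_minus_carrier by (auto simp: E_def U2_def image_subset_iff subset_iff)
      show "S_minus Q (fst y) - X \<subseteq> (snd \<circ> snd) ` {e \<in> E - A. fst (snd e) = y}"
      proof
        fix t assume t: "t \<in> S_minus Q (fst y) - X"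
        have "fst y \<in> verts Q" using y by (auto simp: J2_def)
        with t have "t \<in> Y" by (auto simp: X_def verts_D)
        then obtain x s where xs: "(x, s) \<in> U1 - fst ` A" "(s, t) \<in> ?R" unfolding Y_def by blast
        then have "((x, s), (y, t)) \<in> E" using t y by (auto simp: E_def U2_def)
        moreover have "((x, s), (y, t)) \<notin> A" using xs by force
        ultimately show "t \<in> (snd \<circ> snd) ` {e \<in> E - A. fst (snd e) = y}" by force
      qed
    qed
    then have "(\<Sum>y\<in>J2. int (rk_minus (fst y) X)) \<le> ?r2 (E - A)" by (intro sum_mono) simp
    \<comment> \<open>This is \<open>fb\<close> rearranged: by (F) and (K1) the constant subtracted
      in \<open>flow_bound\<close> equals \<open>k\<close>.\<close>
    moreover have "int k \<le> (\<Sum>x\<in>J1. int (rk_plus (fst x) X)) + (\<Sum>y\<in>J2. int (rk_minus (fst y) X))"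
    proof -
      have "real_of_int (int k) = (\<Sum>i\<in>verts Q. of_int (neg \<sigma> i) * real (mrank (\<alpha> i) w (S_minus Q i)))"
        unfolding cond_F_sums(2)[OF F] using K1 k1 by (simp add: cond_K1_def)
      with fb have "real_of_int (int k) \<le> real_of_int ((\<Sum>i\<in>verts Q. pos \<sigma> i * int (rk_plus i X))
          + (\<Sum>i\<in>verts Q. neg \<sigma> i * int (rk_minus i X)))"
        unfolding flow_bound_alt by simp
      then show ?thesis
        unfolding sumJ1[of "\<lambda>i. int (rk_plus i X)"] sumJ2[of "\<lambda>i. int (rk_minus i X)"]
        by (simp only: of_int_le_iff)
    qed
    ultimately show ?thesis by linarith
  qed
  from matroid_intersection[OF finE r1 r2 this] obtain I where I: "I \<subseteq> E" "card I = k" "?r1 I = int k" "?r2 I = int k"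
    by blast
  have "finite I" using I(1) finE finite_subset by blast
  moreover have "\<forall>e\<in>I. fst (fst e) \<in> J1 \<and> snd (fst e) \<in> S_plus Q (fst (fst (fst e))) \<and>
      fst (snd e) \<in> J2 \<and> snd (snd e) \<in> S_minus Q (fst (fst (snd e))) \<and>
      (snd (fst e), snd (snd e)) \<in> (arcs D)\<^sup>*"
    using I(1) by (auto simp: E_def U1_def U2_def)
  moreover have "card I = (\<Sum>x\<in>J1. \<alpha> (fst x))" "card I = (\<Sum>y\<in>J2. \<alpha> (fst y))"
    using I(2) k2 by (simp_all add: k_def)
  moreover have "(\<Sum>x\<in>J1. mrank (\<alpha> (fst x)) w ((snd \<circ> fst) ` {e \<in> I. fst (fst e) = x})) = card I"
    "(\<Sum>y\<in>J2. mrank (\<alpha> (fst y)) w ((snd \<circ> snd) ` {e \<in> I. fst (snd e) = y})) = card I"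
    using I(2-4) unfolding of_nat_sum[symmetric] of_nat_eq_iff by auto
  ultimately show ?thesis by blast
qed

text \<open>Each matched pair contributes a unit flow from its source to its sink. By
  \<open>tight_fibres\<close> the nodes matched in one copy form a base without repetition, so the
  boundary of the superposition is a sum of characteristic vectors of bases.\<close>

lemma cut_condition_imp_cond_S':
  assumes K1: "cond_K1 Q \<alpha> \<sigma>" and F: "cond_F Q \<alpha> v f \<sigma>" and cut: cut_condition
  shows "cond_S' Q \<alpha> v f \<sigma>"
proof -
  define J1 where "J1 = (SIGMA i:verts Q. {1..nat (pos \<sigma> i)})"
  define J2 where "J2 = (SIGMA i:verts Q. {1..nat (neg \<sigma> i)})"
  have fin: "finite J1" "finite J2" by (auto simp: J1_def J2_def)
  obtain I :: "((('v \<times> nat) \<times> 'a node) \<times> (('v \<times> nat) \<times> 'a node)) set" where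
    finI: "finite I"
    and I: "\<forall>e\<in>I. fst (fst e) \<in> J1 \<and> snd (fst e) \<in> S_plus Q (fst (fst (fst e))) \<and>
      fst (snd e) \<in> J2 \<and> snd (snd e) \<in> S_minus Q (fst (fst (snd e))) \<and>
      (snd (fst e), snd (snd e)) \<in> (arcs D)\<^sup>*"
    and card: "card I = (\<Sum>x\<in>J1. \<alpha> (fst x))" "card I = (\<Sum>y\<in>J2. \<alpha> (fst y))"
    and rank: "(\<Sum>x\<in>J1. mrank (\<alpha> (fst x)) w ((snd \<circ> fst) ` {e \<in> I. fst (fst e) = x})) = card I"
      "(\<Sum>y\<in>J2. mrank (\<alpha> (fst y)) w ((snd \<circ> snd) ` {e \<in> I. fst (snd e) = y})) = card I"
    using cut_condition_imp_matched_bases[OF K1 F cut] unfolding J1_def J2_def by blast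
  have x1: "fst (fst e) \<in> J1" and s1: "snd (fst e) \<in> S_plus Q (fst (fst (fst e)))"
    and x2: "fst (snd e) \<in> J2" and s2: "snd (snd e) \<in> S_minus Q (fst (fst (snd e)))"
    and reach: "(snd (fst e), snd (snd e)) \<in> (arcs D)\<^sup>*" if "e \<in> I" for e
    using I that by blast+
  let ?p1 = "snd \<circ> fst :: (('v \<times> nat) \<times> 'a node) \<times> (('v \<times> nat) \<times> 'a node) \<Rightarrow> 'a node"
  let ?p2 = "snd \<circ> snd :: (('v \<times> nat) \<times> 'a node) \<times> (('v \<times> nat) \<times> 'a node) \<Rightarrow> 'a node"
  define B1 where "B1 x = ?p1 ` {e \<in> I. fst (fst e) = x}" for x
  define B2 where "B2 y = ?p2 ` {e \<in> I. fst (snd e) = y}" for y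
  have B1_sub: "B1 x \<subseteq> S_plus Q (fst x)" and B2_sub: "B2 x \<subseteq> S_minus Q (fst x)" for x
    using s1 s2 by (auto simp: B1_def B2_def)
  have tight1: "mrank (\<alpha> (fst x)) w (B1 x) = \<alpha> (fst x)" "card (B1 x) = \<alpha> (fst x)"
      "inj_on ?p1 {e \<in> I. fst (fst e) = x}" if x: "x \<in> J1" for x
    unfolding B1_def using x1 s1 S_plus_carrier
    by (intro tight_fibres[OF fin(1) finI _ _ rank(1) card(1) x]; auto simp: image_subset_iff)+
  have tight2: "mrank (\<alpha> (fst x)) w (B2 x) = \<alpha> (fst x)" "card (B2 x) = \<alpha> (fst x)"
      "inj_on ?p2 {e \<in> I. fst (snd e) = x}" if x: "x \<in> J2" for x
    unfolding B2_def using x2 s2 S_minus_carrier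
    by (intro tight_fibres[OF fin(2) finI _ _ rank(2) card(2) x]; auto simp: image_subset_iff)+
  have "\<forall>e\<in>I. \<exists>\<phi>. (\<forall>a. 0 \<le> \<phi> a) \<and>
      (\<forall>u. boundary D \<phi> u = of_bool (u = ?p1 e) - (of_bool (u = ?p2 e) :: int))"
  proof
    fix e assume "e \<in> I"
    then show "\<exists>\<phi>. (\<forall>a. 0 \<le> \<phi> a) \<and>
      (\<forall>u. boundary D \<phi> u = of_bool (u = ?p1 e) - (of_bool (u = ?p2 e) :: int))"
      using unit_flow[of _ "snd (fst e)" "snd (snd e)"] D.finite_arcs reach unfolding rep_digraph_def by simp
  qed
  from bchoice[OF this] obtain \<phi> where \<phi>: "\<And>e a. e \<in> I \<Longrightarrow> 0 \<le> \<phi> e a"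
    and bd: "\<And>e u. e \<in> I \<Longrightarrow> boundary D (\<phi> e) u = of_bool (u = ?p1 e) - (of_bool (u = ?p2 e) :: int)"
    by blast
  define \<psi> where "\<psi> a = (\<Sum>e\<in>I. \<phi> e a)" for a
  have bd\<psi>: "boundary D \<psi> u = (\<Sum>e\<in>I. of_bool (?p1 e = u)) - (\<Sum>e\<in>I. of_bool (?p2 e = u))" for u
    unfolding \<psi>_def boundary_sum_flows sum_subtractf[symmetric]
    by (rule sum.cong[OF refl]) (simp add: bd eq_commute)
  have count1: "(\<Sum>e\<in>I. of_bool (?p1 e = u)) = (\<Sum>x\<in>J1. indicator (B1 x) u :: int)" for u
    unfolding B1_def using x1 by (intro count_by_fibres[OF fin(1) finI] tight1(3)) auto
  have count2: "(\<Sum>e\<in>I. of_bool (?p2 e = u)) = (\<Sum>x\<in>J2. indicator (B2 x) u :: int)" for u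
    unfolding B2_def using x2 by (intro count_by_fibres[OF fin(2) finI] tight2(3)) auto
  have plus: "boundary D \<psi> s = (\<Sum>l = 1..nat (pos \<sigma> i). indicator (B1 (i, l)) s)"
    if i: "i \<in> verts Q" and s: "s \<in> S_plus Q i" for i s
  proof -
    \<comment> \<open>A functional is never a sink, and only the copies at its own vertex can
      contain it.\<close>
    have "(\<Sum>x\<in>J2. indicator (B2 x) s :: int) = 0"
      using B2_sub s by (intro sum.neutral) (fastforce simp: indicator_def in_S_plus in_S_minus)
    moreover have "(\<Sum>x\<in>J1. indicator (B1 x) s :: int)
        = (\<Sum>j\<in>verts Q. \<Sum>l = 1..nat (pos \<sigma> j). indicator (B1 (j, l)) s)"
      unfolding J1_def by (subst sum.Sigma) (auto simp: case_prod_unfold)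
    moreover have "\<dots> = (\<Sum>j\<in>{i}. \<Sum>l = 1..nat (pos \<sigma> j). indicator (B1 (j, l)) s)"
      using B1_sub s i
      by (intro sum.mono_neutral_right) (fastforce simp: indicator_def in_S_plus intro!: sum.neutral)+
    ultimately show ?thesis unfolding bd\<psi> count1 count2 by simp
  qed
  have minus: "boundary D \<psi> s = - (\<Sum>l = 1..nat (neg \<sigma> i). indicator (B2 (i, l)) s)"
    if i: "i \<in> verts Q" and s: "s \<in> S_minus Q i" for i s
  proof -
    have "(\<Sum>x\<in>J1. indicator (B1 x) s :: int) = 0"
      using B1_sub s by (intro sum.neutral) (fastforce simp: indicator_def in_S_plus in_S_minus)
    moreover have "(\<Sum>x\<in>J2. indicator (B2 x) s :: int)
        = (\<Sum>j\<in>verts Q. \<Sum>l = 1..nat (neg \<sigma> j). indicator (B2 (j, l)) s)"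
      unfolding J2_def by (subst sum.Sigma) (auto simp: case_prod_unfold)
    moreover have "\<dots> = (\<Sum>j\<in>{i}. \<Sum>l = 1..nat (neg \<sigma> j). indicator (B2 (j, l)) s)"
      using B2_sub s i
      by (intro sum.mono_neutral_right) (fastforce simp: indicator_def in_S_minus intro!: sum.neutral)+
    ultimately show ?thesis unfolding bd\<psi> count1 count2 by simp
  qed
  have base1: "B1 (i, l) \<in> mbases (\<alpha> i) w (S_plus Q i)" if "i \<in> verts Q" "l \<in> {1..nat (pos \<sigma> i)}" for i l
    using that tight1[of "(i, l)"] B1_sub[of "(i, l)"] cond_F_pos[OF F that(1)]
    by (auto simp: J1_def mbases_def)
  have base2: "B2 (i, l) \<in> mbases (\<alpha> i) w (S_minus Q i)" if "i \<in> verts Q" "l \<in> {1..nat (neg \<sigma> i)}" for i l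
    using that tight2[of "(i, l)"] B2_sub[of "(i, l)"] cond_F_neg[OF F that(1)]
    by (auto simp: J2_def mbases_def)
  have "\<forall>e\<in>arcs D. 0 \<le> \<psi> e" using \<phi> by (auto simp: \<psi>_def intro: sum_nonneg)
  moreover have "\<exists>B. (\<forall>l\<in>{1..nat (pos \<sigma> i)}. B l \<in> mbases (\<alpha> i) w (S_plus Q i)) \<and>
      (\<forall>s\<in>S_plus Q i. boundary D \<psi> s = (\<Sum>l = 1..nat (pos \<sigma> i). indicator (B l) s))"
    if "i \<in> verts Q" for i
    using base1[OF that] plus[OF that] by (intro exI[of _ "\<lambda>l. B1 (i, l)"]) blast
  moreover have "\<exists>B. (\<forall>l\<in>{1..nat (neg \<sigma> i)}. B l \<in> mbases (\<alpha> i) w (S_minus Q i)) \<and>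
      (\<forall>s\<in>S_minus Q i. boundary D \<psi> s = - (\<Sum>l = 1..nat (neg \<sigma> i). indicator (B l) s))"
    if "i \<in> verts Q" for i
    using base2[OF that] minus[OF that] by (intro exI[of _ "\<lambda>l. B2 (i, l)"]) blast
  ultimately show ?thesis unfolding cond_S'_def by blast
qed

section \<open>The group action and the energy\<close>

abbreviation ginv where "ginv g i \<equiv> the (mat_inverse (g i))"
abbreviation arc_norm where
  "arc_norm g a \<equiv> frobenius_norm (g (head Q a) * V a * ginv g (tail Q a))"

lemma ends_in_verts [simp]: "a \<in> arcs Q \<Longrightarrow> head Q a \<in> verts Q" "a \<in> arcs Q \<Longrightarrow> tail Q a \<in> verts Q"
  by auto

lemma V_eq: "a \<in> arcs Q \<Longrightarrow> V a = outer_prod (v a) (f a)"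
  using rank_one factors v_carrier[of a] f_carrier[of a]
  by (intro mat_eq_by_action[of _ "\<alpha> (head Q a)" "\<alpha> (tail Q a)"])
    (auto simp: rank_one_rep_def quiver_rep_def rank_one_factors_def outer_prod_mult_vec)

lemma GL_D:
  assumes "g \<in> GL Q \<alpha>" "i \<in> verts Q"
  shows "g i \<in> carrier_mat (\<alpha> i) (\<alpha> i)" "ginv g i \<in> carrier_mat (\<alpha> i) (\<alpha> i)"
    "g i * ginv g i = 1\<^sub>m (\<alpha> i)" "ginv g i * g i = 1\<^sub>m (\<alpha> i)" "det (g i) * det (ginv g i) = 1" "det (g i) \<noteq> 0"
proof -
  have g: "g i \<in> carrier_mat (\<alpha> i) (\<alpha> i)" "invertible_mat (g i)" using assms by (auto simp: GL_def)
  note inv = mat_inverse_invertible[OF g]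
  show "g i \<in> carrier_mat (\<alpha> i) (\<alpha> i)" "ginv g i \<in> carrier_mat (\<alpha> i) (\<alpha> i)"
    "g i * ginv g i = 1\<^sub>m (\<alpha> i)" "ginv g i * g i = 1\<^sub>m (\<alpha> i)" using g inv by auto
  show "det (g i) * det (ginv g i) = 1" using det_mult[OF g(1) inv(1)] inv(2) by simp
  then show "det (g i) \<noteq> 0" by auto
qed

text \<open>The group turns \<open>v a\<close> and \<open>f a\<close> into new factors of a rank-one
  matrix, so the norm splits into one term for each of the nodes \<open>Vct a\<close> and
  \<open>Fnl a\<close>.\<close>

lemma arc_norm_eq:
  assumes "g \<in> GL Q \<alpha>" "a \<in> arcs Q"
  shows "(arc_norm g a)\<^sup>2 = (vnorm (g (head Q a) *\<^sub>v v a) * vnorm ((ginv g (tail Q a))\<^sup>T *\<^sub>v f a))\<^sup>2"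
  using assms GL_D v_carrier f_carrier
  by (simp add: V_eq mult_outer_prod_mult[of _ "\<alpha> (head Q a)" _ "\<alpha> (tail Q a)"] frobenius_outer_prod)

abbreviation energy where
  "energy g \<equiv> (\<Sum>a\<in>arcs Q. (arc_norm g a)\<^sup>2) + (cmod (character Q \<sigma> g))\<^sup>2"

lemma energy_nonneg: "0 \<le> energy g"
  by (intro add_nonneg_nonneg sum_nonneg) auto

lemma one_in_GL: "(\<lambda>i. 1\<^sub>m (\<alpha> i)) \<in> GL Q \<alpha>"
  using mat_inverse_eqI(1)[of "1\<^sub>m n :: complex mat" n "1\<^sub>m n" for n] by (simp add: GL_def)

text \<open>An infimum of reals is meaningful only for a nonempty set bounded below; the identity in
  \<open>GL\<close> and the nonnegative energy provide this.\<close>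

lemma semistable_iff: "semistable Q \<alpha> V \<sigma> \<longleftrightarrow> (\<exists>c>0. \<forall>g\<in>GL Q \<alpha>. c \<le> energy g)"
proof
  assume ss: "semistable Q \<alpha> V \<sigma>"
  have "bdd_below (energy ` GL Q \<alpha>)" using energy_nonneg by (intro bdd_belowI[of _ 0]) auto
  then have "\<forall>g\<in>GL Q \<alpha>. (INF g\<in>GL Q \<alpha>. energy g) \<le> energy g" by (auto intro: cINF_lower)
  then show "\<exists>c>0. \<forall>g\<in>GL Q \<alpha>. c \<le> energy g" using ss unfolding semistable_def by blast
next
  assume "\<exists>c>0. \<forall>g\<in>GL Q \<alpha>. c \<le> energy g"
  then obtain c where "c > 0" "\<And>g. g \<in> GL Q \<alpha> \<Longrightarrow> c \<le> energy g" by blast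
  then have "c \<le> (INF g\<in>GL Q \<alpha>. energy g)" using one_in_GL by (intro cINF_greatest) auto
  with \<open>c > 0\<close> show "semistable Q \<alpha> V \<sigma>" unfolding semistable_def by linarith
qed

text \<open>The height counts the vertices from which a nontrivial walk leads to \<open>u\<close>.
  Along an arc this set can only grow, and by acyclicity the tail is counted at the head but not at
  itself.\<close>

lemma height_exists: "\<exists>h :: 'v \<Rightarrow> nat. \<forall>a\<in>arcs Q. h (tail Q a) < h (head Q a)"
proof -
  have irrefl: "\<not> u \<rightarrow>\<^sup>+\<^bsub>Q\<^esub> u" for u
  proof
    assume "u \<rightarrow>\<^sup>+\<^bsub>Q\<^esub> u"
    then obtain p where "awalk u p u" "p \<noteq> []" by (auto simp: reachable1_awalk)
    then have "closed_w p" by (auto simp: closed_w_def)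
    then show False using closed_w_imp_cycle acyclic by (auto simp: acyclic_quiver_def)
  qed
  let ?h = "\<lambda>u. card {x \<in> verts Q. x \<rightarrow>\<^sup>+\<^bsub>Q\<^esub> u}"
  have "?h (tail Q a) < ?h (head Q a)" if a: "a \<in> arcs Q" for a
  proof (rule psubset_card_mono)
    have arc: "tail Q a \<rightarrow>\<^sup>+\<^bsub>Q\<^esub> head Q a" using in_arcs_imp_in_arcs_ends[OF a] by blast
    then have "{x \<in> verts Q. x \<rightarrow>\<^sup>+\<^bsub>Q\<^esub> tail Q a} \<subseteq> {x \<in> verts Q. x \<rightarrow>\<^sup>+\<^bsub>Q\<^esub> head Q a}"
      by (auto intro: trancl_trans)
    moreover have "tail Q a \<in> {x \<in> verts Q. x \<rightarrow>\<^sup>+\<^bsub>Q\<^esub> head Q a}" "tail Q a \<notin> {x \<in> verts Q. x \<rightarrow>\<^sup>+\<^bsub>Q\<^esub> tail Q a}"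
      using arc a irrefl by auto
    ultimately show "{x \<in> verts Q. x \<rightarrow>\<^sup>+\<^bsub>Q\<^esub> tail Q a} \<subset> {x \<in> verts Q. x \<rightarrow>\<^sup>+\<^bsub>Q\<^esub> head Q a}" by blast
  qed simp
  then show ?thesis by (intro exI[of _ ?h]) blast
qed

lemma scaled_in_GL:
  assumes g: "g \<in> GL Q \<alpha>" and t: "\<And>i. t i \<noteq> 0"
  shows "(\<lambda>i. t i \<cdot>\<^sub>m g i) \<in> GL Q \<alpha>"
    and "i \<in> verts Q \<Longrightarrow> the (mat_inverse (t i \<cdot>\<^sub>m g i)) = (1 / t i) \<cdot>\<^sub>m ginv g i"
proof -
  have "invertible_mat (t i \<cdot>\<^sub>m g i)" "the (mat_inverse (t i \<cdot>\<^sub>m g i)) = (1 / t i) \<cdot>\<^sub>m ginv g i"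
    if i: "i \<in> verts Q" for i
  proof -
    note D = GL_D[OF g i]
    have "t i \<cdot>\<^sub>m g i * ((1 / t i) \<cdot>\<^sub>m ginv g i) = 1\<^sub>m (\<alpha> i)" "(1 / t i) \<cdot>\<^sub>m ginv g i * (t i \<cdot>\<^sub>m g i) = 1\<^sub>m (\<alpha> i)"
      using D t[of i] by (auto simp: mult_smult_assoc_mat[of _ "\<alpha> i" "\<alpha> i"] mult_smult_distrib[of _ "\<alpha> i" "\<alpha> i"])
    then show "invertible_mat (t i \<cdot>\<^sub>m g i)" "the (mat_inverse (t i \<cdot>\<^sub>m g i)) = (1 / t i) \<cdot>\<^sub>m ginv g i"
      using mat_inverse_eqI[of "t i \<cdot>\<^sub>m g i" "\<alpha> i" "(1 / t i) \<cdot>\<^sub>m ginv g i"] D by auto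
  qed
  then show "(\<lambda>i. t i \<cdot>\<^sub>m g i) \<in> GL Q \<alpha>"
    "i \<in> verts Q \<Longrightarrow> the (mat_inverse (t i \<cdot>\<^sub>m g i)) = (1 / t i) \<cdot>\<^sub>m ginv g i"
    using GL_D[OF g] by (auto simp: GL_def)
qed

lemma arc_norm_scaled:
  assumes g: "g \<in> GL Q \<alpha>" and t: "\<And>i. t i \<noteq> 0" and a: "a \<in> arcs Q"
  shows "(arc_norm (\<lambda>i. t i \<cdot>\<^sub>m g i) a)\<^sup>2 = (cmod (t (head Q a) / t (tail Q a)))\<^sup>2 * (arc_norm g a)\<^sup>2"
proof -
  note h = GL_D[OF g ends_in_verts(1)[OF a]] and l = GL_D[OF g ends_in_verts(2)[OF a]]
  have "(t (head Q a) \<cdot>\<^sub>m g (head Q a)) *\<^sub>v v a = t (head Q a) \<cdot>\<^sub>v (g (head Q a) *\<^sub>v v a)"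
    using h v_carrier[OF a] by (intro eq_vecI) auto
  moreover have "((1 / t (tail Q a)) \<cdot>\<^sub>m ginv g (tail Q a))\<^sup>T *\<^sub>v f a = (1 / t (tail Q a)) \<cdot>\<^sub>v ((ginv g (tail Q a))\<^sup>T *\<^sub>v f a)"
    using l f_carrier[OF a] by (intro eq_vecI) (auto simp: scalar_prod_def sum_distrib_left mult.assoc)
  ultimately show ?thesis
    unfolding arc_norm_eq[OF scaled_in_GL(1)[of g t, OF g t] a] arc_norm_eq[OF g a]
    using scaled_in_GL(2)[of g t, OF g t ends_in_verts(2)[OF a]]
    by (simp add: vnorm_smult norm_divide power_mult_distrib power_divide)
qed

lemma character_scaled:
  assumes g: "g \<in> GL Q \<alpha>"
  shows "character Q \<sigma> (\<lambda>i. t i \<cdot>\<^sub>m g i) = (\<Prod>i\<in>verts Q. (t i ^ \<alpha> i) powi \<sigma> i) * character Q \<sigma> g"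
  unfolding character_def prod.distrib[symmetric]
proof (rule prod.cong[OF refl])
  fix i assume "i \<in> verts Q"
  then have "det (t i \<cdot>\<^sub>m g i) = t i ^ \<alpha> i * det (g i)"
    using carrier_matD(2)[OF GL_D(1)[OF g]] by (simp add: det_smult)
  then show "det (t i \<cdot>\<^sub>m g i) powi \<sigma> i = (t i ^ \<alpha> i) powi \<sigma> i * det (g i) powi \<sigma> i"
    by (simp only: power_int_mult_distrib)
qed

text \<open>Semistability is applied to \<open>g\<close> rescaled by t^(h i). The height rises by at
  least 1 along every arc, so each squared arc norm shrinks by a factor at most \<open>t\<close>,
  while the character changes by the fixed factor \<open>K\<close>. Once the arcs take up at most
  half of \<open>c0\<close>, the other half must come from the character.\<close>

lemma semistable_character_bound:
  assumes "semistable Q \<alpha> V \<sigma>"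
  shows "\<exists>c>0. \<forall>g\<in>GL Q \<alpha>. (\<forall>a\<in>arcs Q. (arc_norm g a)\<^sup>2 \<le> C) \<longrightarrow> c \<le> cmod (character Q \<sigma> g)"
proof -
  obtain c0 where c0: "c0 > 0" "\<And>g. g \<in> GL Q \<alpha> \<Longrightarrow> c0 \<le> energy g"
    using assms by (auto simp: semistable_iff)
  obtain h :: "'v \<Rightarrow> nat" where h: "\<And>a. a \<in> arcs Q \<Longrightarrow> h (tail Q a) < h (head Q a)"
    using height_exists by blast
  \<comment> \<open>Chosen so that \<open>t * N \<le> c0\<close> keeps the total of the rescaled
    arcs below \<open>c0 / 2\<close>. The summand 1 keeps \<open>N\<close> positive.\<close>
  define N where "N = 1 + 2 * real (card (arcs Q)) * \<bar>C\<bar>"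
  define t where "t = min 1 (c0 / N)"
  have N: "N \<ge> 1" by (simp add: N_def)
  have t: "0 < t" "t \<le> 1" "t * N \<le> c0" using N c0 by (auto simp: t_def min_def field_simps)
  define K where "K = (\<Prod>i\<in>verts Q. ((complex_of_real t ^ h i) ^ \<alpha> i) powi \<sigma> i)"
  have K: "0 < cmod K" using t by (simp add: K_def)
  have "sqrt (c0 / 2) / cmod K \<le> cmod (character Q \<sigma> g)"
    if g: "g \<in> GL Q \<alpha>" and C: "\<forall>a\<in>arcs Q. (arc_norm g a)\<^sup>2 \<le> C" for g
  proof -
    let ?s = "\<lambda>i. complex_of_real t ^ h i"
    have s: "\<And>i. ?s i \<noteq> 0" using t by simp
    let ?g = "\<lambda>i. ?s i \<cdot>\<^sub>m g i"
    have "(arc_norm ?g a)\<^sup>2 \<le> t * \<bar>C\<bar>" if a: "a \<in> arcs Q" for a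
    proof -
      have "cmod (?s (head Q a) / ?s (tail Q a)) = t ^ (h (head Q a) - h (tail Q a))"
        using t h[OF a] by (simp add: norm_divide norm_power power_diff)
      also have "\<dots> \<le> t ^ 1" using t h[OF a] by (intro power_decreasing) auto
      finally have le: "cmod (?s (head Q a) / ?s (tail Q a)) \<le> t" by simp
      then have "(cmod (?s (head Q a) / ?s (tail Q a)))\<^sup>2 \<le> t * t"
        unfolding power2_eq_square using t by (intro mult_mono) auto
      also have "\<dots> \<le> t * 1" using t by (intro mult_left_mono) auto
      finally have "(cmod (?s (head Q a) / ?s (tail Q a)))\<^sup>2 \<le> t" by simp
      moreover have "(arc_norm g a)\<^sup>2 \<le> \<bar>C\<bar>" using C a by force
      ultimately show ?thesis
        unfolding arc_norm_scaled[of g ?s a, OF g s a] using t by (intro mult_mono) simp_all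
    qed
    then have "(\<Sum>a\<in>arcs Q. (arc_norm ?g a)\<^sup>2) \<le> real (card (arcs Q)) * (t * \<bar>C\<bar>)"
      by (rule sum_bounded_above)
    also have "\<dots> \<le> c0 / 2" using t by (simp add: N_def algebra_simps)
    finally have "c0 / 2 \<le> (cmod (character Q \<sigma> ?g))\<^sup>2"
      using c0(2)[OF scaled_in_GL(1)[of g ?s, OF g s]] by linarith
    then have "sqrt (c0 / 2) \<le> cmod (character Q \<sigma> ?g)" by (rule real_le_lsqrt[rotated -1]) simp_all
    also have "\<dots> = cmod K * cmod (character Q \<sigma> g)"
      unfolding character_scaled[OF g] K_def by (simp add: norm_mult)
    finally show ?thesis using K by (simp add: field_simps)
  qed
  then show ?thesis using K c0 by (intro exI[of _ "sqrt (c0 / 2) / cmod K"]) auto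
qed

section \<open>Necessity: destabilising one-parameter subgroups\<close>

lemma pos_minus_neg: "pos \<sigma> i - neg \<sigma> i = \<sigma> i"
  by (simp add: pos_def neg_def)

lemma cond_K1_iff: "cond_K1 Q \<alpha> \<sigma> \<longleftrightarrow> (\<Sum>i\<in>verts Q. \<sigma> i * int (\<alpha> i)) = 0"
proof -
  have "(\<Sum>i\<in>verts Q. \<sigma> i * int (\<alpha> i)) = (\<Sum>i\<in>verts Q. pos \<sigma> i * int (\<alpha> i)) - (\<Sum>i\<in>verts Q. neg \<sigma> i * int (\<alpha> i))"
    unfolding sum_subtractf[symmetric] left_diff_distrib[symmetric] pos_minus_neg ..
  then show ?thesis by (auto simp: cond_K1_def)
qed

lemma prod_powi_sum:
  fixes s :: "'b::field"
  assumes "s \<noteq> 0" "finite A"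
  shows "(\<Prod>i\<in>A. (s ^ k i) powi m i) = s powi (\<Sum>i\<in>A. m i * int (k i))"
  using assms(2,1)
  by (induction A) (simp_all add: power_int_add power_int_power mult.commute)

text \<open>Scaling all \<open>g\<^sub>i\<close> by a common factor leaves the arcs unchanged.\<close>

lemma semistable_imp_K1:
  assumes "semistable Q \<alpha> V \<sigma>"
  shows "cond_K1 Q \<alpha> \<sigma>"
proof (rule ccontr)
  define m where "m = (\<Sum>i\<in>verts Q. \<sigma> i * int (\<alpha> i))"
  assume "\<not> cond_K1 Q \<alpha> \<sigma>"
  then have m: "m \<noteq> 0" by (simp add: cond_K1_iff m_def)
  let ?e = "\<lambda>i. 1\<^sub>m (\<alpha> i) :: complex mat"
  define C where "C = (\<Sum>a\<in>arcs Q. (arc_norm ?e a)\<^sup>2)"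
  obtain c where c: "c > 0"
    "\<And>g. g \<in> GL Q \<alpha> \<Longrightarrow> \<forall>a\<in>arcs Q. (arc_norm g a)\<^sup>2 \<le> C \<Longrightarrow> c \<le> cmod (character Q \<sigma> g)"
    using semistable_character_bound[OF assms, of C] by blast
  have bound: "c \<le> r powi m" if r: "r > 0" for r :: real
  proof -
    have r0: "complex_of_real r \<noteq> 0" using r by simp
    let ?g = "\<lambda>i. complex_of_real r \<cdot>\<^sub>m ?e i"
    have "(arc_norm ?g a)\<^sup>2 \<le> C" if "a \<in> arcs Q" for a
      using r that unfolding arc_norm_scaled[of ?e "\<lambda>_. complex_of_real r", OF one_in_GL r0 that] C_def
      by (auto intro: member_le_sum)
    then have "c \<le> cmod (character Q \<sigma> ?g)"
      using c(2)[OF scaled_in_GL(1)[of ?e "\<lambda>_. complex_of_real r", OF one_in_GL r0]] by blast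
    also have "character Q \<sigma> ?g = complex_of_real r powi m"
      unfolding character_scaled[OF one_in_GL] m_def using prod_powi_sum[OF r0, of "verts Q" \<alpha> \<sigma>]
      by (simp add: character_def)
    finally show ?thesis using r by (simp add: norm_power_int)
  qed
  \<comment> \<open>\<open>s\<close> lies below \<open>c\<close>, and being at most 1 it dominates
    its own positive powers. The sign of \<open>m\<close> decides whether \<open>s\<close> or its
    reciprocal is the scalar that makes the character small.\<close>
  define s where "s = min 1 (c / 2)"
  have s: "0 < s" "s \<le> 1" "s < c" using c by (auto simp: s_def)
  obtain r :: real where "r > 0" "r powi m = s ^ nat \<bar>m\<bar>"
  proof (cases "m > 0")
    case True
    then show ?thesis using that[of s] s by (simp add: power_int_def)
  next
    case False
    then show ?thesis using that[of "1 / s"] s by (simp add: power_int_def power_one_over field_simps)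
  qed
  then have "c \<le> s ^ nat \<bar>m\<bar>" using bound by metis
  also have "\<dots> \<le> s ^ 1" using s m by (intro power_decreasing) auto
  finally show False using s by simp
qed

text \<open>
  The easy half of King's criterion: the projections \<open>P\<^sub>i\<close> have a subrepresentation as image,
  and \<open>1 + (s - 1) P\<^sub>i\<close> is the one-parameter subgroup contracting it as \<open>s\<close> tends to \<open>0\<close>.
\<close>

lemma semistable_projections:
  assumes ss: "semistable Q \<alpha> V \<sigma>"
    and P: "\<And>i. i \<in> verts Q \<Longrightarrow> P i \<in> carrier_mat (\<alpha> i) (\<alpha> i)"
    and PP: "\<And>i. i \<in> verts Q \<Longrightarrow> P i * P i = P i"
    and det: "\<And>i s. i \<in> verts Q \<Longrightarrow> s \<noteq> 0 \<Longrightarrow> det (1\<^sub>m (\<alpha> i) + (s - 1) \<cdot>\<^sub>m P i) = s ^ k i"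
    and sub: "\<And>a. a \<in> arcs Q \<Longrightarrow> (P (tail Q a))\<^sup>T *\<^sub>v f a = 0\<^sub>v (\<alpha> (tail Q a)) \<or> P (head Q a) *\<^sub>v v a = v a"
  shows "(\<Sum>i\<in>verts Q. \<sigma> i * int (k i)) \<le> 0"
proof (rule ccontr)
  define m where "m = (\<Sum>i\<in>verts Q. \<sigma> i * int (k i))"
  assume "\<not> (\<Sum>i\<in>verts Q. \<sigma> i * int (k i)) \<le> 0"
  then have m: "m > 0" by (simp add: m_def)
  define G where "G s i = 1\<^sub>m (\<alpha> i) + (s - 1) \<cdot>\<^sub>m P i" for s :: complex and i
  have Gc: "G s i \<in> carrier_mat (\<alpha> i) (\<alpha> i)" if "i \<in> verts Q" for s i
    using P[OF that] by (simp add: G_def)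
  have Gv: "G s i *\<^sub>v u = u + (s - 1) \<cdot>\<^sub>v (P i *\<^sub>v u)"
    if i: "i \<in> verts Q" and u: "u \<in> carrier_vec (\<alpha> i)" for s i u
    using P[OF i] u unfolding G_def
    by (subst add_mult_distrib_mat_vec[of _ "\<alpha> i" "\<alpha> i"]) (auto intro!: eq_vecI)
  have GTv: "(G s i)\<^sup>T *\<^sub>v u = u + (s - 1) \<cdot>\<^sub>v ((P i)\<^sup>T *\<^sub>v u)"
    if i: "i \<in> verts Q" and u: "u \<in> carrier_vec (\<alpha> i)" for s i u
  proof -
    have "(G s i)\<^sup>T = 1\<^sub>m (\<alpha> i) + (s - 1) \<cdot>\<^sub>m (P i)\<^sup>T"
      using P[OF i] unfolding G_def by (intro eq_matI) auto
    then show ?thesis using P[OF i] u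
      by (simp, subst add_mult_distrib_mat_vec[of _ "\<alpha> i" "\<alpha> i"]) (auto intro!: eq_vecI)
  qed
  \<comment> \<open>\<open>G s i\<close> is multiplication by \<open>s\<close> on the image of the
    idempotent \<open>P i\<close> and the identity on its kernel, so inverting it replaces
    \<open>s\<close> by \<open>1 / s\<close>.\<close>
  have Ginv: "G s i * G (1 / s) i = 1\<^sub>m (\<alpha> i)" if i: "i \<in> verts Q" and s: "s \<noteq> 0" for s i
  proof (rule mat_eq_by_action[of _ "\<alpha> i" "\<alpha> i"])
    fix y :: "complex vec" assume y: "y \<in> carrier_vec (\<alpha> i)"
    have Py: "P i *\<^sub>v y \<in> carrier_vec (\<alpha> i)" using P[OF i] y by simp
    have "P i *\<^sub>v (P i *\<^sub>v y) = P i *\<^sub>v y"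
      using P[OF i] y PP[OF i] by (simp add: assoc_mult_mat_vec[symmetric])
    then have "P i *\<^sub>v (y + (1 / s - 1) \<cdot>\<^sub>v (P i *\<^sub>v y)) = P i *\<^sub>v y + (1 / s - 1) \<cdot>\<^sub>v (P i *\<^sub>v y)"
      using y Py by (simp add: mult_add_distrib_mat_vec[OF P[OF i]] mult_mat_vec[OF P[OF i]])
    then have "G s i *\<^sub>v (G (1 / s) i *\<^sub>v y)
        = (y + (1 / s - 1) \<cdot>\<^sub>v (P i *\<^sub>v y)) + (s - 1) \<cdot>\<^sub>v (P i *\<^sub>v y + (1 / s - 1) \<cdot>\<^sub>v (P i *\<^sub>v y))"
      using y Py by (simp add: Gv[OF i])
    also have "\<dots> = y" using y P[OF i] s
      by (intro eq_vecI) (auto simp: field_simps simp del: index_mult_mat_vec)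
    finally show "(G s i * G (1 / s) i) *\<^sub>v y = 1\<^sub>m (\<alpha> i) *\<^sub>v y"
      using assoc_mult_mat_vec[OF Gc[OF i, of s] Gc[OF i, of "1 / s"] y] y by simp
  qed (use mult_carrier_mat[OF Gc[OF i] Gc[OF i]] in simp_all)
  have GL: "G s \<in> GL Q \<alpha>" and GLinv: "\<And>i. i \<in> verts Q \<Longrightarrow> ginv (G s) i = G (1 / s) i" if s: "s \<noteq> 0" for s
  proof -
    have "invertible_mat (G s i) \<and> ginv (G s) i = G (1 / s) i" if i: "i \<in> verts Q" for i
      using mat_inverse_eqI[OF Gc[OF i] Gc[OF i] Ginv[OF i s]] Ginv[OF i, of "1 / s"] s by simp
    then show "G s \<in> GL Q \<alpha>" "\<And>i. i \<in> verts Q \<Longrightarrow> ginv (G s) i = G (1 / s) i"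
      using Gc by (auto simp: GL_def)
  qed
  \<comment> \<open>Bounds for the two factors of an arc norm, uniform in 0 < s \<le> 1: a projected
    entry occurs with a coefficient of modulus |s - 1| \<le> 1, and the triangle inequality gives
    the sums inside \<open>L2_set\<close>.\<close>
  define bv where "bv a = L2_set (\<lambda>j. cmod (v a $ j) + cmod ((P (head Q a) *\<^sub>v v a) $ j)) {..<\<alpha> (head Q a)}" for a
  define bf where "bf a = L2_set (\<lambda>j. cmod (f a $ j) + cmod (((P (tail Q a))\<^sup>T *\<^sub>v f a) $ j)) {..<\<alpha> (tail Q a)}" for a
  define C where "C = (\<Sum>a\<in>arcs Q. (bv a * bf a)\<^sup>2)"
  have bounded: "(arc_norm (G (of_real s)) a)\<^sup>2 \<le> C" if a: "a \<in> arcs Q" and s: "0 < s" "s \<le> 1" for s :: real and a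
  proof -
    let ?h = "head Q a" and ?t = "tail Q a" and ?s = "complex_of_real s"
    have s0: "?s \<noteq> 0" and cs: "cmod ?s \<le> 1" using s by simp_all
    have cs1: "cmod (?s - 1) \<le> 1"
      using s norm_of_real[of "s - 1", where 'a = complex] by simp
    have va: "v a \<in> carrier_vec (\<alpha> ?h)" and fa: "f a \<in> carrier_vec (\<alpha> ?t)" using a v_carrier f_carrier by auto
    have Ph: "P ?h \<in> carrier_mat (\<alpha> ?h) (\<alpha> ?h)" and Pt: "P ?t \<in> carrier_mat (\<alpha> ?t) (\<alpha> ?t)" using P a by auto
    have combine: "cmod (x + c * y) \<le> cmod x + cmod y" if "cmod c \<le> 1" for c x y
      using norm_triangle_ineq[of x "c * y"] mult_right_mono[OF that norm_ge_zero, of y] by (simp add: norm_mult)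
    \<comment> \<open>In the first case the inverse fixes \<open>f a\<close>, and only the bounded
      factor at the head varies. In the second \<open>v a\<close> is multiplied by \<open>s\<close>,
      which cancels the \<open>1 / s\<close> that the inverse may produce at the tail.\<close>
    have "vnorm (G ?s ?h *\<^sub>v v a) * vnorm ((ginv (G ?s) ?t)\<^sup>T *\<^sub>v f a) \<le> bv a * bf a"
      using sub[OF a]
    proof
      assume z: "(P ?t)\<^sup>T *\<^sub>v f a = 0\<^sub>v (\<alpha> ?t)"
      have "vnorm (G ?s ?h *\<^sub>v v a) \<le> bv a"
        unfolding bv_def using Ph va a combine[OF cs1]
        by (intro vnorm_mono) (auto simp: Gv simp del: index_mult_mat_vec)
      moreover have "(ginv (G ?s) ?t)\<^sup>T *\<^sub>v f a = f a"
        using a fa z by (simp add: GLinv[OF s0] GTv) (intro eq_vecI, auto)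
      moreover have "vnorm (f a) \<le> bf a"
        unfolding bf_def using fa by (intro vnorm_mono) auto
      ultimately show ?thesis by (intro mult_mono) (auto simp: bv_def)
    next
      assume z: "P ?h *\<^sub>v v a = v a"
      have "G ?s ?h *\<^sub>v v a = ?s \<cdot>\<^sub>v v a"
        using a va z by (simp add: Gv) (intro eq_vecI, auto simp: algebra_simps)
      then have 1: "vnorm (G ?s ?h *\<^sub>v v a) = cmod ?s * vnorm (v a)" by (simp add: vnorm_smult)
      have "vnorm (v a) \<le> bv a" unfolding bv_def using va by (intro vnorm_mono) auto
      have "?s \<cdot>\<^sub>v ((ginv (G ?s) ?t)\<^sup>T *\<^sub>v f a) = ?s \<cdot>\<^sub>v f a + (1 - ?s) \<cdot>\<^sub>v ((P ?t)\<^sup>T *\<^sub>v f a)"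
        using a fa Pt s0 by (simp add: GLinv[OF s0] GTv)
          (intro eq_vecI, auto simp: field_simps simp del: index_mult_mat_vec)
      moreover have "vnorm (?s \<cdot>\<^sub>v f a + (1 - ?s) \<cdot>\<^sub>v ((P ?t)\<^sup>T *\<^sub>v f a)) \<le> bf a"
        unfolding bf_def
      proof (rule vnorm_mono)
        fix j assume j: "j < \<alpha> ?t"
        let ?y = "((P ?t)\<^sup>T *\<^sub>v f a) $ j"
        have "cmod (?s * f a $ j + (1 - ?s) * ?y) \<le> cmod (?s * f a $ j) + cmod ?y"
          using cs1 by (intro combine) (simp add: norm_minus_commute)
        also have "cmod (?s * f a $ j) \<le> cmod (f a $ j)"
          using mult_right_mono[OF cs norm_ge_zero, of "f a $ j"] by (simp add: norm_mult)
        finally show "cmod ((?s \<cdot>\<^sub>v f a + (1 - ?s) \<cdot>\<^sub>v ((P ?t)\<^sup>T *\<^sub>v f a)) $ j) \<le> cmod (f a $ j) + cmod ?y"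
          using j fa Pt by (simp del: index_mult_mat_vec)
      qed (use fa Pt in simp)
      ultimately have "cmod ?s * vnorm ((ginv (G ?s) ?t)\<^sup>T *\<^sub>v f a) \<le> bf a" by (metis vnorm_smult)
      then have "vnorm (v a) * (cmod ?s * vnorm ((ginv (G ?s) ?t)\<^sup>T *\<^sub>v f a)) \<le> bv a * bf a"
        using \<open>vnorm (v a) \<le> bv a\<close> by (intro mult_mono) (auto simp: order_trans[OF vnorm_nonneg])
      then show ?thesis unfolding 1 by (simp add: ac_simps)
    qed
    then have "(arc_norm (G ?s) a)\<^sup>2 \<le> (bv a * bf a)\<^sup>2"
      unfolding arc_norm_eq[OF GL[OF s0] a] by (intro power_mono) auto
    also have "\<dots> \<le> C" unfolding C_def using a by (intro member_le_sum) auto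
    finally show ?thesis .
  qed
  obtain c where c: "c > 0"
    "\<And>g. g \<in> GL Q \<alpha> \<Longrightarrow> \<forall>a\<in>arcs Q. (arc_norm g a)\<^sup>2 \<le> C \<Longrightarrow> c \<le> cmod (character Q \<sigma> g)"
    using semistable_character_bound[OF ss, of C] by blast
  define s where "s = min 1 (c / 2)"
  have s: "0 < s" "s \<le> 1" "s < c" using c by (auto simp: s_def)
  then have s0: "complex_of_real s \<noteq> 0" by simp
  have "c \<le> cmod (character Q \<sigma> (G (of_real s)))"
    using c(2)[OF GL[OF s0]] bounded s by blast
  also have "character Q \<sigma> (G (of_real s)) = complex_of_real s powi m"
    unfolding m_def prod_powi_sum[OF s0 finite_verts, symmetric] character_def G_def
    using det s0 by (intro prod.cong) auto
  also have "cmod (complex_of_real s powi m) = s ^ nat m"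
    using s m by (simp add: norm_power power_int_def)
  also have "\<dots> \<le> s ^ 1" using s m by (intro power_decreasing) auto
  finally show False using s by simp
qed

text \<open>If \<sigma>(i) > 0 and the functionals leaving \<open>i\<close> do not span, their
  common kernel, placed at \<open>i\<close> alone, is a subrepresentation of positive weight. If
  \<sigma>(i) < 0 and the vectors entering \<open>i\<close> do not span, shrinking the whole
  representation at \<open>i\<close> to their span gives one.\<close>

lemma semistable_imp_F:
  assumes ss: "semistable Q \<alpha> V \<sigma>"
  shows "cond_F Q \<alpha> v f \<sigma>"
  unfolding cond_F_def
proof (intro conjI ballI impI)
  fix i assume i: "i \<in> verts Q" "\<sigma> i > 0"
  let ?r = "mrank (\<alpha> i) w (S_plus Q i)"
  have le: "?r \<le> \<alpha> i" by (rule mrank_le_dim[OF S_plus_finite S_plus_carrier])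
  obtain P0 where P0: "P0 \<in> carrier_mat (\<alpha> i) (\<alpha> i)" "P0 * P0 = P0"
    "\<And>u. u \<in> w ` S_plus Q i \<Longrightarrow> P0\<^sup>T *\<^sub>v u = 0\<^sub>v (\<alpha> i)"
    and det: "\<And>s. s \<noteq> 0 \<Longrightarrow> det (1\<^sub>m (\<alpha> i) + (s - 1) \<cdot>\<^sub>m P0) = s ^ (\<alpha> i - ?r)"
    using vec_space.projection_onto_annihilator[OF _ S_plus_carrier, of i] unfolding mrank_def by auto
  let ?P = "\<lambda>j. if j = i then P0 else 0\<^sub>m (\<alpha> j) (\<alpha> j)" and ?k = "\<lambda>j. if j = i then \<alpha> i - ?r else 0"
  have "(\<Sum>j\<in>verts Q. \<sigma> j * int (?k j)) \<le> 0"
  proof (rule semistable_projections[OF ss, of ?P])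
    fix j s assume "s \<noteq> (0::complex)"
    have "1\<^sub>m (\<alpha> j) + (s - 1) \<cdot>\<^sub>m 0\<^sub>m (\<alpha> j) (\<alpha> j) = 1\<^sub>m (\<alpha> j)" by (intro eq_matI) auto
    with det[OF \<open>s \<noteq> 0\<close>] show "det (1\<^sub>m (\<alpha> j) + (s - 1) \<cdot>\<^sub>m ?P j) = s ^ ?k j" by simp
  next
    fix a assume a: "a \<in> arcs Q"
    have "(?P (tail Q a))\<^sup>T *\<^sub>v f a = 0\<^sub>v (\<alpha> (tail Q a))"
    proof (cases "tail Q a = i")
      case True
      then have "f a \<in> w ` S_plus Q i" using a by (force simp: in_S_plus)
      with P0(3) True show ?thesis by simp
    next
      case False
      then show ?thesis using f_carrier[OF a] by (intro eq_vecI) auto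
    qed
    then show "(?P (tail Q a))\<^sup>T *\<^sub>v f a = 0\<^sub>v (\<alpha> (tail Q a)) \<or> ?P (head Q a) *\<^sub>v v a = v a" ..
  qed (use P0 in auto)
  also have "(\<Sum>j\<in>verts Q. \<sigma> j * int (?k j)) = (\<Sum>j\<in>verts Q. if j = i then \<sigma> i * int (\<alpha> i - ?r) else 0)"
    by (rule sum.cong) auto
  also have "\<dots> = \<sigma> i * int (\<alpha> i - ?r)" using i by simp
  finally show "?r = \<alpha> i" using i le by (simp add: mult_le_0_iff)
next
  fix i assume i: "i \<in> verts Q" "\<sigma> i < 0"
  let ?r = "mrank (\<alpha> i) w (S_minus Q i)"
  have le: "?r \<le> \<alpha> i" by (rule mrank_le_dim[OF S_minus_finite S_minus_carrier])
  obtain P0 where P0: "P0 \<in> carrier_mat (\<alpha> i) (\<alpha> i)" "P0 * P0 = P0"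
    "\<And>u. u \<in> w ` S_minus Q i \<Longrightarrow> P0 *\<^sub>v u = u"
    and det: "\<And>s. det (1\<^sub>m (\<alpha> i) + (s - 1) \<cdot>\<^sub>m P0) = s ^ ?r"
    using vec_space.projection_onto_span[OF _ S_minus_carrier, of i] unfolding mrank_def by auto
  let ?P = "\<lambda>j. if j = i then P0 else 1\<^sub>m (\<alpha> j)" and ?k = "\<lambda>j. if j = i then ?r else \<alpha> j"
  have "(\<Sum>j\<in>verts Q. \<sigma> j * int (?k j)) \<le> 0"
  proof (rule semistable_projections[OF ss, of ?P])
    fix j s assume "s \<noteq> (0::complex)"
    have "1\<^sub>m (\<alpha> j) + (s - 1) \<cdot>\<^sub>m 1\<^sub>m (\<alpha> j) = s \<cdot>\<^sub>m 1\<^sub>m (\<alpha> j)" by (intro eq_matI) auto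
    with det show "det (1\<^sub>m (\<alpha> j) + (s - 1) \<cdot>\<^sub>m ?P j) = s ^ ?k j" by simp
  next
    fix a assume a: "a \<in> arcs Q"
    have "?P (head Q a) *\<^sub>v v a = v a"
    proof (cases "head Q a = i")
      case True
      then have "v a \<in> w ` S_minus Q i" using a by (force simp: in_S_minus)
      with P0(3) True show ?thesis by simp
    next
      case False
      then show ?thesis using v_carrier[OF a] by simp
    qed
    then show "(?P (tail Q a))\<^sup>T *\<^sub>v f a = 0\<^sub>v (\<alpha> (tail Q a)) \<or> ?P (head Q a) *\<^sub>v v a = v a" ..
  qed (use P0 in auto)
  \<comment> \<open>Compared with the whole representation, whose weight is 0 by (K1), only the
    vertex \<open>i\<close> loses dimension.\<close>
  also have "(\<Sum>j\<in>verts Q. \<sigma> j * int (?k j))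
      = (\<Sum>j\<in>verts Q. \<sigma> j * int (\<alpha> j) - (if j = i then \<sigma> i * int (\<alpha> i - ?r) else 0))"
    using le by (intro sum.cong) (auto simp: of_nat_diff algebra_simps)
  also have "\<dots> = - \<sigma> i * int (\<alpha> i - ?r)"
    using i semistable_imp_K1[OF ss] by (simp add: sum_subtractf cond_K1_iff)
  finally show "?r = \<alpha> i" using i le by (simp add: zero_le_mult_iff)
qed

text \<open>
  A set \<open>X\<close> without entering arcs yields a subrepresentation of weight \<open>- f\<^sub>V(X)\<close>: the common
  kernel of \<open>S\<^sub>i\<^sup>+ \<inter> X\<close> if \<open>\<sigma>(i) > 0\<close>, and the span of \<open>S\<^sub>i\<^sup>- - X\<close> otherwise.
\<close>

lemma semistable_imp_cut_condition:
  assumes ss: "semistable Q \<alpha> V \<sigma>"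
  shows cut_condition
  unfolding cut_condition_def
proof (intro allI impI)
  fix X assume X: "X \<subseteq> verts D" and closed: "\<forall>(s, t)\<in>arcs D. t \<in> X \<longrightarrow> s \<in> X"
  note K1 = semistable_imp_K1[OF ss] and F = semistable_imp_F[OF ss]
  let ?A = "\<lambda>i. w ` (S_plus Q i \<inter> X)" and ?B = "\<lambda>i. w ` (S_minus Q i - X)"
  let ?k = "\<lambda>i. if \<sigma> i > 0 then \<alpha> i - rk_plus i X else rk_minus i X"
  have A: "finite (?A i)" "?A i \<subseteq> carrier_vec (\<alpha> i)" and B: "finite (?B i)" "?B i \<subseteq> carrier_vec (\<alpha> i)" for i
    using S_plus_carrier[of i] S_minus_carrier[of i] by auto
  \<comment> \<open>A nonzero pairing would give an arc \<open>(Vct a, Fnl b)\<close> entering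
    \<open>X\<close>. So the span of \<open>?B i\<close> lies in the common kernel of
    \<open>?A i\<close>.\<close>
  have orth: "x \<bullet> y = 0 \<and> y \<bullet> x = 0" if "x \<in> ?A i" "y \<in> ?B i" for i x y
  proof -
    from that obtain a b where ab: "a \<in> arcs Q" "b \<in> arcs Q" "head Q a = i" "tail Q b = i"
      "Vct a \<notin> X" "Fnl b \<in> X" "x = f b" "y = v a" by (auto simp: in_S_plus in_S_minus)
    then have "f b \<bullet> v a = 0" using closed by (auto simp: arcs_D)
    moreover have "v a \<bullet> f b = f b \<bullet> v a"
      using ab v_carrier[of a] f_carrier[of b] by (intro comm_scalar_prod) auto
    ultimately show ?thesis using ab by simp
  qed
  \<comment> \<open>Any subspace between the span of \<open>?B i\<close> and the kernel of
    \<open>?A i\<close> would respect the arcs. The weight is largest for the kernel if \<sigma>(i)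
    > 0 and for the span otherwise.\<close>
  have "\<exists>P\<in>carrier_mat (\<alpha> i) (\<alpha> i). P * P = P \<and> (\<forall>x\<in>?A i. P\<^sup>T *\<^sub>v x = 0\<^sub>v (\<alpha> i)) \<and>
      (\<forall>y\<in>?B i. P *\<^sub>v y = y) \<and> (\<forall>s. s \<noteq> 0 \<longrightarrow> det (1\<^sub>m (\<alpha> i) + (s - 1) \<cdot>\<^sub>m P) = s ^ ?k i)" for i
  proof (cases "\<sigma> i > 0")
    case True
    obtain P where "P \<in> carrier_mat (\<alpha> i) (\<alpha> i)" "P * P = P" "\<forall>x\<in>?A i. P\<^sup>T *\<^sub>v x = 0\<^sub>v (\<alpha> i)"
      and fixd: "\<forall>u\<in>carrier_vec (\<alpha> i). (\<forall>x\<in>?A i. x \<bullet> u = 0) \<longrightarrow> P *\<^sub>v u = u"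
      and "\<forall>s. s \<noteq> 0 \<longrightarrow> det (1\<^sub>m (\<alpha> i) + (s - 1) \<cdot>\<^sub>m P) = s ^ (\<alpha> i - rk_plus i X)"
      using vec_space.projection_onto_annihilator[OF A[of i]] unfolding mrank_def by blast
    moreover have "\<forall>y\<in>?B i. P *\<^sub>v y = y"
      using fixd orth[of _ i] B(2)[of i] by blast
    ultimately show ?thesis using True by (intro bexI[of _ P]) auto
  next
    case False
    obtain P where "P \<in> carrier_mat (\<alpha> i) (\<alpha> i)" "P * P = P" "\<forall>y\<in>?B i. P *\<^sub>v y = y"
      and ann: "\<forall>x\<in>carrier_vec (\<alpha> i). (\<forall>y\<in>?B i. x \<bullet> y = 0) \<longrightarrow> P\<^sup>T *\<^sub>v x = 0\<^sub>v (\<alpha> i)"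
      and "\<forall>s. det (1\<^sub>m (\<alpha> i) + (s - 1) \<cdot>\<^sub>m P) = s ^ rk_minus i X"
      using vec_space.projection_onto_span[OF B[of i]] unfolding mrank_def by blast
    moreover have "\<forall>x\<in>?A i. P\<^sup>T *\<^sub>v x = 0\<^sub>v (\<alpha> i)"
      using ann orth[of _ i] A(2)[of i] by blast
    ultimately show ?thesis using False by (intro bexI[of _ P]) auto
  qed
  then obtain P where P: "\<And>i. P i \<in> carrier_mat (\<alpha> i) (\<alpha> i)" "\<And>i. P i * P i = P i"
    and PA: "\<And>i x. x \<in> ?A i \<Longrightarrow> (P i)\<^sup>T *\<^sub>v x = 0\<^sub>v (\<alpha> i)"
    and PB: "\<And>i y. y \<in> ?B i \<Longrightarrow> P i *\<^sub>v y = y"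
    and det: "\<And>i s. s \<noteq> 0 \<Longrightarrow> det (1\<^sub>m (\<alpha> i) + (s - 1) \<cdot>\<^sub>m P i) = s ^ ?k i"
    unfolding Bex_def by metis
  have "(\<Sum>i\<in>verts Q. \<sigma> i * int (?k i)) \<le> 0"
  proof (rule semistable_projections[OF ss, of P])
    fix a assume a: "a \<in> arcs Q"
    show "(P (tail Q a))\<^sup>T *\<^sub>v f a = 0\<^sub>v (\<alpha> (tail Q a)) \<or> P (head Q a) *\<^sub>v v a = v a"
    proof (cases "Fnl a \<in> X")
      case True
      then have "f a \<in> ?A (tail Q a)" using a by (force simp: in_S_plus)
      with PA show ?thesis by blast
    next
      case False
      then have "Vct a \<notin> X" using closed a by (auto simp: arcs_D)
      then have "v a \<in> ?B (head Q a)" using a by (force simp: in_S_minus)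
      with PB show ?thesis by blast
    qed
  qed (use P det in auto)
  moreover have "\<sigma> i * int (?k i) = pos \<sigma> i * int (\<alpha> i) - pos \<sigma> i * int (rk_plus i X) - neg \<sigma> i * int (rk_minus i X)" for i
  proof -
    have "rk_plus i X \<le> \<alpha> i"
      using S_plus_carrier[of i] by (intro mrank_le_dim) auto
    then show ?thesis by (auto simp: pos_def neg_def of_nat_diff algebra_simps)
  qed
  ultimately have "(\<Sum>i\<in>verts Q. pos \<sigma> i * int (\<alpha> i)) \<le> (\<Sum>i\<in>verts Q. pos \<sigma> i * int (rk_plus i X)) + (\<Sum>i\<in>verts Q. neg \<sigma> i * int (rk_minus i X))"
    by (simp add: sum_subtractf)
  then have "real_of_int (\<Sum>i\<in>verts Q. neg \<sigma> i * int (\<alpha> i)) \<le> real_of_int ((\<Sum>i\<in>verts Q. pos \<sigma> i * int (rk_plus i X)) + (\<Sum>i\<in>verts Q. neg \<sigma> i * int (rk_minus i X)))"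
    using K1 by (simp only: cond_K1_def of_int_le_iff)
  then show "0 \<le> flow_bound Q \<alpha> v f \<sigma> X"
    unfolding flow_bound_alt cond_F_sums(2)[OF F] by simp
qed

section \<open>Sufficiency: a lower bound for the character from the flow\<close>

text \<open>Weak duality. Lower bounds for the potential drops, weighted by the flow, become by
  summation by parts a bound for the potential weighted by the boundary. At each vertex the boundary
  is made of bases, and the sum of the potential over a base is compared with ln |det g|.\<close>

lemma cond_S'_imp_semistable:
  assumes F: "cond_F Q \<alpha> v f \<sigma>" and S': "cond_S' Q \<alpha> v f \<sigma>"
  shows "semistable Q \<alpha> V \<sigma>"
proof -
  obtain \<phi> :: "'a node \<times> 'a node \<Rightarrow> int" and B B' where nonneg: "\<forall>e\<in>arcs D. 0 \<le> \<phi> e"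
    and Bs: "\<forall>i\<in>verts Q. (\<forall>l\<in>{1..nat (pos \<sigma> i)}. B i l \<in> mbases (\<alpha> i) w (S_plus Q i)) \<and>
      (\<forall>s\<in>S_plus Q i. boundary D \<phi> s = (\<Sum>l = 1..nat (pos \<sigma> i). indicator (B i l) s))"
    and B's: "\<forall>i\<in>verts Q. (\<forall>l\<in>{1..nat (neg \<sigma> i)}. B' i l \<in> mbases (\<alpha> i) w (S_minus Q i)) \<and>
      (\<forall>s\<in>S_minus Q i. boundary D \<phi> s = - (\<Sum>l = 1..nat (neg \<sigma> i). indicator (B' i l) s))"
    using cond_S'_flowE[OF S'] .
  have \<phi>: "0 \<le> \<phi> e" if "e \<in> arcs D" for e using nonneg that by blast

  let ?I = "SIGMA i:verts Q. {1..nat (pos \<sigma> i)}" and ?I' = "SIGMA i:verts Q. {1..nat (neg \<sigma> i)}"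
  have "\<forall>x\<in>?I. \<exists>K>0. \<forall>M\<in>carrier_mat (\<alpha> (fst x)) (\<alpha> (fst x)).
      cmod (det M) \<le> K * (\<Prod>s\<in>B (fst x) (snd x). vnorm (M *\<^sub>v w s))"
  proof
    fix x assume x: "x \<in> ?I"
    then have "B (fst x) (snd x) \<in> mbases (\<alpha> (fst x)) w (S_plus Q (fst x))" using Bs by auto
    moreover have "mrank (\<alpha> (fst x)) w (S_plus Q (fst x)) = \<alpha> (fst x)"
      using x by (intro cond_F_pos[OF F]) auto
    ultimately show "\<exists>K>0. \<forall>M\<in>carrier_mat (\<alpha> (fst x)) (\<alpha> (fst x)).
      cmod (det M) \<le> K * (\<Prod>s\<in>B (fst x) (snd x). vnorm (M *\<^sub>v w s))"
      using S_plus_carrier[of "fst x"]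
      by (intro basis_det_bound) (auto simp: mbases_def intro: finite_subset[OF _ S_plus_finite])
  qed
  from bchoice[OF this] obtain K where K: "\<forall>x\<in>?I. 0 < K x \<and> (\<forall>M\<in>carrier_mat (\<alpha> (fst x)) (\<alpha> (fst x)).
      cmod (det M) \<le> K x * (\<Prod>s\<in>B (fst x) (snd x). vnorm (M *\<^sub>v w s)))" ..
  have "\<forall>x\<in>?I'. \<exists>K>0. \<forall>M\<in>carrier_mat (\<alpha> (fst x)) (\<alpha> (fst x)).
      cmod (det M) \<le> K * (\<Prod>s\<in>B' (fst x) (snd x). vnorm (M *\<^sub>v w s))"
  proof
    fix x assume x: "x \<in> ?I'"
    then have "B' (fst x) (snd x) \<in> mbases (\<alpha> (fst x)) w (S_minus Q (fst x))" using B's by auto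
    moreover have "mrank (\<alpha> (fst x)) w (S_minus Q (fst x)) = \<alpha> (fst x)"
      using x by (intro cond_F_neg[OF F]) auto
    ultimately show "\<exists>K>0. \<forall>M\<in>carrier_mat (\<alpha> (fst x)) (\<alpha> (fst x)).
      cmod (det M) \<le> K * (\<Prod>s\<in>B' (fst x) (snd x). vnorm (M *\<^sub>v w s))"
      using S_minus_carrier[of "fst x"]
      by (intro basis_det_bound) (auto simp: mbases_def intro: finite_subset[OF _ S_minus_finite])
  qed
  from bchoice[OF this] obtain K' where K': "\<forall>x\<in>?I'. 0 < K' x \<and> (\<forall>M\<in>carrier_mat (\<alpha> (fst x)) (\<alpha> (fst x)).
      cmod (det M) \<le> K' x * (\<Prod>s\<in>B' (fst x) (snd x). vnorm (M *\<^sub>v w s)))" ..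

  \<comment> \<open>A lower bound for the potential drop: 0 on \<open>(Fnl a, Vct a)\<close>, where
    the arc norm will be at most 1, and on \<open>(Vct a, Fnl b)\<close> the logarithm of the
    modulus of the pairing, which is nonzero on arcs of \<open>D\<close>. With the constants of the
    bases this makes up \<open>L\<close>, which is fixed before \<open>g\<close>.\<close>
  define \<delta> where "\<delta> = (\<lambda>(s, t). case s of Fnl a \<Rightarrow> 0 | Vct a \<Rightarrow> ln (cmod (w t \<bullet> v a)))"
  define L where "L = (\<Sum>e\<in>arcs D. real_of_int (\<phi> e) * \<delta> e)
    - (\<Sum>i\<in>verts Q. (\<Sum>l = 1..nat (pos \<sigma> i). ln (K (i, l))) + (\<Sum>l = 1..nat (neg \<sigma> i). ln (K' (i, l))))"

  have bound: "exp L \<le> cmod (character Q \<sigma> g)"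
    if g: "g \<in> GL Q \<alpha>" and small: "\<And>a. a \<in> arcs Q \<Longrightarrow> (arc_norm g a)\<^sup>2 \<le> 1" for g
  proof -
    define N where "N s = (case s of Fnl a \<Rightarrow> vnorm ((ginv g (tail Q a))\<^sup>T *\<^sub>v f a)
      | Vct a \<Rightarrow> vnorm (g (head Q a) *\<^sub>v v a))" for s
    have N_plus: "N s = vnorm ((ginv g i)\<^sup>T *\<^sub>v w s)" if "s \<in> S_plus Q i" for s i
      using that by (auto simp: N_def in_S_plus)
    have N_minus: "N s = vnorm (g i *\<^sub>v w s)" if "s \<in> S_minus Q i" for s i
      using that by (auto simp: N_def in_S_minus)
    have N_pos: "0 < N s" if "s \<in> verts D" for s
    proof -
      show ?thesis
      proof (cases s)
        case (Fnl a)
        with that have a: "a \<in> arcs Q" by (simp add: node_in_verts_D)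
        note l = GL_D[OF g ends_in_verts(2)[OF a]]
        have "(g (tail Q a))\<^sup>T * (ginv g (tail Q a))\<^sup>T = 1\<^sub>m (\<alpha> (tail Q a))"
          using transpose_mult[OF l(2) l(1)] l(4) by simp
        moreover have "f a \<in> carrier_vec (\<alpha> (tail Q a))" "f a \<noteq> 0\<^sub>v (\<alpha> (tail Q a))"
          using factors a by (auto simp: rank_one_factors_def)
        ultimately have "(ginv g (tail Q a))\<^sup>T *\<^sub>v f a \<noteq> 0\<^sub>v (\<alpha> (tail Q a))"
          using l by (intro mult_mat_vec_nonzero[of "(g (tail Q a))\<^sup>T"]) auto
        moreover have "(ginv g (tail Q a))\<^sup>T *\<^sub>v f a \<in> carrier_vec (\<alpha> (tail Q a))"
          using l by (simp add: carrier_vecI)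
        ultimately show ?thesis unfolding N_def Fnl by (simp add: vnorm_pos)
      next
        case (Vct a)
        with that have a: "a \<in> arcs Q" by (simp add: node_in_verts_D)
        note h = GL_D[OF g ends_in_verts(1)[OF a]]
        have "v a \<in> carrier_vec (\<alpha> (head Q a))" "v a \<noteq> 0\<^sub>v (\<alpha> (head Q a))"
          using factors a by (auto simp: rank_one_factors_def)
        then have "g (head Q a) *\<^sub>v v a \<noteq> 0\<^sub>v (\<alpha> (head Q a))"
          by (rule mult_mat_vec_nonzero[OF h(4) h(1,2)])
        moreover have "g (head Q a) *\<^sub>v v a \<in> carrier_vec (\<alpha> (head Q a))"
          using h by (simp add: carrier_vecI)
        ultimately show ?thesis unfolding N_def Vct by (simp add: vnorm_pos)
      qed
    qed
    \<comment> \<open>With opposite signs on the two kinds of nodes, the drop along an arc of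
      \<open>D\<close> is, up to sign, the logarithm of a product of norms: negative sign on
      \<open>(Fnl a, Vct a)\<close>, positive on \<open>(Vct a, Fnl b)\<close>.\<close>
    define p where "p s = (case s of Fnl a \<Rightarrow> - ln (N s) | Vct a \<Rightarrow> ln (N s))" for s
    have p_arc: "\<delta> e \<le> p (fst e) - p (snd e)" if "e \<in> arcs D" for e
      using that unfolding arcs_D
    proof (elim UnE CollectE exE conjE)
      fix a assume e: "e = (Fnl a, Vct a)" and a: "a \<in> arcs Q"
      have Np: "0 < N (Fnl a)" "0 < N (Vct a)" using a N_pos by (auto simp: node_in_verts_D)
      have "(N (Vct a) * N (Fnl a))\<^sup>2 \<le> 1"
        using small[OF a] unfolding arc_norm_eq[OF g a] by (simp add: N_def)
      then have "N (Vct a) * N (Fnl a) \<le> 1" using Np by (simp add: power2_le_iff_abs_le abs_square_le_1)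
      then have "ln (N (Vct a) * N (Fnl a)) \<le> 0" using Np by simp
      then show ?thesis using Np e by (simp add: p_def \<delta>_def ln_mult)
    next
      fix a b assume e: "e = (Vct a, Fnl b)" and a: "a \<in> arcs Q" and b: "b \<in> arcs Q"
        and hb: "head Q a = tail Q b" and nz: "f b \<bullet> v a \<noteq> 0"
      have Np: "0 < N (Fnl b)" "0 < N (Vct a)" using a b N_pos by (auto simp: node_in_verts_D)
      note l = GL_D[OF g ends_in_verts(2)[OF b]]
      have va: "v a \<in> carrier_vec (\<alpha> (tail Q b))" using v_carrier[OF a] hb by simp
      \<comment> \<open>The pairing is invariant under \<open>g\<close>, so Cauchy-Schwarz for the
        transformed vectors bounds the original value.\<close>
      have "f b \<bullet> v a = f b \<bullet> ((ginv g (tail Q b) * g (tail Q b)) *\<^sub>v v a)" using l va by simp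
      also have "\<dots> = f b \<bullet> (ginv g (tail Q b) *\<^sub>v (g (tail Q b) *\<^sub>v v a))"
        using l va by (subst assoc_mult_mat_vec) auto
      also have "\<dots> = ((ginv g (tail Q b))\<^sup>T *\<^sub>v f b) \<bullet> (g (tail Q b) *\<^sub>v v a)"
        using l va f_carrier[OF b] by (subst transpose_vec_mult_scalar[of _ "\<alpha> (tail Q b)" "\<alpha> (tail Q b)"]) auto
      also have "cmod \<dots> \<le> N (Fnl b) * N (Vct a)"
        unfolding N_def node.case hb using l va f_carrier[OF b]
        by (intro scalar_prod_le_vnorm[of _ "\<alpha> (tail Q b)"]) auto
      finally have "ln (cmod (f b \<bullet> v a)) \<le> ln (N (Fnl b) * N (Vct a))"
        using nz Np by (subst ln_le_cancel_iff) simp_all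
      then show ?thesis using Np e by (simp add: p_def \<delta>_def ln_mult)
    qed
    have sum_ind: "(\<Sum>s\<in>Y. (\<Sum>l\<in>J. indicator (C l) s) * h s) = (\<Sum>l\<in>J. \<Sum>s\<in>C l. h s)"
      if "finite Y" "\<And>l. l \<in> J \<Longrightarrow> C l \<subseteq> Y"
      for Y :: "'a node set" and J :: "nat set" and C and h :: "'a node \<Rightarrow> real"
    proof -
      have "(\<Sum>s\<in>Y. (\<Sum>l\<in>J. indicator (C l) s) * h s) = (\<Sum>l\<in>J. \<Sum>s\<in>Y. indicator (C l) s * h s)"
        unfolding sum_distrib_right by (rule sum.swap)
      also have "\<dots> = (\<Sum>l\<in>J. \<Sum>s\<in>C l. h s)"
      proof (rule sum.cong[OF refl])
        fix l assume "l \<in> J"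
        then have "Y \<inter> C l = C l" using that by blast
        then show "(\<Sum>s\<in>Y. indicator (C l) s * h s) = (\<Sum>s\<in>C l. h s)"
          using sum.inter_restrict[OF that(1), of h "C l"] by (auto simp: indicator_def intro!: sum.cong)
      qed
      finally show ?thesis .
    qed
    \<comment> \<open>Up to the constants, a base of functionals bounds ln |det g| from below,
      because the inverse transpose has determinant 1 / det g, and a base of vectors bounds it from
      above. With \<open>pos \<sigma> i\<close> bases of the first kind and
      \<open>neg \<sigma> i\<close> of the second, the coefficients combine to \<sigma>(i).\<close>
    have vertex: "(\<Sum>s\<in>S_plus Q i. real_of_int (boundary D \<phi> s) * p s) + (\<Sum>s\<in>S_minus Q i. real_of_int (boundary D \<phi> s) * p s)
        - ((\<Sum>l = 1..nat (pos \<sigma> i). ln (K (i, l))) + (\<Sum>l = 1..nat (neg \<sigma> i). ln (K' (i, l))))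
        \<le> of_int (\<sigma> i) * ln (cmod (det (g i)))" if i: "i \<in> verts Q" for i
    proof -
      note D = GL_D[OF g i]
      have dpos: "0 < cmod (det (g i))" "0 < cmod (det (ginv g i))" using D(5) by auto
      have lninv: "ln (cmod (det (ginv g i))) = - ln (cmod (det (g i)))"
        using D(5) ln_mult_pos[OF dpos] by (simp flip: norm_mult)
      have plus: "- (\<Sum>s\<in>B i l. ln (N s)) - ln (K (i, l)) \<le> ln (cmod (det (g i)))" if l: "l \<in> {1..nat (pos \<sigma> i)}" for l
      proof -
        have x: "(i, l) \<in> ?I" using i l by simp
        have sub: "B i l \<subseteq> S_plus Q i" using Bs i l by (auto simp: mbases_def)
        have Np: "\<And>s. s \<in> B i l \<Longrightarrow> 0 < N s" using sub i N_pos by (auto simp: verts_D)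
        have "cmod (det ((ginv g i)\<^sup>T)) \<le> K (i, l) * (\<Prod>s\<in>B i l. vnorm ((ginv g i)\<^sup>T *\<^sub>v w s))"
          using bspec[OF K x] D by simp
        also have "(\<Prod>s\<in>B i l. vnorm ((ginv g i)\<^sup>T *\<^sub>v w s)) = (\<Prod>s\<in>B i l. N s)"
          using sub N_plus by (intro prod.cong) auto
        finally have "ln (cmod (det (ginv g i))) \<le> ln (K (i, l) * (\<Prod>s\<in>B i l. N s))"
          using dpos D bspec[OF K x] Np by (subst ln_le_cancel_iff) (auto simp: det_transpose[of _ "\<alpha> i"] intro!: prod_pos mult_pos_pos)
        also have "\<dots> = ln (K (i, l)) + (\<Sum>s\<in>B i l. ln (N s))"
        proof -
          have "\<And>s. s \<in> B i l \<Longrightarrow> N s \<noteq> 0" using Np by force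
          moreover have "(\<Prod>s\<in>B i l. N s) > 0" using Np by (intro prod_pos) auto
          ultimately show ?thesis
            using bspec[OF K x] Np finite_subset[OF sub] by (subst ln_mult_pos) (auto simp: ln_prod)
        qed
        finally show ?thesis using lninv by simp
      qed
      have minus: "ln (cmod (det (g i))) \<le> (\<Sum>s\<in>B' i l. ln (N s)) + ln (K' (i, l))" if l: "l \<in> {1..nat (neg \<sigma> i)}" for l
      proof -
        have x: "(i, l) \<in> ?I'" using i l by simp
        have sub: "B' i l \<subseteq> S_minus Q i" using B's i l by (auto simp: mbases_def)
        have Np: "\<And>s. s \<in> B' i l \<Longrightarrow> 0 < N s" using sub i N_pos by (auto simp: verts_D)
        have "cmod (det (g i)) \<le> K' (i, l) * (\<Prod>s\<in>B' i l. vnorm (g i *\<^sub>v w s))"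
          using bspec[OF K' x] D by simp
        also have "(\<Prod>s\<in>B' i l. vnorm (g i *\<^sub>v w s)) = (\<Prod>s\<in>B' i l. N s)"
          using sub N_minus by (intro prod.cong) auto
        finally have "ln (cmod (det (g i))) \<le> ln (K' (i, l) * (\<Prod>s\<in>B' i l. N s))"
          using dpos bspec[OF K' x] Np by (subst ln_le_cancel_iff) (auto intro!: prod_pos mult_pos_pos)
        also have "\<dots> = ln (K' (i, l)) + (\<Sum>s\<in>B' i l. ln (N s))"
        proof -
          have "\<And>s. s \<in> B' i l \<Longrightarrow> N s \<noteq> 0" using Np by force
          moreover have "(\<Prod>s\<in>B' i l. N s) > 0" using Np by (intro prod_pos) auto
          ultimately show ?thesis
            using bspec[OF K' x] Np finite_subset[OF sub] by (subst ln_mult_pos) (auto simp: ln_prod)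
        qed
        finally show ?thesis by simp
      qed
      have "(\<Sum>s\<in>S_plus Q i. real_of_int (boundary D \<phi> s) * p s)
          = (\<Sum>s\<in>S_plus Q i. (\<Sum>l = 1..nat (pos \<sigma> i). indicator (B i l) s) * - ln (N s))"
      proof (rule sum.cong[OF refl])
        fix s assume s: "s \<in> S_plus Q i"
        then have "boundary D \<phi> s = (\<Sum>l = 1..nat (pos \<sigma> i). indicator (B i l) s)" using Bs i by blast
        moreover have "p s = - ln (N s)" using s by (auto simp: p_def in_S_plus)
        ultimately show "real_of_int (boundary D \<phi> s) * p s = (\<Sum>l = 1..nat (pos \<sigma> i). indicator (B i l) s) * - ln (N s)"
          by (simp add: indicator_def of_bool_def if_distrib cong: if_cong)
      qed
      also have "\<dots> = (\<Sum>l = 1..nat (pos \<sigma> i). \<Sum>s\<in>B i l. - ln (N s))"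
        using Bs i by (intro sum_ind) (auto simp: mbases_def)
      finally have 1: "(\<Sum>s\<in>S_plus Q i. real_of_int (boundary D \<phi> s) * p s)
          = (\<Sum>l = 1..nat (pos \<sigma> i). - (\<Sum>s\<in>B i l. ln (N s)))" by (simp add: sum_negf)
      have "(\<Sum>s\<in>S_minus Q i. real_of_int (boundary D \<phi> s) * p s)
          = (\<Sum>s\<in>S_minus Q i. (\<Sum>l = 1..nat (neg \<sigma> i). indicator (B' i l) s) * - ln (N s))"
      proof (rule sum.cong[OF refl])
        fix s assume s: "s \<in> S_minus Q i"
        then have "boundary D \<phi> s = - (\<Sum>l = 1..nat (neg \<sigma> i). indicator (B' i l) s)" using B's i by blast
        moreover have "p s = ln (N s)" using s by (auto simp: p_def in_S_minus)
        ultimately show "real_of_int (boundary D \<phi> s) * p s = (\<Sum>l = 1..nat (neg \<sigma> i). indicator (B' i l) s) * - ln (N s)"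
          by (simp add: indicator_def of_bool_def if_distrib cong: if_cong)
      qed
      also have "\<dots> = (\<Sum>l = 1..nat (neg \<sigma> i). \<Sum>s\<in>B' i l. - ln (N s))"
        using B's i by (intro sum_ind) (auto simp: mbases_def)
      finally have 2: "(\<Sum>s\<in>S_minus Q i. real_of_int (boundary D \<phi> s) * p s)
          = (\<Sum>l = 1..nat (neg \<sigma> i). - (\<Sum>s\<in>B' i l. ln (N s)))" by (simp add: sum_negf)
      have "(\<Sum>l = 1..nat (pos \<sigma> i). - (\<Sum>s\<in>B i l. ln (N s)) - ln (K (i, l)))
          \<le> (\<Sum>l = 1..nat (pos \<sigma> i). ln (cmod (det (g i))))"
        by (intro sum_mono plus)
      moreover have "(\<Sum>l = 1..nat (neg \<sigma> i). - (\<Sum>s\<in>B' i l. ln (N s)) - ln (K' (i, l)))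
          \<le> (\<Sum>l = 1..nat (neg \<sigma> i). - ln (cmod (det (g i))))"
        using minus by (intro sum_mono) fastforce
      ultimately have "(\<Sum>l = 1..nat (pos \<sigma> i). - (\<Sum>s\<in>B i l. ln (N s)) - ln (K (i, l)))
          + (\<Sum>l = 1..nat (neg \<sigma> i). - (\<Sum>s\<in>B' i l. ln (N s)) - ln (K' (i, l)))
          \<le> of_int (pos \<sigma> i) * ln (cmod (det (g i))) - of_int (neg \<sigma> i) * ln (cmod (det (g i)))" by simp
      also have "\<dots> = of_int (\<sigma> i) * ln (cmod (det (g i)))"
      proof -
        have "pos \<sigma> i - neg \<sigma> i = \<sigma> i" by (simp add: pos_def neg_def)
        then show ?thesis by (simp only: left_diff_distrib[symmetric] of_int_diff[symmetric])
      qed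
      finally show ?thesis unfolding 1 2 by (simp add: sum_subtractf)
    qed
    have "(\<Sum>e\<in>arcs D. real_of_int (\<phi> e) * \<delta> e) \<le> (\<Sum>e\<in>arcs D. real_of_int (\<phi> e) * (p (fst e) - p (snd e)))"
      using \<phi> p_arc by (intro sum_mono mult_left_mono) auto
    also have "\<dots> = (\<Sum>s\<in>verts D. boundary D (\<lambda>e. real_of_int (\<phi> e)) s * p s)"
      using D.sum_boundary_mult[of "\<lambda>e. real_of_int (\<phi> e)" p] by simp
    also have "\<dots> = (\<Sum>s\<in>verts D. real_of_int (boundary D \<phi> s) * p s)"
      by (simp add: boundary_def)
    also have "\<dots> = (\<Sum>i\<in>verts Q. (\<Sum>s\<in>S_plus Q i. real_of_int (boundary D \<phi> s) * p s)
        + (\<Sum>s\<in>S_minus Q i. real_of_int (boundary D \<phi> s) * p s))"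
    proof -
      have "S_plus Q i \<inter> verts D = S_plus Q i" "S_minus Q i \<inter> verts D = S_minus Q i" if "i \<in> verts Q" for i
        using that by (auto simp: verts_D)
      then show ?thesis by (subst sum_verts_D) (auto intro!: sum.cong)
    qed
    finally have "L \<le> (\<Sum>i\<in>verts Q. (\<Sum>s\<in>S_plus Q i. real_of_int (boundary D \<phi> s) * p s)
        + (\<Sum>s\<in>S_minus Q i. real_of_int (boundary D \<phi> s) * p s)
        - ((\<Sum>l = 1..nat (pos \<sigma> i). ln (K (i, l))) + (\<Sum>l = 1..nat (neg \<sigma> i). ln (K' (i, l)))))"
      unfolding L_def sum_subtractf by linarith
    also have "\<dots> \<le> (\<Sum>i\<in>verts Q. of_int (\<sigma> i) * ln (cmod (det (g i))))"
      by (intro sum_mono vertex)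
    finally have "L \<le> (\<Sum>i\<in>verts Q. of_int (\<sigma> i) * ln (cmod (det (g i))))" .
    then have "exp L \<le> exp (\<Sum>i\<in>verts Q. of_int (\<sigma> i) * ln (cmod (det (g i))))" by simp
    also have "\<dots> = (\<Prod>i\<in>verts Q. cmod (det (g i)) powi \<sigma> i)"
      unfolding exp_sum[OF finite_verts]
    proof (rule prod.cong[OF refl])
      fix i assume "i \<in> verts Q"
      then have "0 < cmod (det (g i))" using GL_D(6)[OF g] by simp
      then show "exp (of_int (\<sigma> i) * ln (cmod (det (g i)))) = cmod (det (g i)) powi \<sigma> i"
        by (simp add: powr_real_of_int'[symmetric] powr_def)
    qed
    also have "\<dots> = cmod (character Q \<sigma> g)"
      by (simp add: character_def prod_norm[symmetric] norm_power_int)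
    finally show ?thesis .
  qed
  \<comment> \<open>Either a single arc already contributes at least 1, or all arcs are in the range
    where the bound for the character applies.\<close>
  have "min 1 ((exp L)\<^sup>2) \<le> energy g" if g: "g \<in> GL Q \<alpha>" for g
  proof (cases "\<forall>a\<in>arcs Q. (arc_norm g a)\<^sup>2 \<le> 1")
    case True
    then have "(exp L)\<^sup>2 \<le> (cmod (character Q \<sigma> g))\<^sup>2" using bound[OF g] by (intro power_mono) auto
    moreover have "0 \<le> (\<Sum>a\<in>arcs Q. (arc_norm g a)\<^sup>2)" by (intro sum_nonneg) auto
    ultimately show ?thesis by linarith
  next
    case False
    then obtain a where a: "a \<in> arcs Q" "1 \<le> (arc_norm g a)\<^sup>2" by force
    then have "1 \<le> (\<Sum>a\<in>arcs Q. (arc_norm g a)\<^sup>2)"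
      using member_le_sum[of a "arcs Q" "\<lambda>a. (arc_norm g a)\<^sup>2"] by simp
    moreover have "0 \<le> (cmod (character Q \<sigma> g))\<^sup>2" by simp
    ultimately show ?thesis by linarith
  qed
  then show ?thesis unfolding semistable_iff by (intro exI[of _ "min 1 ((exp L)\<^sup>2)"]) auto
qed

end

theorem theorem5p8:
  fixes Q :: "('v, 'a) pre_digraph" and \<alpha> :: "'v \<Rightarrow> nat" and \<sigma> :: "'v \<Rightarrow> int"
    and V :: "'a \<Rightarrow> complex mat" and v f :: "'a \<Rightarrow> complex vec"
  assumes "fin_digraph Q" and "acyclic_quiver Q"
    and "rank_one_rep Q \<alpha> V"
    and "rank_one_factors Q \<alpha> V v f"
  shows "(semistable Q \<alpha> V \<sigma> \<longleftrightarrow> cond_K1 Q \<alpha> \<sigma> \<and> cond_F Q \<alpha> v f \<sigma> \<and> cond_S Q \<alpha> v f \<sigma>) \<and>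
         (semistable Q \<alpha> V \<sigma> \<longleftrightarrow> cond_K1 Q \<alpha> \<sigma> \<and> cond_F Q \<alpha> v f \<sigma> \<and> cond_S' Q \<alpha> v f \<sigma>)"
proof -
  interpret fin_digraph Q by fact
  interpret rank_one_quiver Q \<alpha> \<sigma> V v f
    using assms by unfold_locales
  \<comment> \<open>Under (K1) and (F) the implications close up: the cut condition gives (S)',
    which gives (S) and semistability, and each of these gives back the cut condition.\<close>
  show ?thesis
    using semistable_imp_K1 semistable_imp_F semistable_imp_cut_condition cut_condition_imp_cond_S'
      cond_S'_imp_cond_S cond_S_imp_cut_condition cond_S'_imp_semistable by blast
qed

end
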